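(* For all $d\ge 2$, $$\mathfrak{c}_d^{\mathrm{cone}}\le \bigl\lceil\sqrt{d-1}\,\bigr\rceil(d-1)\,\frac{d(d+1)}{2}\Bigl(\frac32\Bigr)^{\lceil\sqrt{d-1}\rceil(d-1)-2}.$$
   Context: Cones are subsets of $\mathbb{R}^d$ closed under nonnegative linear combinations; all cones are assumed polyhedral, rational (generated by finitely many rational vectors) and pointed. For such a cone $C$, $\mathrm{Hilb}(C)$ is the unique minimal finite generating set of the semigroup $C\cap\mathbb{Z}^d$. The extreme integral generators of $C$ are the generators of the semigroups $l\cap\mathbb{Z}^d\cong\mathbb{Z}_+$ for the edges $l$ of $C$. $\Delta_C$ is the convex hull of $O$ and the extreme integral generators of $C$. $C$ is simplicial if it has a linearly independent generating system; a unimodular cone is a simplicial rational cone $C$ such that $\Delta_C$ is a unimodular simplex (multiplicity of a lattice simplex with vertices $v_0,\dots,v_e$: index of the subgroup $U$ generated by $v_i-v_0$ in the smallest direct summand of $\mathbb{Z}^d$ containing $U$; unimodular means multiplicity $1$). A unimodular cover of $C$ is a finite family of unimodular cones whose union is $C$. For $c\ge0$, $c\Delta_C$ is the dilate of $\Delta_C$ by $c$ with center $O$. $\mathfrak{c}_d^{\mathrm{cone}}$ is the infimum of natural numbers $c$ such that every rational $d$-dimensional cone $C\subset\mathbb{R}^d$ admits a unimodular cover $C=\bigcup_{j=1}^k C_j$ with $\mathrm{Hilb}(C_j)\subset c\Delta_C$ for all $j$. *)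

theory Defs
  imports "HOL-Analysis.Analysis"
begin

definition lattice_pts :: "(real^'n) set" where
  "lattice_pts = {x. \<forall>i. x $ i \<in> \<int>}"

definition rational_vec :: "real^'n \<Rightarrow> bool" where
  "rational_vec x \<longleftrightarrow> (\<forall>i. x $ i \<in> \<rat>)"

definition nonneg_span :: "(real^'n) set \<Rightarrow> (real^'n) set" where
  "nonneg_span S = {x. \<exists>a. (\<forall>v\<in>S. a v \<ge> 0) \<and> x = (\<Sum>v\<in>S. a v *\<^sub>R v)}"

definition rational_cone :: "(real^'n) set \<Rightarrow> bool" where
  "rational_cone C \<longleftrightarrow>
     (\<exists>S. finite S \<and> (\<forall>v\<in>S. rational_vec v) \<and> C = nonneg_span S)
     \<and> C \<inter> uminus ` C = {0}"

definition monoid_gen :: "(real^'n) set \<Rightarrow> (real^'n) set" where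
  "monoid_gen H = {x. \<exists>F k. finite F \<and> F \<subseteq> H \<and> x = (\<Sum>v\<in>F. real (k v) *\<^sub>R v)}"

definition gen_set_of :: "(real^'n) set \<Rightarrow> (real^'n) set \<Rightarrow> bool" where
  "gen_set_of C H \<longleftrightarrow> finite H \<and> H \<subseteq> C \<inter> lattice_pts \<and> monoid_gen H = C \<inter> lattice_pts"

definition Hilb :: "(real^'n) set \<Rightarrow> (real^'n) set" where
  "Hilb C = (THE H. gen_set_of C H \<and> \<not> (\<exists>H'. H' \<subset> H \<and> gen_set_of C H'))"

definition extreme_gens :: "(real^'n) set \<Rightarrow> (real^'n) set" where
  "extreme_gens C = {v. \<exists>l. l face_of C \<and> aff_dim l = 1 \<and> v \<in> l \<inter> lattice_pts \<and> v \<noteq> 0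
       \<and> l \<inter> lattice_pts = {real k *\<^sub>R v | k. True}}"

definition Delta :: "(real^'n) set \<Rightarrow> (real^'n) set" where
  "Delta C = convex hull (insert 0 (extreme_gens C))"

definition dilate :: "real \<Rightarrow> (real^'n) set \<Rightarrow> (real^'n) set" where
  "dilate c A = (\<lambda>x. c *\<^sub>R x) ` A"

definition simplicial :: "(real^'n) set \<Rightarrow> bool" where
  "simplicial C \<longleftrightarrow> (\<exists>S. independent S \<and> C = nonneg_span S)"

definition int_span :: "(real^'n) set \<Rightarrow> (real^'n) set" where
  "int_span V = {x. \<exists>F k. finite F \<and> F \<subseteq> V \<and> x = (\<Sum>v\<in>F. real_of_int (k v) *\<^sub>R v)}"

definition lattice_subgroup :: "(real^'n) set \<Rightarrow> bool" where
  "lattice_subgroup L \<longleftrightarrow> L \<subseteq> lattice_pts \<and> 0 \<in> L \<and> (\<forall>x\<in>L. \<forall>y\<in>L. x + y \<in> L \<and> - x \<in> L)"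

definition direct_summand :: "(real^'n) set \<Rightarrow> bool" where
  "direct_summand L \<longleftrightarrow> lattice_subgroup L \<and>
     (\<exists>M. lattice_subgroup M \<and> L \<inter> M = {0} \<and> (\<forall>z\<in>lattice_pts. \<exists>a\<in>L. \<exists>b\<in>M. z = a + b))"

definition smallest_summand :: "(real^'n) set \<Rightarrow> (real^'n) set" where
  "smallest_summand U = (THE S. direct_summand S \<and> U \<subseteq> S \<and>
       (\<forall>S'. direct_summand S' \<and> U \<subseteq> S' \<longrightarrow> S \<subseteq> S'))"

definition simplex_mult :: "real^'n \<Rightarrow> (real^'n) set \<Rightarrow> nat" where
  "simplex_mult v0 V = (let U = int_span ((\<lambda>v. v - v0) ` V)
      in card ((\<lambda>x. (+) x ` U) ` smallest_summand U))"

definition unimodular_simplex :: "(real^'n) set \<Rightarrow> bool" where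
  "unimodular_simplex W \<longleftrightarrow> finite W \<and> W \<noteq> {} \<and> W \<subseteq> lattice_pts \<and> \<not> affine_dependent W
     \<and> (\<forall>v0\<in>W. simplex_mult v0 (W - {v0}) = 1)"

definition unimodular_cone :: "(real^'n) set \<Rightarrow> bool" where
  "unimodular_cone C \<longleftrightarrow> simplicial C \<and> rational_cone C \<and>
     unimodular_simplex (insert 0 (extreme_gens C))"

definition has_bounded_unimod_cover :: "(real^'n) set \<Rightarrow> nat \<Rightarrow> bool" where
  "has_bounded_unimod_cover C c \<longleftrightarrow>
     (\<exists>F. finite F \<and> \<Union>F = C \<and>
        (\<forall>Cj\<in>F. unimodular_cone Cj \<and> Hilb Cj \<subseteq> dilate (real c) (Delta C)))"

text \<open>The constant c_d^cone for d = CARD('n), as an extended real (+\<infinity> if no c works).\<close>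
definition c_cone :: "('n::finite) itself \<Rightarrow> ereal" where
  "c_cone _ = Inf {ereal (real c) | c. \<forall>C :: (real^'n) set.
       rational_cone C \<and> aff_dim C = int CARD('n) \<longrightarrow> has_bounded_unimod_cover C c}"

end

(*
  Write deg_V for the coordinate sum with respect to a linearly independent set V of lattice vectors.
  A simplicial cone over V that is not unimodular contains a nonzero lattice point x of the half-open
  parallelepiped spanned by V. Starring the cone at x replaces one generator by x and strictly
  decreases the number of lattice points in the parallelepiped.  Since x or its complement in the
  parallelepiped has at most half the total degree of the generators, a cone of multiplicity mu is
  refined to unimodular ones with the degrees growing only by a factor of order (3/2)^(mu - 2).

  So it suffices to reach multiplicity d with degrees polynomial in d.  Starring at lattice points of
  degree at most 1 one may assume that conv(0, V) contains no further lattice points.  Given p in the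
  cone, let v be the generator with the largest coordinate in p.  By induction on the dimension the
  projection of p along v lies in a unimodular cone of the quotient lattice; lifting its generators so
  that their v-coordinates xi lie in [0, 1) gives a lattice basis consisting of v and lifts w.
  If p is in the cone of this basis we are done.  Otherwise let delta be the degree of the projected w.
  The lifts with delta > (d - 1) xi are kept and subtracted from p; for the others emptiness gives
  xi + delta >= 1, and this forces the v-coordinate of the remaining part q, scaled to coefficient
  sum d, to be at least 1.  In the slice of coefficient sum d the point q lies in a simplex of the Kuhn
  triangulation adapted to the ordering of the basis by v-coordinate: along such a simplex the
  v-coordinate varies by at most 1, so the simplex stays in the cone, and the cone over it has
  multiplicity at most d.
*)
theory Submission
  imports Defs
begin

section \<open>Coordinates and simplicial cones\<close>

text \<open>The multiplicity of a simplicial cone is not bounded in terms of the dimension, and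
  starring down to multiplicity 1 costs a factor exponential in the multiplicity. Hence that process
  may only be started once the multiplicity is at most the dimension. Starring at points of degree
  at most 1 is free but gets stuck at empty simplices, which need not be unimodular from dimension 3
  on; this is what forces the passage to quotients. A quotient controls a point only up to multiples
  of v, and so a negative coefficient of v is the one thing that can go wrong after lifting.

  The whole argument treats one point p at a time. The basis found depends on p, but its members are
  lattice points of bounded degree over finitely many sets of generators, so finitely many cones
  suffice for the cover.

  On the constant: each star multiplies the degree sum by at most 3/2 and lowers the multiplicity;
  the last star happens at multiplicity at least 2 and uses a point of at most half the sum. For m
  generators of degree at most B this gives m B / 2 times (3/2)^(m - 2). The stated bound has room
  for it, its exponent being at least 2 (d - 2) for d >= 3.\<close>

definition coord :: "(real^'n) set \<Rightarrow> real^'n \<Rightarrow> real^'n \<Rightarrow> real" where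
  "coord V v = (SOME f. linear f \<and> (\<forall>u\<in>V. f u = (if u = v then 1 else 0)))"

definition deg :: "(real^'n) set \<Rightarrow> real^'n \<Rightarrow> real" where
  "deg V x = (\<Sum>v\<in>V. coord V v x)"

text \<open>
  \<^term>\<open>coord V v\<close> is linear on the whole space, but its values are determined only on the span of \<open>V\<close>.
\<close>

lemma coord_spec:
  fixes V :: "(real^'n) set"
  assumes "independent V"
  shows "linear (coord V v) \<and> (\<forall>u\<in>V. coord V v u = (if u = v then 1 else 0))"
proof -
  have "\<exists>f :: real^'n \<Rightarrow> real. linear f \<and> (\<forall>u\<in>V. f u = (if u = v then 1 else 0))"
    using linear_independent_extend[OF assms, of "\<lambda>u. if u = v then 1 else 0"] by blast
  from someI_ex[OF this] show ?thesis unfolding coord_def .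
qed

lemma linear_coord: "independent V \<Longrightarrow> linear (coord V v)"
  using coord_spec by blast

lemma coord_basis: "independent V \<Longrightarrow> u \<in> V \<Longrightarrow> coord V v u = (if u = v then 1 else 0)"
  using coord_spec by blast

lemma linear_deg: "independent V \<Longrightarrow> linear (deg V)"
  unfolding deg_def by (intro linear_compose_sum ballI linear_coord)

lemma indep_finite: "independent (V :: (real^'n) set) \<Longrightarrow> finite V"
  by (rule finiteI_independent)

lemma deg_basis: "independent V \<Longrightarrow> v \<in> V \<Longrightarrow> deg V v = 1"
  unfolding deg_def by (simp add: coord_basis indep_finite)

lemma linear_lincomb: "linear f \<Longrightarrow> f (\<Sum>v\<in>S. a v *\<^sub>R v) = (\<Sum>v\<in>S. a v * f v)" for f :: "real^'n \<Rightarrow> real"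
  by (simp add: linear_sum linear_scale)

lemma coord_lincomb:
  assumes "independent V" "v \<in> V"
  shows "coord V v (\<Sum>u\<in>V. a u *\<^sub>R u) = a v"
proof -
  have "coord V v (\<Sum>u\<in>V. a u *\<^sub>R u) = (\<Sum>u\<in>V. a u * coord V v u)"
    by (rule linear_lincomb[OF linear_coord[OF assms(1)]])
  also have "\<dots> = (\<Sum>u\<in>V. if u = v then a u else 0)"
    by (rule sum.cong) (auto simp: coord_basis[OF assms(1)])
  finally show ?thesis using assms by (simp add: indep_finite)
qed

lemma span_lincomb:
  assumes "independent V" "x \<in> span V"
  shows "x = (\<Sum>v\<in>V. coord V v x *\<^sub>R v)"
proof -
  obtain a where a: "x = (\<Sum>v\<in>V. a v *\<^sub>R v)"
    using assms(2) span_finite[OF indep_finite[OF assms(1)]] by auto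
  have "(\<Sum>v\<in>V. coord V v x *\<^sub>R v) = (\<Sum>v\<in>V. a v *\<^sub>R v)"
    by (rule sum.cong) (auto simp: a coord_lincomb[OF assms(1)])
  then show ?thesis using a by simp
qed

lemma linear_eq_coord:
  fixes f :: "real^'n \<Rightarrow> real"
  assumes "independent V" "linear f" "x \<in> span V"
  shows "f x = (\<Sum>v\<in>V. coord V v x * f v)"
  by (subst span_lincomb[OF assms(1,3)]) (rule linear_lincomb[OF assms(2)])

lemma linear_eq_on_span:
  fixes f g :: "real^'n \<Rightarrow> real"
  assumes "linear f" "linear g" "\<And>v. v \<in> V \<Longrightarrow> f v = g v" "x \<in> span V"
  shows "f x = g x"
  using linear_eq_on[OF assms(1,2,4)] assms(3) by blast

lemma coord_eqI:
  assumes "independent V" "x \<in> span V" "y \<in> span V" "\<And>v. v \<in> V \<Longrightarrow> coord V v x = coord V v y"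
  shows "x = y"
  by (subst span_lincomb[OF assms(1,2)], subst span_lincomb[OF assms(1,3)])
     (rule sum.cong, auto simp: assms(4))

lemma nonneg_span_coord:
  assumes "independent V"
  shows "x \<in> nonneg_span V \<longleftrightarrow> x \<in> span V \<and> (\<forall>v\<in>V. 0 \<le> coord V v x)"
proof
  assume "x \<in> nonneg_span V"
  then obtain a where a: "\<forall>v\<in>V. a v \<ge> 0" "x = (\<Sum>v\<in>V. a v *\<^sub>R v)"
    unfolding nonneg_span_def by auto
  have "x \<in> span V" unfolding a(2) by (intro span_sum span_scale span_base)
  then show "x \<in> span V \<and> (\<forall>v\<in>V. 0 \<le> coord V v x)"
    using a by (simp add: coord_lincomb[OF assms])
next
  assume "x \<in> span V \<and> (\<forall>v\<in>V. 0 \<le> coord V v x)"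
  then show "x \<in> nonneg_span V" unfolding nonneg_span_def
    using span_lincomb[OF assms, of x] by auto
qed

section \<open>Closure properties of cones and exchange of one generator\<close>

lemma nonneg_span_add: "x \<in> nonneg_span S \<Longrightarrow> y \<in> nonneg_span S \<Longrightarrow> x + y \<in> nonneg_span S"
proof -
  assume "x \<in> nonneg_span S" "y \<in> nonneg_span S"
  then obtain a b where "\<forall>v\<in>S. a v \<ge> 0" "x = (\<Sum>v\<in>S. a v *\<^sub>R v)" "\<forall>v\<in>S. b v \<ge> 0" "y = (\<Sum>v\<in>S. b v *\<^sub>R v)"
    unfolding nonneg_span_def by auto
  then show ?thesis unfolding nonneg_span_def
    by (auto intro!: exI[of _ "\<lambda>v. a v + b v"] simp: algebra_simps sum.distrib)
qed

lemma nonneg_span_scale: "x \<in> nonneg_span S \<Longrightarrow> 0 \<le> c \<Longrightarrow> c *\<^sub>R x \<in> nonneg_span S"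
proof -
  assume "x \<in> nonneg_span S" "0 \<le> c"
  then obtain a where "\<forall>v\<in>S. a v \<ge> 0" "x = (\<Sum>v\<in>S. a v *\<^sub>R v)"
    unfolding nonneg_span_def by auto
  with \<open>0 \<le> c\<close> show ?thesis unfolding nonneg_span_def
    by (auto intro!: exI[of _ "\<lambda>v. c * a v"] simp: scaleR_sum_right)
qed

lemma nonneg_span_zero: "0 \<in> nonneg_span S"
  unfolding nonneg_span_def by (auto intro!: exI[of _ "\<lambda>v. 0"])

lemma nonneg_span_sum: "(\<And>i. i \<in> I \<Longrightarrow> f i \<in> nonneg_span S) \<Longrightarrow> (\<Sum>i\<in>I. f i) \<in> nonneg_span S"
  by (induction I rule: infinite_finite_induct) (auto simp: nonneg_span_add nonneg_span_zero)

lemma nonneg_span_base: "finite S \<Longrightarrow> v \<in> S \<Longrightarrow> v \<in> nonneg_span S"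
  unfolding nonneg_span_def
  by (auto intro!: exI[of _ "\<lambda>u. if u = v then 1 else 0"] simp: if_distrib[of "\<lambda>c. c *\<^sub>R _"] cong: if_cong)

lemma nonneg_span_subset: "S \<subseteq> nonneg_span U \<Longrightarrow> nonneg_span S \<subseteq> nonneg_span U"
proof
  fix x assume S: "S \<subseteq> nonneg_span U" and "x \<in> nonneg_span S"
  then obtain a where a: "\<forall>v\<in>S. a v \<ge> 0" "x = (\<Sum>v\<in>S. a v *\<^sub>R v)"
    unfolding nonneg_span_def by auto
  show "x \<in> nonneg_span U" unfolding a(2)
    by (rule nonneg_span_sum, rule nonneg_span_scale) (use S a(1) in auto)
qed

lemma nonneg_span_mono: "finite U \<Longrightarrow> S \<subseteq> U \<Longrightarrow> nonneg_span S \<subseteq> nonneg_span U"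
  by (rule nonneg_span_subset) (auto intro: nonneg_span_base)

lemma nonneg_span_span: "nonneg_span S \<subseteq> span S"
  unfolding nonneg_span_def by (clarify, intro span_sum span_scale span_base)

lemma deg_nonneg: "independent V \<Longrightarrow> x \<in> nonneg_span V \<Longrightarrow> 0 \<le> deg V x"
  by (simp add: deg_def nonneg_span_coord sum_nonneg)

text \<open>A simplex pivot: as \<open>coord V v x\<close> is nonzero, the expansion of
  \<open>x\<close> can be solved for \<open>v\<close>, and substitution gives the new coordinates.
  Both formulas are confirmed by linearity, evaluating them on the new basis.\<close>

lemma exchange:
  assumes V: "independent V" "v \<in> V" and x: "x \<in> span V" "coord V v x \<noteq> 0"
  defines "V' \<equiv> insert x (V - {v})"
  shows exchange_independent: "independent V'"
    and exchange_span: "span V' = span V"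
    and exchange_notin: "x \<notin> V - {v}"
    and exchange_coord_new: "\<And>y. y \<in> span V \<Longrightarrow> coord V' x y = coord V v y / coord V v x"
    and exchange_coord_old: "\<And>y u. y \<in> span V \<Longrightarrow> u \<in> V - {v} \<Longrightarrow>
           coord V' u y = coord V u y - coord V u x * (coord V v y / coord V v x)"
proof -
  note lin = linear_coord[OF V(1)] and cb = coord_basis[OF V(1)]
  have lin_div: "linear (\<lambda>y. coord V v y / coord V v x)"
    using linear_compose_scale_right[OF lin[of v], of "inverse (coord V v x)"]
    by (simp add: divide_inverse mult.commute)
  have vanish: "coord V v y = 0" if "y \<in> span (V - {v})" for y
  proof (rule linear_eq_on_span[OF lin linear_zero _ that])
    show "coord V v u = 0" if "u \<in> V - {v}" for u using that cb[of u v] by simp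
  qed
  have xs: "x \<notin> span (V - {v})" using vanish[of x] x(2) by auto
  then show nx: "x \<notin> V - {v}" using span_base[of x "V - {v}"] by blast
  have "independent (V - {v})" using independent_mono[OF V(1)] by blast
  then show ind: "independent V'" unfolding V'_def using xs by (intro independent_insertI)
  have "v \<in> span V'" unfolding V'_def
    by (rule in_span_delete[OF x(1) xs])
  moreover have "V - {v} \<subseteq> span V'" using span_superset[of V'] by (auto simp: V'_def)
  ultimately have "V \<subseteq> span V'" by blast
  moreover have "V' \<subseteq> span V" using x(1) span_superset[of V] by (auto simp: V'_def)
  ultimately show sp: "span V' = span V" by (simp only: span_eq simp_thms)
  have eq: "coord V' w y = f y"
    if f: "linear f" "\<forall>u\<in>V'. f u = (if u = w then 1 else 0)" and y: "y \<in> span V" for f w y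
  proof (rule linear_eq_on_span[OF linear_coord[OF ind] f(1)])
    show "coord V' w u = f u" if "u \<in> V'" for u
      using f(2) that coord_basis[OF ind that, of w] by simp
    show "y \<in> span V'" using y sp by simp
  qed
  show "coord V' x y = coord V v y / coord V v x" if "y \<in> span V" for y
    by (rule eq[OF lin_div _ that]) (use V x(2) in \<open>auto simp: V'_def cb\<close>)
  show "coord V' u y = coord V u y - coord V u x * (coord V v y / coord V v x)"
    if y: "y \<in> span V" and u: "u \<in> V - {v}" for y u
  proof (rule eq[OF _ _ y])
    show "linear (\<lambda>y. coord V u y - coord V u x * (coord V v y / coord V v x))"
      using linear_compose_sub[OF lin linear_compose_scale_right[OF lin_div, of "coord V u x"], of u] by simp
    show "\<forall>w\<in>V'. coord V u w - coord V u x * (coord V v w / coord V v x) = (if w = u then 1 else 0)"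
      using V x(2) u nx by (auto simp: V'_def cb)
  qed
qed

text \<open>The ratio test of linear programming: among the generators occurring in
  \<open>x\<close>, the one with the least quotient of the coordinates of \<open>p\<close> and
  \<open>x\<close> leaves. Every other coordinate of \<open>p\<close> then stays nonnegative after
  the pivot.\<close>

lemma stellar:
  assumes V: "independent V" and p: "p \<in> nonneg_span V" and x: "x \<in> nonneg_span V" "x \<noteq> 0"
  obtains v where "v \<in> V" "0 < coord V v x" "p \<in> nonneg_span (insert x (V - {v}))"
proof -
  define P where "P = {v\<in>V. 0 < coord V v x}"
  have ps: "p \<in> span V" "\<And>v. v \<in> V \<Longrightarrow> 0 \<le> coord V v p"
   and xs: "x \<in> span V" "\<And>v. v \<in> V \<Longrightarrow> 0 \<le> coord V v x"
    using p x nonneg_span_coord[OF V] by auto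
  have "P \<noteq> {}"
  proof
    assume "P = {}"
    then have "coord V v x = coord V v 0" if "v \<in> V" for v
      using xs(2)[OF that] that by (force simp: P_def linear_0[OF linear_coord[OF V]])
    then show False using coord_eqI[OF V xs(1) span_0] x(2) by blast
  qed
  moreover have "finite P" unfolding P_def using indep_finite[OF V] by simp
  ultimately obtain v where v: "v \<in> P"
      and "\<not> (\<exists>u\<in>P. coord V u p / coord V u x < coord V v p / coord V v x)"
    using arg_min_if_finite[of P "\<lambda>u. coord V u p / coord V u x"] by blast
  then have vmin: "coord V v p / coord V v x \<le> coord V u p / coord V u x" if "u \<in> P" for u
    using that by force
  have vV: "v \<in> V" "0 < coord V v x" using v by (auto simp: P_def)
  then have nz: "coord V v x \<noteq> 0" by simp
  note ex = exchange[OF V vV(1) xs(1) nz]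
  have "0 \<le> coord V u p - coord V u x * (coord V v p / coord V v x)" if "u \<in> V - {v}" for u
  proof (cases "u \<in> P")
    case True
    then show ?thesis using vmin[OF True] by (simp add: P_def field_simps)
  next
    case False
    then have "coord V u x = 0" using that xs(2)[of u] by (simp add: P_def)
    then show ?thesis using ps(2) that by simp
  qed
  then have "\<forall>u\<in>insert x (V - {v}). 0 \<le> coord (insert x (V - {v})) u p"
    using ex(4)[OF ps(1)] ex(5)[OF ps(1)] ps(2)[OF vV(1)] vV(2) by simp
  then have "p \<in> nonneg_span (insert x (V - {v}))"
    using ps(1) ex(2) nonneg_span_coord[OF ex(1)] by blast
  then show ?thesis using that vV by blast
qed

section \<open>Lattices and half-open parallelepipeds\<close>

text \<open>In a \<open>lattice_frame\<close> every element of \<open>L\<close> is congruent to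
  exactly one of these points modulo the subgroup generated by \<open>V\<close>, so their number is
  the index of that subgroup, the multiplicity.\<close>

definition box_pts :: "(real^'n) set \<Rightarrow> (real^'n) set \<Rightarrow> (real^'n) set" where
  "box_pts V L = {x\<in>L. \<forall>v\<in>V. 0 \<le> coord V v x \<and> coord V v x < 1}"

definition zsubgroup :: "(real^'n) set \<Rightarrow> bool" where
  "zsubgroup L \<longleftrightarrow> 0 \<in> L \<and> (\<forall>x\<in>L. \<forall>y\<in>L. x - y \<in> L)"

text \<open>Discreteness of \<open>L\<close> is expressed by the finite parallelepiped, a property
  inherited by projections. The induction passes to projected lattices, whose points need not be
  integer vectors, so \<open>L\<close> is kept abstract.\<close>

definition lattice_frame :: "(real^'n) set \<Rightarrow> (real^'n) set \<Rightarrow> bool" where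
  "lattice_frame V L \<longleftrightarrow> independent V \<and> V \<subseteq> L \<and> L \<subseteq> span V \<and> zsubgroup L \<and> finite (box_pts V L)"

definition lattice_basis :: "(real^'n) set \<Rightarrow> (real^'n) set \<Rightarrow> bool" where
  "lattice_basis Y L \<longleftrightarrow> independent Y \<and> Y \<subseteq> L \<and> L \<subseteq> span Y \<and> zsubgroup L \<and>
     (\<forall>x\<in>L. \<forall>y\<in>Y. coord Y y x \<in> \<int>)"

lemma zsubgroupD:
  assumes "zsubgroup L"
  shows zsubgroup_zero: "0 \<in> L"
    and zsubgroup_diff: "\<And>x y. x \<in> L \<Longrightarrow> y \<in> L \<Longrightarrow> x - y \<in> L"
    and zsubgroup_uminus: "\<And>x. x \<in> L \<Longrightarrow> - x \<in> L"
    and zsubgroup_add: "\<And>x y. x \<in> L \<Longrightarrow> y \<in> L \<Longrightarrow> x + y \<in> L"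
proof -
  show z: "0 \<in> L" and d: "\<And>x y. x \<in> L \<Longrightarrow> y \<in> L \<Longrightarrow> x - y \<in> L" using assms by (auto simp: zsubgroup_def)
  show m: "- x \<in> L" if "x \<in> L" for x using d[OF z that] by simp
  show "x + y \<in> L" if "x \<in> L" "y \<in> L" for x y using d[OF that(1) m[OF that(2)]] by simp
qed

lemma zsubgroup_int_scale:
  assumes "zsubgroup L" "x \<in> L" "k \<in> \<int>"
  shows "k *\<^sub>R x \<in> L"
proof -
  have nat: "real n *\<^sub>R x \<in> L" for n
    by (induction n) (auto simp: zsubgroup_zero[OF assms(1)] scaleR_add_left intro!: zsubgroup_add[OF assms(1)] assms(2))
  obtain i where i: "k = real_of_int i" using assms(3) Ints_cases by blast
  show ?thesis
  proof (cases "0 \<le> i")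
    case True
    then show ?thesis using nat[of "nat i"] i by simp
  next
    case False
    then show ?thesis using zsubgroup_uminus[OF assms(1) nat[of "nat (- i)"]] i by simp
  qed
qed

lemma zsubgroup_sum: "zsubgroup L \<Longrightarrow> (\<And>i. i \<in> I \<Longrightarrow> f i \<in> L) \<Longrightarrow> (\<Sum>i\<in>I. f i) \<in> L"
  by (induction I rule: infinite_finite_induct) (auto simp: zsubgroup_zero zsubgroup_add)

lemma zsubgroup_int_lincomb:
  "zsubgroup L \<Longrightarrow> S \<subseteq> L \<Longrightarrow> (\<And>v. v \<in> S \<Longrightarrow> a v \<in> \<int>) \<Longrightarrow> (\<Sum>v\<in>S. a v *\<^sub>R v) \<in> L"
  by (auto intro!: zsubgroup_sum zsubgroup_int_scale)

lemma lattice_frameD: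
  assumes "lattice_frame V L"
  shows "independent V" "V \<subseteq> L" "L \<subseteq> span V" "zsubgroup L" "finite (box_pts V L)" "finite V"
  using assms indep_finite by (auto simp: lattice_frame_def)

lemma lattice_basisD:
  assumes "lattice_basis V L"
  shows "independent V" "V \<subseteq> L" "L \<subseteq> span V" "zsubgroup L" "finite V"
    "\<And>x v. x \<in> L \<Longrightarrow> v \<in> V \<Longrightarrow> coord V v x \<in> \<int>"
  using assms indep_finite by (auto simp: lattice_basis_def)

definition box_red :: "(real^'n) set \<Rightarrow> real^'n \<Rightarrow> real^'n" where
  "box_red V x = x - (\<Sum>v\<in>V. of_int \<lfloor>coord V v x\<rfloor> *\<^sub>R v)"

lemma coord_box_red:
  assumes "independent V" "v \<in> V"
  shows "coord V v (box_red V x) = frac (coord V v x)"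
  using assms by (simp add: box_red_def linear_diff[OF linear_coord] coord_lincomb frac_def)

lemma box_red_in:
  assumes "lattice_frame V L" "x \<in> L"
  shows "box_red V x \<in> box_pts V L"
proof -
  note f = lattice_frameD[OF assms(1)]
  have "box_red V x \<in> L" unfolding box_red_def
    by (intro zsubgroup_diff[OF f(4) assms(2)] zsubgroup_int_lincomb[OF f(4,2)]) simp
  then show ?thesis by (simp add: box_pts_def coord_box_red[OF f(1)] frac_lt_1)
qed

lemma zero_in_box: "lattice_frame V L \<Longrightarrow> 0 \<in> box_pts V L"
  using lattice_frameD[of V L] by (auto simp: box_pts_def zsubgroup_zero linear_0[OF linear_coord])

lemma lattice_basisI_box:
  assumes "lattice_frame V L" "box_pts V L \<subseteq> {0}"
  shows "lattice_basis V L"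
proof -
  note f = lattice_frameD[OF assms(1)]
  have "coord V v x \<in> \<int>" if "x \<in> L" "v \<in> V" for x v
  proof -
    have "box_red V x = 0" using box_red_in[OF assms(1) that(1)] assms(2) by auto
    then have "frac (coord V v x) = 0"
      using coord_box_red[OF f(1) that(2), of x] linear_0[OF linear_coord[OF f(1)]] by simp
    then show ?thesis by (simp add: frac_eq_0_iff)
  qed
  then show ?thesis using f by (simp add: lattice_basis_def)
qed

text \<open>Comparing determinants, the multiplicity gets multiplied by \<open>coord V v x\<close>,
  which is below 1. The strict decrease, which drives the inductions, is obtained here from an
  injection.\<close>

lemma exchange_box:
  assumes V: "lattice_frame V L" and x: "x \<in> box_pts V L" and v: "v \<in> V" "coord V v x > 0"
  defines "V' \<equiv> insert x (V - {v})"
  shows "lattice_frame V' L" "card (box_pts V' L) < card (box_pts V L)"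
proof -
  note f = lattice_frameD[OF V]
  have xL: "x \<in> L" "coord V v x < 1" using x v by (auto simp: box_pts_def)
  have xs: "x \<in> span V" using xL f(3) by auto
  have nz: "coord V v x \<noteq> 0" using v by simp
  note ex = exchange[OF f(1) v(1) xs nz, folded V'_def]
  have cn: "coord V v y = coord V' x y * coord V v x" if "y \<in> span V" for y
    using ex(4)[OF that] nz by simp
  have co: "coord V u y = coord V' u y + coord V u x * coord V' x y" if "y \<in> span V" "u \<in> V - {v}" for y u
    using ex(5)[OF that] ex(4)[OF that(1)] by simp
  \<comment> \<open>Reduction modulo \<^term>\<open>V\<close> embeds the new parallelepiped in the old one and misses \<^term>\<open>x\<close>,
    since it only produces points whose \<^term>\<open>v\<close>-coordinate is below that of \<^term>\<open>x\<close>.\<close>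
  have inj: "inj_on (box_red V) (box_pts V' L)"
  proof (rule inj_onI)
    fix y z assume y: "y \<in> box_pts V' L" and z: "z \<in> box_pts V' L" and e: "box_red V y = box_red V z"
    have ys: "y \<in> span V" "z \<in> span V" using y z f(3) by (auto simp: box_pts_def)
    have yb: "0 \<le> coord V' u y" "coord V' u y < 1" "0 \<le> coord V' u z" "coord V' u z < 1" if "u \<in> V'" for u
      using y z that by (auto simp: box_pts_def)
    have fr: "frac (coord V u y) = frac (coord V u z)" if "u \<in> V" for u
      using e coord_box_red[OF f(1) that] by metis
    have xV': "x \<in> V'" by (simp add: V'_def)
    have small: "0 \<le> coord V v w \<and> coord V v w < 1" if "w \<in> {y, z}" for w
    proof -
      have c: "coord V v w = coord V' x w * coord V v x" "0 \<le> coord V' x w" "coord V' x w < 1"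
        using that cn ys yb[OF xV'] by auto
      then have "coord V' x w * coord V v x \<le> 1 * coord V v x" using v(2) by (intro mult_right_mono) auto
      moreover have "0 \<le> coord V' x w * coord V v x" using c(2) v(2) by simp
      ultimately show ?thesis using c(1) xL(2) by linarith
    qed
    have "coord V v y = coord V v z" using small[of y] small[of z] fr[OF v(1)] by (simp add: frac_eq)
    then have e1: "coord V' x y = coord V' x z" using ex(4) ys by simp
    show "y = z"
    proof (rule coord_eqI[OF ex(1)])
      show "y \<in> span V'" "z \<in> span V'" using ys ex(2) by auto
      fix u assume u: "u \<in> V'"
      show "coord V' u y = coord V' u z"
      proof (cases "u = x")
        case False
        then have u': "u \<in> V - {v}" "u \<in> V" using u by (auto simp: V'_def)
        \<comment> \<open>With equal \<open>x\<close>-coordinates the shift is the same on both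
          sides, so the two \<open>u\<close>-coordinates differ by an integer; both lie in [0,
          1).\<close>
        have "frac (coord V' u y + coord V u x * coord V' x y) = frac (coord V' u z + coord V u x * coord V' x y)"
          using fr[OF u'(2)] co[OF ys(1) u'(1)] co[OF ys(2) u'(1)] e1 by simp
        then have "coord V' u y = coord V' u z + of_int (\<lfloor>coord V' u y + coord V u x * coord V' x y\<rfloor>
            - \<lfloor>coord V' u z + coord V u x * coord V' x y\<rfloor>)" by (simp add: frac_def)
        then obtain k where "coord V' u y = coord V' u z + of_int k" by blast
        moreover have "k = 0" using calculation yb[OF u] by linarith
        ultimately show ?thesis by simp
      qed (simp add: e1)
    qed
  qed
  have img: "box_red V ` box_pts V' L \<subseteq> box_pts V L - {x}"
  proof
    fix w assume "w \<in> box_red V ` box_pts V' L"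
    then obtain y where y: "y \<in> box_pts V' L" "w = box_red V y" by auto
    have yL: "y \<in> L" "0 \<le> coord V' x y" "coord V' x y < 1" using y by (auto simp: box_pts_def V'_def)
    have c: "coord V v y = coord V' x y * coord V v x" using cn yL(1) f(3) by auto
    have "coord V' x y * coord V v x < 1 * coord V v x" using yL(3) v(2) by (intro mult_strict_right_mono) auto
    then have lt: "coord V v y < coord V v x" using c by simp
    have "0 \<le> coord V v y" using c yL(2) v(2) by simp
    then have "coord V v w = coord V v y"
      using coord_box_red[OF f(1) v(1), of y] lt xL(2) y(2) by (simp add: frac_eq)
    then have "w \<noteq> x" using lt by auto
    then show "w \<in> box_pts V L - {x}" using box_red_in[OF V yL(1)] y(2) by simp
  qed
  have fin: "finite (box_pts V' L)"
    by (rule finite_imageD[OF finite_subset[OF img] inj]) (use f(5) in simp)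
  show "lattice_frame V' L" using ex(1,2) f xL(1) fin by (auto simp: lattice_frame_def V'_def)
  have "card (box_pts V' L) \<le> card (box_pts V L - {x})"
    using card_inj_on_le[OF inj img] f(5) by simp
  also have "\<dots> < card (box_pts V L)" by (rule card_Diff1_less[OF f(5) x])
  finally show "card (box_pts V' L) < card (box_pts V L)" .
qed

section \<open>Starring at lattice points\<close>

text \<open>
  The generators in \<open>J\<close> split off the lattice as a direct summand, so no parallelepiped point involves
  them and they do not contribute to the growth of \<open>f\<close>.
\<close>

lemma unimodular_refinement:
  fixes f :: "real^'n \<Rightarrow> real"
  assumes f: "linear f"
  shows "\<lbrakk>lattice_frame V L; J \<subseteq> V; \<forall>x\<in>L. \<forall>j\<in>J. coord V j x \<in> \<int>;
     \<forall>v\<in>V - J. 0 \<le> f v \<and> f v \<le> T;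
     (\<Sum>v\<in>V - J. f v) * (3/2) ^ card (box_pts V L) \<le> 9/2 * T; p \<in> nonneg_span V\<rbrakk>
   \<Longrightarrow> \<exists>Y. lattice_basis Y L \<and> J \<subseteq> Y \<and> Y \<subseteq> nonneg_span V \<and> p \<in> nonneg_span Y \<and>
        (\<forall>y\<in>Y - J. f y \<le> T)"
proof (induction "card (box_pts V L)" arbitrary: V rule: less_induct)
  case less
  note V = less.prems(1) and J = less.prems(2) and frozen = less.prems(3) and fV = less.prems(4)
    and S = less.prems(5) and p = less.prems(6)
  note fr = lattice_frameD[OF V]
  define s where "s = (\<Sum>v\<in>V - J. f v)"
  have s0: "0 \<le> s" unfolding s_def using fV by (intro sum_nonneg) auto
  show ?case
  proof (cases "box_pts V L \<subseteq> {0}")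
    case True
    have "lattice_basis V L" by (rule lattice_basisI_box[OF V True])
    moreover have "V \<subseteq> nonneg_span V" using nonneg_span_base[OF fr(6)] by auto
    ultimately show ?thesis using J p fV by blast
  next
    case False
    then obtain x where x: "x \<in> box_pts V L" "x \<noteq> 0" by auto
    have boxJ: "coord V j z = 0" if "z \<in> box_pts V L" "j \<in> J" for z j
    proof -
      have "coord V j z \<in> \<int>" "0 \<le> coord V j z" "coord V j z < 1"
        using that frozen J by (auto simp: box_pts_def)
      then show ?thesis by (auto elim!: Ints_cases)
    qed
    have boxcone: "z \<in> nonneg_span V" if "z \<in> box_pts V L" for z
      using that fr(3) nonneg_span_coord[OF fr(1)] by (auto simp: box_pts_def)
    define A where "A = {v\<in>V. 0 < coord V v x}"
    have AV: "A \<subseteq> V - J" using boxJ[OF x(1)] by (auto simp: A_def)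
    have finA: "finite A" using fr(6) by (simp add: A_def)
    \<comment> \<open>The complementary parallelepiped point; the smaller of \<^term>\<open>f\<close> at the two is at most \<open>s / 2\<close>.\<close>
    define x' where "x' = (\<Sum>v\<in>V. (if v \<in> A then 1 else 0) *\<^sub>R v) - x"
    have xL: "x \<in> L" using x by (simp add: box_pts_def)
    have cx': "coord V v x' = (if v \<in> A then 1 else 0) - coord V v x" if "v \<in> V" for v
      by (simp only: x'_def linear_diff[OF linear_coord[OF fr(1)]] coord_lincomb[OF fr(1) that])
    have "x' \<in> L" unfolding x'_def
      by (intro zsubgroup_diff[OF fr(4) _ xL] zsubgroup_int_lincomb[OF fr(4,2)]) simp
    moreover have "0 \<le> coord V v x' \<and> coord V v x' < 1" if "v \<in> V" for v
      using x that by (auto simp: cx' box_pts_def A_def)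
    ultimately have x'box: "x' \<in> box_pts V L" by (simp add: box_pts_def)
    have "x' \<noteq> 0"
    proof
      assume "x' = 0"
      then have c: "coord V v x = (if v \<in> A then 1 else 0)" if "v \<in> V" for v
        using cx'[OF that] linear_0[OF linear_coord[OF fr(1)]] by simp
      moreover have "coord V v x < 1" if "v \<in> V" for v using x that by (simp add: box_pts_def)
      ultimately have "coord V v x = coord V v 0" if "v \<in> V" for v
        using that linear_0[OF linear_coord[OF fr(1)]] by (metis less_irrefl)
      moreover have "x \<in> span V" using xL fr(3) by blast
      ultimately have "x = 0" by (intro coord_eqI[OF fr(1) _ span_0])
      then show False using x(2) by simp
    qed
    have "x + x' = (\<Sum>v\<in>V. (if v \<in> A then 1 else 0) *\<^sub>R v)" by (simp add: x'_def)
    then have "f x + f x' = (\<Sum>v\<in>V. (if v \<in> A then 1 else 0) * f v)"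
      using linear_add[OF f, of x x'] linear_lincomb[OF f, of _ V] by simp
    also have "\<dots> = (\<Sum>v\<in>A. f v)"
      using AV by (intro sum.mono_neutral_cong_right fr(6)) auto
    also have "\<dots> \<le> s" unfolding s_def using AV fV fr(6) by (intro sum_mono2) auto
    finally have fs: "f x + f x' \<le> s" .
    obtain z where z: "z \<in> box_pts V L" "z \<noteq> 0" "f z \<le> s / 2"
    proof (cases "f x \<le> s / 2")
      case True
      then show ?thesis using that[of x] x by blast
    next
      case False
      then show ?thesis using that[of x'] x'box \<open>x' \<noteq> 0\<close> fs by auto
    qed
    have zs: "z \<in> span V" using boxcone[OF z(1)] nonneg_span_span by blast
    obtain v where v: "v \<in> V" "0 < coord V v z" and pz: "p \<in> nonneg_span (insert z (V - {v}))"
      using stellar[OF fr(1) p boxcone[OF z(1)] z(2)] by blast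
    define V' where "V' = insert z (V - {v})"
    have nz: "coord V v z \<noteq> 0" using v by simp
    note ex = exchange[OF fr(1) v(1) zs nz, folded V'_def]
    note eb = exchange_box[OF V z(1) v, folded V'_def]
    have vJ: "v \<notin> J" using boxJ[OF z(1)] nz by blast
    have zJ: "z \<notin> J" using ex(3) J vJ by auto
    have V'J: "V' - J = insert z (V - J - {v})" "z \<notin> V - J - {v}"
      using zJ ex(3) by (auto simp: V'_def)
    \<comment> \<open>\<open>f\<close> may be negative on \<open>J\<close>, but the
      \<open>J\<close>-coordinates of a parallelepiped point vanish.\<close>
    have fz0: "0 \<le> f z"
    proof -
      have "f z = (\<Sum>v\<in>V. coord V v z * f v)" by (rule linear_eq_coord[OF fr(1) f zs])
      also have "\<dots> \<ge> 0"
      proof (rule sum_nonneg)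
        fix u assume "u \<in> V"
        then show "0 \<le> coord V u z * f u" using boxJ[OF z(1)] fV z(1)
          by (cases "u \<in> J") (auto simp: box_pts_def)
      qed
      finally show ?thesis .
    qed
    have "s = f v + (\<Sum>v\<in>V - J - {v}. f v)"
      unfolding s_def using v(1) vJ fr(6) by (intro sum.remove) auto
    moreover have "(\<Sum>v\<in>V' - J. f v) = f z + (\<Sum>v\<in>V - J - {v}. f v)"
      unfolding V'J(1) using V'J(2) fr(6) by (intro sum.insert) auto
    moreover have "0 \<le> f v" using fV v(1) vJ by simp
    ultimately have s': "(\<Sum>v\<in>V' - J. f v) \<le> 3/2 * s" using z(3) by linarith
    have "card {0, x} \<le> card (box_pts V L)"
      using zero_in_box[OF V] x fr(5) by (intro card_mono) auto
    then have c2: "2 \<le> card (box_pts V L)" using x(2) by simp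
    \<comment> \<open>The exponent is at least 2 because 0 and \<open>x\<close> are both counted, so
      the hypothesis yields \<open>9/4 * s \<le> 9/2 * T\<close>. The factor 9/2 is chosen to make
      half the sum at most \<open>T\<close>.\<close>
    have "s * (3/2) ^ 2 \<le> s * (3/2) ^ card (box_pts V L)"
      using s0 c2 by (intro mult_left_mono power_increasing) auto
    then have "s / 2 \<le> T" using S by (simp add: s_def power2_eq_square)
    then have fzT: "f z \<le> T" using z(3) by simp
    \<comment> \<open>The sum grows by a factor of at most 3/2 while the exponent drops by at least
      1: the product is a potential that does not increase.\<close>
    have "(\<Sum>v\<in>V' - J. f v) * (3/2) ^ card (box_pts V' L) \<le> (3/2 * s) * (3/2) ^ card (box_pts V' L)"
      using s' by (intro mult_right_mono) auto
    also have "\<dots> = s * (3/2) ^ Suc (card (box_pts V' L))" by simp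
    also have "\<dots> \<le> s * (3/2) ^ card (box_pts V L)"
      using s0 eb(2) by (intro mult_left_mono power_increasing) auto
    also have "\<dots> \<le> 9/2 * T" using S by (simp add: s_def)
    finally have S': "(\<Sum>v\<in>V' - J. f v) * (3/2) ^ card (box_pts V' L) \<le> 9/2 * T" .
    have J': "J \<subseteq> V'" using J vJ by (auto simp: V'_def)
    have frozen': "\<forall>y\<in>L. \<forall>j\<in>J. coord V' j y \<in> \<int>"
    proof (intro ballI)
      fix y j assume y: "y \<in> L" and j: "j \<in> J"
      have "coord V' j y = coord V j y"
        using ex(5)[of y j] y j J vJ fr(3) boxJ[OF z(1) j] by auto
      then show "coord V' j y \<in> \<int>" using frozen y j by simp
    qed
    have fV': "\<forall>v\<in>V' - J. 0 \<le> f v \<and> f v \<le> T" using fV fz0 fzT by (auto simp: V'J)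
    obtain Y where Y: "lattice_basis Y L" "J \<subseteq> Y" "Y \<subseteq> nonneg_span V'" "p \<in> nonneg_span Y" "\<forall>y\<in>Y - J. f y \<le> T"
      using less.hyps[OF eb(2,1) J' frozen' fV' S' pz[folded V'_def]] by blast
    have "nonneg_span V' \<subseteq> nonneg_span V"
      using boxcone[OF z(1)] nonneg_span_base[OF fr(6)] by (intro nonneg_span_subset) (auto simp: V'_def)
    then show ?thesis using Y by blast
  qed
qed

text \<open>Expanding \<open>y\<close> over \<open>V'\<close> bounds its degree by its
  \<open>V'\<close>-coordinate sum. Passing to generators of degree at most 1 is therefore free: an
  upper bound on degrees relative to \<open>V'\<close> also holds relative to
  \<open>V\<close>.\<close>

lemma deg_exchange:
  assumes V: "independent V" and V': "independent V'" "V' \<subseteq> nonneg_span V" "\<And>v. v \<in> V' \<Longrightarrow> deg V v \<le> 1"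
    and y: "y \<in> nonneg_span V'"
  shows "deg V y \<le> deg V' y"
proof -
  have ys: "y \<in> span V'" "\<forall>v\<in>V'. 0 \<le> coord V' v y" using y nonneg_span_coord[OF V'(1)] by auto
  have "deg V y = (\<Sum>v\<in>V'. coord V' v y * deg V v)" by (rule linear_eq_coord[OF V'(1) linear_deg[OF V] ys(1)])
  also have "\<dots> \<le> (\<Sum>v\<in>V'. coord V' v y * 1)"
    using ys(2) V'(3) by (intro sum_mono mult_left_mono) auto
  finally show ?thesis by (simp add: deg_def)
qed

section \<open>Empty lattice simplices\<close>

definition empty_frame :: "(real^'n) set \<Rightarrow> (real^'n) set \<Rightarrow> bool" where
  "empty_frame V L \<longleftrightarrow> lattice_frame V L \<and>
     (\<forall>x\<in>L \<inter> nonneg_span V. x \<noteq> 0 \<longrightarrow> x \<notin> V \<longrightarrow> 1 < deg V x)"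

text \<open>A nonzero lattice point of the cone of degree at most 1, other than a generator, has all
  coordinates below 1, since a coordinate 1 would use up the whole degree. It therefore lies in the
  parallelepiped, and starring there lowers the multiplicity.\<close>

lemma empty_refinement:
  "lattice_frame V L \<Longrightarrow> p \<in> nonneg_span V \<Longrightarrow>
   \<exists>V'. empty_frame V' L \<and> V' \<subseteq> nonneg_span V \<and> card V' = card V \<and> p \<in> nonneg_span V' \<and> (\<forall>v\<in>V'. deg V v \<le> 1)"
proof (induction "card (box_pts V L)" arbitrary: V rule: less_induct)
  case less
  note V = less.prems(1) and p = less.prems(2)
  note fr = lattice_frameD[OF V]
  have VV: "V \<subseteq> nonneg_span V" using nonneg_span_base[OF fr(6)] by auto
  show ?case
  proof (cases "empty_frame V L")
    case True
    then show ?thesis using VV p deg_basis[OF fr(1)] by (intro exI[of _ V]) auto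
  next
    case False
    then obtain x where x: "x \<in> L" "x \<in> nonneg_span V" "x \<noteq> 0" "x \<notin> V" "deg V x \<le> 1"
      using V by (auto simp: empty_frame_def not_less)
    have xs: "x \<in> span V" "\<And>v. v \<in> V \<Longrightarrow> 0 \<le> coord V v x" using x(2) nonneg_span_coord[OF fr(1)] by auto
    have "coord V v x < 1" if v: "v \<in> V" for v
    proof (rule ccontr)
      assume "\<not> coord V v x < 1"
      moreover have "deg V x = coord V v x + (\<Sum>u\<in>V - {v}. coord V u x)"
        unfolding deg_def using v fr(6) by (rule sum.remove[rotated])
      moreover have "0 \<le> (\<Sum>u\<in>V - {v}. coord V u x)" using xs(2) by (intro sum_nonneg) auto
      ultimately have c: "coord V v x = 1" "(\<Sum>u\<in>V - {v}. coord V u x) = 0" using x(5) by auto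
      then have "coord V u x = 0" if "u \<in> V - {v}" for u
        using sum_nonneg_eq_0_iff[of "V - {v}" "\<lambda>u. coord V u x"] xs(2) that fr(6) by auto
      then have "coord V u x = coord V u v" if "u \<in> V" for u
        using that c(1) v by (auto simp: coord_basis[OF fr(1)])
      then have "x = v" using coord_eqI[OF fr(1) xs(1)] v by (auto intro: span_base)
      then show False using x(4) v by simp
    qed
    then have xb: "x \<in> box_pts V L" using x(1) xs(2) by (simp add: box_pts_def)
    obtain v where v: "v \<in> V" "0 < coord V v x" and px: "p \<in> nonneg_span (insert x (V - {v}))"
      using stellar[OF fr(1) p x(2,3)] by blast
    define V' where "V' = insert x (V - {v})"
    have nz: "coord V v x \<noteq> 0" using v by simp
    note ex = exchange[OF fr(1) v(1) xs(1) nz, folded V'_def]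
    note eb = exchange_box[OF V xb v, folded V'_def]
    have V'V: "V' \<subseteq> nonneg_span V" using VV x(2) by (auto simp: V'_def)
    have d': "deg V u \<le> 1" if "u \<in> V'" for u using that x(5) by (auto simp: V'_def deg_basis[OF fr(1)])
    have "card V' = card V" using ex(3) v(1) fr(6) by (simp add: V'_def card_gt_0_iff) (metis Suc_pred card_gt_0_iff empty_iff)
    obtain W where W: "empty_frame W L" "W \<subseteq> nonneg_span V'" "card W = card V'" "p \<in> nonneg_span W" "\<forall>v\<in>W. deg V' v \<le> 1"
      using less.hyps[OF eb(2,1)] px unfolding V'_def by blast
    have "deg V w \<le> 1" if "w \<in> W" for w
    proof -
      have "deg V w \<le> deg V' w" using W(2) that by (intro deg_exchange[OF fr(1) ex(1) V'V d']) auto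
      then show ?thesis using W(5) that by force
    qed
    moreover have "W \<subseteq> nonneg_span V" using W(2) nonneg_span_subset[OF V'V] by blast
    ultimately show ?thesis using W \<open>card V' = card V\<close> by (intro exI[of _ W]) auto
  qed
qed

text \<open>With at most two generators, a nonzero parallelepiped point has only positive
  coordinates, as otherwise its degree would be at most 1. It and its complement then have total
  degree at most 2, so one of them violates emptiness. This starts the induction and is why
  \<open>degree_bound\<close> is 1 up to two generators.\<close>

lemma empty_frame_basis:
  assumes "empty_frame V L" "card V \<le> 2"
  shows "lattice_basis V L"
proof -
  have V: "lattice_frame V L" using assms(1) by (simp add: empty_frame_def)
  note fr = lattice_frameD[OF V]
  have "x = 0" if x: "x \<in> box_pts V L" for x
  proof (rule ccontr)
    assume nz: "x \<noteq> 0"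
    have big: "1 < deg V z" if "z \<in> box_pts V L" "z \<noteq> 0" for z
    proof -
      have "z \<notin> V"
      proof
        assume "z \<in> V"
        then have "coord V z z < 1" using that(1) by (simp add: box_pts_def)
        then show False using \<open>z \<in> V\<close> by (simp add: coord_basis[OF fr(1)])
      qed
      moreover have "z \<in> L \<inter> nonneg_span V" using that(1) fr(3) nonneg_span_coord[OF fr(1)] by (auto simp: box_pts_def)
      ultimately show ?thesis using assms(1) that(2) by (simp add: empty_frame_def)
    qed
    have xL: "x \<in> L" and xc: "\<And>v. v \<in> V \<Longrightarrow> 0 \<le> coord V v x \<and> coord V v x < 1" using x by (auto simp: box_pts_def)
    have pos: "0 < coord V v x" if v: "v \<in> V" for v
    proof (rule ccontr)
      assume "\<not> 0 < coord V v x"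
      then have "coord V v x = 0" using xc[OF v] by simp
      then have "deg V x = (\<Sum>u\<in>V - {v}. coord V u x)" unfolding deg_def
        using v fr(6) by (simp add: sum.remove)
      also have "\<dots> \<le> (\<Sum>u\<in>V - {v}. 1)" using xc by (intro sum_mono) (auto simp: less_imp_le)
      also have "\<dots> \<le> 1" using assms(2) v fr(6) by simp
      finally show False using big[OF x nz] by simp
    qed
    define x' where "x' = (\<Sum>v\<in>V. 1 *\<^sub>R v) - x"
    have cx': "coord V v x' = 1 - coord V v x" if "v \<in> V" for v
      by (simp only: x'_def linear_diff[OF linear_coord[OF fr(1)]] coord_lincomb[OF fr(1) that])
    have "x' \<in> L" unfolding x'_def
      by (intro zsubgroup_diff[OF fr(4) _ xL] zsubgroup_int_lincomb[OF fr(4,2)]) simp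
    then have x'b: "x' \<in> box_pts V L" using cx' xc pos by (auto simp: box_pts_def less_imp_le)
    have "V \<noteq> {}" using fr(3) xL nz by auto
    then obtain v where "v \<in> V" by auto
    then have "x' \<noteq> 0" using cx' xc linear_0[OF linear_coord[OF fr(1)]] by fastforce
    have "deg V x + deg V x' = (\<Sum>v\<in>V. 1)" unfolding deg_def sum.distrib[symmetric]
      by (rule sum.cong) (auto simp: cx')
    then show False using big[OF x nz] big[OF x'b \<open>x' \<noteq> 0\<close>] assms(2) by simp
  qed
  then show ?thesis by (intro lattice_basisI_box[OF V]) auto
qed

section \<open>The Kuhn triangulation\<close>

text \<open>
  A point of the cube lies in the simplex of a maximal chain of subsets. Ties are broken in favour of
  the larger index so that monotone sequences are rounded to monotone sequences.
\<close>

lemma kuhn_chain: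
  fixes f :: "nat \<Rightarrow> real"
  assumes "finite I" "0 \<le> c" "\<forall>i\<in>I. 0 \<le> f i \<and> f i \<le> c"
  shows "\<exists>\<A> w. \<A> \<subseteq> Pow I \<and> {} \<in> \<A> \<and> card \<A> = Suc (card I)
    \<and> (\<forall>i\<in>I. \<exists>A\<in>\<A>. i \<notin> A \<and> insert i A \<in> \<A>)
    \<and> (\<forall>A\<in>\<A>. \<forall>i\<in>A. \<forall>k\<in>I. f i < f k \<or> f i = f k \<and> i < k \<longrightarrow> k \<in> A)
    \<and> (\<forall>A\<in>\<A>. 0 \<le> w A) \<and> (\<Sum>A\<in>\<A>. w A) = c
    \<and> (\<forall>i\<in>I. f i = (\<Sum>A\<in>\<A>. if i \<in> A then w A else 0))"
  using assms
proof (induction "card I" arbitrary: I c)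
  case 0
  then have "I = {}" by simp
  then show ?case using 0 by (intro exI[of _ "{{}}"] exI[of _ "\<lambda>A. c"]) auto
next
  case (Suc n)
  note fin = Suc.prems(1) and b = Suc.prems(3)
  have "I \<noteq> {}" using Suc.hyps(2) by auto
  define m where "m = Max (f ` I)"
  have fm: "\<And>i. i \<in> I \<Longrightarrow> f i \<le> m" and "m \<in> f ` I"
    unfolding m_def using fin \<open>I \<noteq> {}\<close> by (auto intro: Max_in)
  then have ne: "{i\<in>I. f i = m} \<noteq> {}" by auto
  \<comment> \<open>The largest index among the maximal values comes first in the order, so
    \<open>M\<close> lies in every nonempty set of the chain. The other indices form a chain for the
    bound \<open>f M\<close>, and the empty set receives the weight \<open>c - f M\<close>.\<close>
  define M where "M = Max {i\<in>I. f i = m}"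
  have "M \<in> {i\<in>I. f i = m}" unfolding M_def using fin ne by (intro Max_in) auto
  then have M: "M \<in> I" "f M = m" by auto
  have Mtop: "f k < f M \<or> f k = f M \<and> k \<le> M" if "k \<in> I" for k
    using fm[OF that] M(2) Max_ge[of "{i\<in>I. f i = m}" k] fin that unfolding M_def by fastforce
  define I' where "I' = I - {M}"
  have I': "I = insert M I'" "M \<notin> I'" using M(1) by (auto simp: I'_def)
  have n: "n = card I'" using Suc.hyps(2) fin M(1) by (simp add: I'_def)
  have fin': "finite I'" using fin by (simp add: I'_def)
  have fM0: "0 \<le> f M" "f M \<le> c" using b M(1) by auto
  have b': "\<forall>i\<in>I'. 0 \<le> f i \<and> f i \<le> f M" using b fm M(2) by (auto simp: I'_def)
  obtain \<B> u where B: "\<B> \<subseteq> Pow I'" "{} \<in> \<B>" "card \<B> = Suc (card I')"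
    "\<forall>i\<in>I'. \<exists>A\<in>\<B>. i \<notin> A \<and> insert i A \<in> \<B>"
    "\<forall>A\<in>\<B>. \<forall>i\<in>A. \<forall>k\<in>I'. f i < f k \<or> f i = f k \<and> i < k \<longrightarrow> k \<in> A"
    "\<forall>A\<in>\<B>. 0 \<le> u A" "(\<Sum>A\<in>\<B>. u A) = f M"
    "\<forall>i\<in>I'. f i = (\<Sum>A\<in>\<B>. if i \<in> A then u A else 0)"
    using Suc.hyps(1)[OF n fin' fM0(1) b'] by blast
  have MB: "M \<notin> A" if "A \<in> \<B>" for A using B(1) that I'(2) by auto
  have finB: "finite \<B>" using B(1) fin' finite_subset by blast
  have inj: "inj_on (insert M) \<B>" by (rule inj_onI) (metis MB insert_ident)
  define \<A> where "\<A> = insert {} (insert M ` \<B>)"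
  define w where "w A = (if A = {} then c - f M else u (A - {M}))" for A
  have wM: "w (insert M A) = u A" if "A \<in> \<B>" for A using MB[OF that] by (simp add: w_def)
  have sumA: "(\<Sum>A\<in>\<A>. g A) = g {} + (\<Sum>A\<in>\<B>. g (insert M A))" for g :: "nat set \<Rightarrow> real"
    unfolding \<A>_def using finB by (subst sum.insert) (auto simp: sum.reindex[OF inj])
  have "\<A> \<subseteq> Pow I" using B(1) I' by (auto simp: \<A>_def)
  moreover have "{} \<in> \<A>" by (simp add: \<A>_def)
  moreover have "card \<A> = Suc (card I)"
    unfolding \<A>_def using finB
    by (subst card_insert_disjoint) (auto simp: card_image[OF inj] B(3) I' fin')
  moreover have "\<forall>i\<in>I. \<exists>A\<in>\<A>. i \<notin> A \<and> insert i A \<in> \<A>"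
  proof
    fix i assume "i \<in> I"
    show "\<exists>A\<in>\<A>. i \<notin> A \<and> insert i A \<in> \<A>"
    proof (cases "i = M")
      case True
      then show ?thesis using B(2) by (auto simp: \<A>_def)
    next
      case False
      then obtain A where "A \<in> \<B>" "i \<notin> A" "insert i A \<in> \<B>" using B(4) \<open>i \<in> I\<close> I' by blast
      then show ?thesis using False
        by (intro bexI[of _ "insert M A"]) (auto simp: \<A>_def insert_commute[of i M])
    qed
  qed
  moreover have "k \<in> A" if kA: "A \<in> \<A>" "i \<in> A" "k \<in> I" "f i < f k \<or> f i = f k \<and> i < k" for A i k
  proof -
    obtain A' where A': "A = insert M A'" "A' \<in> \<B>" using kA by (auto simp: \<A>_def)
    show ?thesis
    proof (cases "k = M")
      case False
      then have "k \<in> I'" using that I' by auto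
      moreover have "i \<noteq> M" using Mtop[OF that(3)] that(4) False by auto
      ultimately have "i \<in> A'" "k \<in> I'" using kA(2) A'(1) by auto
      then have "k \<in> A'" using B(5) A'(2) kA(4) by blast
      then show ?thesis using A'(1) by simp
    qed (simp add: A')
  qed
  moreover have "\<forall>A\<in>\<A>. 0 \<le> w A" using B(6) fM0 wM by (auto simp: \<A>_def) (simp add: w_def)
  moreover have "(\<Sum>A\<in>\<A>. w A) = c"
    unfolding sumA using B(7) wM by (simp cong: sum.cong) (simp add: w_def)
  moreover have "f i = (\<Sum>A\<in>\<A>. if i \<in> A then w A else 0)" if "i \<in> I" for i
  proof (cases "i = M")
    case True
    then show ?thesis unfolding sumA using B(7) wM by (simp cong: sum.cong)
  next
    case False
    then have "i \<in> I'" using that I' by auto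
    then have "f i = (\<Sum>A\<in>\<B>. if i \<in> A then u A else 0)" using B(8) by blast
    also have "\<dots> = (\<Sum>A\<in>\<A>. if i \<in> A then w A else 0)"
      unfolding sumA using wM False by (auto intro!: sum.cong)
    finally show ?thesis .
  qed
  ultimately show ?case by (intro exI[of _ \<A>] exI[of _ w]) blast
qed

lemma summation_by_parts:
  fixes y :: "nat \<Rightarrow> 'a::real_vector"
  shows "(\<Sum>j\<le>r. a j *\<^sub>R y j) = (\<Sum>j\<le>r. a j) *\<^sub>R y r + (\<Sum>i<r. (\<Sum>j\<le>i. a j) *\<^sub>R (y i - y (Suc i)))"
  by (induction r) (simp_all add: algebra_simps)

lemma enumerate_descending:
  fixes l :: "'a \<Rightarrow> real"
  assumes "finite K" "e \<in> K" "\<And>y. y \<in> K \<Longrightarrow> l y \<le> l e"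
  obtains y r where "y 0 = e" "bij_betw y {..r} K" "\<And>i. i < r \<Longrightarrow> l (y (Suc i)) \<le> l (y i)"
proof -
  obtain xs where xs: "set xs = K - {e}" "distinct xs"
    using finite_distinct_list[of "K - {e}"] assms(1) by auto
  \<comment> \<open>\<open>e\<close> goes in front by hand: sorting alone could put another maximal
    element first.\<close>
  define ys where "ys = e # sort_key (\<lambda>v. - l v) xs"
  define r where "r = length xs"
  have len: "length ys = Suc r" by (simp add: ys_def r_def)
  have set: "set ys = K" using xs assms(2) by (auto simp: ys_def)
  have dist: "distinct ys" using xs by (simp add: ys_def)
  have "sorted (map (\<lambda>v. - l v) ys)"
    using assms(3) xs(1) by (auto simp: ys_def)
  then have "l (ys ! Suc i) \<le> l (ys ! i)" if "i < r" for i
    using that len sorted_nth_mono[of "map (\<lambda>v. - l v) ys" i "Suc i"] by simp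
  moreover have "bij_betw ((!) ys) {..r} K"
    using bij_betw_nth[OF dist, of "{..r}" K] len set by (auto simp: lessThan_Suc_atMost)
  moreover have "ys ! 0 = e" by (simp add: ys_def)
  ultimately show ?thesis using that by blast
qed

text \<open>The partial sums \<open>T i\<close> of the coefficients, taken along descending
  \<open>lev\<close> with \<open>e\<close> first, are coordinates on the slice; lattice points over
  \<open>K\<close> get integer coordinates, and the Kuhn triangulation becomes the standard one of
  the cubical grid. All coefficients but that of \<open>e\<close> are increments of partial sums, so
  the sign of the coefficient of \<open>e\<close> is left free.\<close>

lemma slice_simplex:
  fixes lev :: "real^'n \<Rightarrow> real"
  assumes E: "lattice_basis E L" and K: "K \<subseteq> E" "e \<in> K" and lev: "linear lev"
    and top: "\<And>y. y \<in> K \<Longrightarrow> lev y \<le> lev e" and bot: "\<And>y. y \<in> K \<Longrightarrow> lev e - 1 \<le> lev y"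
    and g: "0 < \<gamma>" and \<eta>: "\<And>y. y \<in> K - {e} \<Longrightarrow> 0 \<le> \<eta> y" "(\<Sum>y\<in>K. \<eta> y) = real \<gamma>"
    and q: "q = (\<Sum>y\<in>K. \<eta> y *\<^sub>R y)"
  obtains Z where "lattice_frame (Z \<union> (E - K)) L" "card Z \<le> card K" "finite Z" "q \<in> nonneg_span Z"
    "card (box_pts (Z \<union> (E - K)) L) \<le> \<gamma>"
    "\<forall>x\<in>L. \<forall>j\<in>E - K. coord (Z \<union> (E - K)) j x \<in> \<int>"
    "\<And>z. z \<in> Z \<Longrightarrow> \<exists>\<zeta>. z = (\<Sum>y\<in>K. \<zeta> y *\<^sub>R y) \<and> (\<Sum>y\<in>K. \<zeta> y) = real \<gamma>
        \<and> (\<forall>y\<in>K - {e}. 0 \<le> \<zeta> y \<and> \<zeta> y \<le> \<eta> y + 2) \<and> lev q - 1 \<le> lev z"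
proof -
  note b = lattice_basisD[OF E]
  have finK: "finite K" using K(1) b(5) finite_subset by blast
  obtain y r where y: "y 0 = e" "bij_betw y {..r} K" "\<And>i. i < r \<Longrightarrow> lev (y (Suc i)) \<le> lev (y i)"
    using enumerate_descending[OF finK K(2), of lev] top by blast
  have yK: "y i \<in> K" if "i \<le> r" for i using y(2) that by (auto simp: bij_betw_def)
  have yE: "y i \<in> E" if "i \<le> r" for i using yK[OF that] K(1) by blast
  have inj: "inj_on y {..r}" using y(2) by (simp add: bij_betw_def)
  have cardK: "card K = Suc r" using bij_betw_same_card[OF y(2)] by simp
  have toK: "(\<Sum>v\<in>K. h v) = (\<Sum>j\<le>r. h (y j))" for h :: "real^'n \<Rightarrow> 'b::comm_monoid_add"
    using sum.reindex_bij_betw[OF y(2), of h] by simp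
  define d where "d i = y i - y (Suc i)" for i
  define T where "T i = (\<Sum>j\<le>i. \<eta> (y j))" for i
  have Tr: "T r = real \<gamma>" using \<eta>(2) toK[of \<eta>] by (simp add: T_def)
  have Tmono: "T i \<le> T (Suc i)" if "i < r" for i
  proof -
    have "y (Suc i) \<noteq> y 0" using inj_onD[OF inj, of "Suc i" 0] that by auto
    then show ?thesis using \<eta>(1)[of "y (Suc i)"] yK[of "Suc i"] that y(1) by (simp add: T_def)
  qed
  have qT: "q = real \<gamma> *\<^sub>R y r + (\<Sum>i<r. T i *\<^sub>R d i)"
    unfolding q toK[of "\<lambda>v. \<eta> v *\<^sub>R v"] summation_by_parts d_def T_def[symmetric] Tr ..
  \<comment> \<open>Fractional parts are taken in \<open>(0, 1]\<close>: with \<open>[0, 1)\<close> an integral \<^term>\<open>T i\<close> could be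
    rounded up past \<^term>\<open>\<gamma>\<close>, making the last coefficient negative.\<close>
  define f where "f i = T i - of_int \<lceil>T i\<rceil> + 1" for i
  have f01: "0 < f i" "f i \<le> 1" for i unfolding f_def by linarith+
  have "\<forall>i\<in>{..<r}. 0 \<le> f i \<and> f i \<le> 1" using f01 less_imp_le by blast
  note kuhn_chain[OF finite_lessThan zero_le_one this]
  then obtain \<A> w where A: "\<A> \<subseteq> Pow {..<r}" "{} \<in> \<A>" "card \<A> = Suc (card {..<r})"
    "\<forall>i\<in>{..<r}. \<exists>A\<in>\<A>. i \<notin> A \<and> insert i A \<in> \<A>"
    "\<forall>A\<in>\<A>. \<forall>i\<in>A. \<forall>k\<in>{..<r}. f i < f k \<or> f i = f k \<and> i < k \<longrightarrow> k \<in> A"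
    "\<forall>A\<in>\<A>. 0 \<le> w A" "(\<Sum>A\<in>\<A>. w A) = 1"
    "\<forall>i\<in>{..<r}. f i = (\<Sum>A\<in>\<A>. if i \<in> A then w A else 0)"
    by (elim exE conjE) (rule that; assumption)
  have finA: "finite \<A>" using A(1) by (rule finite_subset) simp
  \<comment> \<open>A vertex of the grid cell: \<open>T i\<close> is rounded down to
    \<open>\<lceil>T i\<rceil> - 1\<close>, or up to \<open>\<lceil>T i\<rceil>\<close> for
    \<open>i\<close> in \<open>A\<close>. The last sum is pinned to \<open>\<gamma>\<close>, which
    keeps the vertex in the slice.\<close>
  define t where "t A i = (if i < r then \<lceil>T i\<rceil> - 1 + (if i \<in> A then 1 else 0) else int \<gamma>)" for A i
  define z where "z A = real \<gamma> *\<^sub>R y r + (\<Sum>i<r. of_int (t A i) *\<^sub>R d i)" for A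
  define Z where "Z = z ` \<A>"
  define Zf where "Zf = Z \<union> (E - K)"
  have finZ: "finite Z" using finA by (simp add: Z_def)
  have cardZ: "card Z \<le> card K" using card_image_le[OF finA, of z] A(3) by (simp add: Z_def cardK)

  have tT: "of_int (t A i) \<le> T i + 1" "T i - 1 \<le> of_int (t A i)" if "i \<le> r" for A i
    using that Tr unfolding t_def by (auto split: if_splits) linarith+
  define a where "a A j = (case j of 0 \<Rightarrow> t A 0 | Suc i \<Rightarrow> t A (Suc i) - t A i)" for A j
  have sum_a: "(\<Sum>j\<le>i. a A j) = t A i" for A i by (induction i) (simp_all add: a_def)
  have sum_a': "(\<Sum>j\<le>i. real_of_int (a A j)) = of_int (t A i)" for A i
    using sum_a[of A i] by (simp flip: of_int_sum)
  have za: "z A = (\<Sum>j\<le>r. of_int (a A j) *\<^sub>R y j)" for A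
    unfolding summation_by_parts sum_a' z_def d_def by (simp add: t_def)
  have a_nonneg: "0 \<le> a A j" if A': "A \<in> \<A>" and j: "0 < j" "j \<le> r" for A j
  proof -
    obtain i where i: "j = Suc i" "i < r" using j by (cases j) auto
    have c: "\<lceil>T i\<rceil> \<le> \<lceil>T (Suc i)\<rceil>" using Tmono[OF i(2)] by (rule ceiling_mono)
    have "t A i \<le> t A (Suc i)"
    proof (cases "Suc i < r")
      case False
      then have "Suc i = r" using i by simp
      then have "\<lceil>T i\<rceil> \<le> int \<gamma>" using Tmono[OF i(2)] Tr by (simp add: ceiling_le_iff)
      then show ?thesis using i(2) False by (simp add: t_def)
    next
      case True
      show ?thesis
      proof (cases "i \<in> A \<and> Suc i \<notin> A \<and> \<lceil>T i\<rceil> = \<lceil>T (Suc i)\<rceil>")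
        case contra: True
        \<comment> \<open>Only here could the rounded sums decrease: \<open>T i\<close> goes up and
          \<open>T (Suc i)\<close> down within the same unit interval. Monotonicity of
          \<open>T\<close> and the tie rule of the chain exclude this.\<close>
        then have "f i \<le> f (Suc i)" using Tmono[OF i(2)] by (simp add: f_def)
        then have "f i < f (Suc i) \<or> f i = f (Suc i) \<and> i < Suc i" by auto
        then have "Suc i \<in> A" using A(5) A' contra True by blast
        then show ?thesis using contra by simp
      next
        case False
        then show ?thesis using True i(2) c by (auto simp: t_def)
      qed
    qed
    then show ?thesis by (simp add: a_def i(1))
  qed
  have a_le: "real_of_int (a A j) \<le> \<eta> (y j) + 2" if j: "0 < j" "j \<le> r" for A j
  proof -
    obtain i where i: "j = Suc i" "i < r" using j by (cases j) auto
    show ?thesis using tT(1)[of "Suc i" A] tT(2)[of i A] i by (simp add: a_def T_def)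
  qed

  have zspan: "z A \<in> span K" for A
    unfolding za by (intro span_sum span_scale span_base yK) simp
  have zL: "z A \<in> L" for A
    unfolding za using yK K(1) b(2)
    by (intro zsubgroup_sum[OF b(4)] zsubgroup_int_scale[OF b(4)]) auto

  have diffZ: "\<exists>A\<in>\<A>. insert i A \<in> \<A> \<and> d i = z (insert i A) - z A" if i: "i < r" for i
  proof -
    obtain A where A': "A \<in> \<A>" "i \<notin> A" "insert i A \<in> \<A>" using A(4) i by blast
    have "z (insert i A) - z A = (\<Sum>k<r. (of_int (t (insert i A) k) - of_int (t A k)) *\<^sub>R d k)"
      by (simp add: z_def sum_subtractf scaleR_diff_left)
    also have "\<dots> = (\<Sum>k<r. (if k = i then 1 else 0) *\<^sub>R d k)"
      using A'(2) by (intro sum.cong) (auto simp: t_def)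
    also have "\<dots> = d i" using i by (simp add: if_distrib[of "\<lambda>c. c *\<^sub>R _"] cong: if_cong)
    finally show ?thesis using A' by auto
  qed

  have zZf: "z A \<in> Zf" if "A \<in> \<A>" for A using that by (auto simp: Zf_def Z_def)
  have dZ: "d i \<in> span Zf" if i: "i < r" for i
  proof -
    obtain A where "A \<in> \<A>" "insert i A \<in> \<A>" "d i = z (insert i A) - z A" using diffZ[OF i] by blast
    then show ?thesis using span_diff[OF span_base[OF zZf] span_base[OF zZf]] by metis
  qed
  have "real \<gamma> *\<^sub>R y r = z {} - (\<Sum>i<r. of_int (t {} i) *\<^sub>R d i)" by (simp add: z_def)
  moreover have "\<dots> \<in> span Zf"
  proof (rule span_diff[OF span_base[OF zZf[OF A(2)]]])
    show "(\<Sum>i<r. of_int (t {} i) *\<^sub>R d i) \<in> span Zf" by (intro span_sum span_scale dZ) simp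
  qed
  ultimately have "(1 / real \<gamma>) *\<^sub>R (real \<gamma> *\<^sub>R y r) \<in> span Zf" by (metis span_scale)
  then have yr: "y r \<in> span Zf" using g by simp
  have yspan: "y i \<in> span Zf" if "i \<le> r" for i
    using that
  proof (induction i rule: inc_induct)
    case (step i)
    have "y i = d i + y (Suc i)" by (simp add: d_def)
    then show ?case using span_add[OF dZ[OF step(2)] step(3)] by simp
  qed (rule yr)
  have "K \<subseteq> span Zf" using yspan y(2) by (auto simp: bij_betw_def)
  then have Esp: "E \<subseteq> span Zf" using span_superset[of Zf] by (auto simp: Zf_def)
  have Zsp: "Zf \<subseteq> span E" using zspan span_mono[OF K(1)] span_superset[of E] by (auto simp: Zf_def Z_def)
  have finZf: "finite Zf" using finZ b(5) by (simp add: Zf_def)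
  \<comment> \<open>Independence by counting: \<open>Zf\<close> spans and has no more elements than
    the basis \<open>E\<close>.\<close>
  have "card Zf \<le> card Z + card (E - K)" unfolding Zf_def by (rule card_Un_le)
  also have "\<dots> \<le> card K + card (E - K)" using cardZ by simp
  also have "\<dots> = card E" using K(1) finK b(5) by (simp add: card_Diff_subset card_mono)
  finally have cardZf: "card Zf \<le> dim (span E)" using dim_span_eq_card_independent[OF b(1)] by simp
  have span_sub: "span E \<subseteq> span Zf" using Esp span_minimal[OF _ subspace_span] by blast
  have ind: "independent Zf" by (rule card_le_dim_spanning[OF Zsp span_sub finZf cardZf])
  have spE: "x \<in> span Zf" if "x \<in> L" for x using that b(3) span_sub by blast

  have frozen: "coord Zf j x = coord E j x" if "x \<in> L" "j \<in> E - K" for x j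
  proof (rule linear_eq_on_span[OF linear_coord[OF ind] linear_coord[OF b(1)] _ spE[OF that(1)]])
    fix v assume v: "v \<in> Zf"
    show "coord Zf j v = coord E j v"
    proof (cases "v \<in> E - K")
      case True
      then show ?thesis using v by (simp add: coord_basis[OF ind] coord_basis[OF b(1)])
    next
      case False
      then have "v \<in> span K" using v zspan by (auto simp: Zf_def Z_def)
      then have "coord E j v = 0"
      proof (rule linear_eq_on_span[OF linear_coord[OF b(1)] linear_zero, rotated])
        fix u assume "u \<in> K"
        then show "coord E j u = 0" using that(2) K(1) by (auto simp: coord_basis[OF b(1)])
      qed
      moreover have "v \<noteq> j" using False that(2) by auto
      ultimately show ?thesis by (simp add: coord_basis[OF ind v])
    qed
  qed

  \<comment> \<open>\<open>M\<close> consists of the points integral over \<open>Zf\<close>. It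
    contains all \<open>d i\<close> and \<open>real \<gamma> *\<^sub>R y r\<close>, though perhaps
    not \<open>y r\<close> itself. Hence modulo \<open>M\<close> a lattice point is determined by
    its coefficient sum \<open>h\<close> modulo \<open>\<gamma>\<close>, and this bounds the
    multiplicity.\<close>
  define M where "M = {x. \<forall>v\<in>Zf. coord Zf v x \<in> \<int>}"
  have M: "zsubgroup M" unfolding M_def zsubgroup_def
    by (auto simp: linear_diff[OF linear_coord[OF ind]] linear_0[OF linear_coord[OF ind]])
  have ZfM: "Zf \<subseteq> M" by (auto simp: M_def coord_basis[OF ind])
  have dM: "d i \<in> M" if i: "i < r" for i
  proof -
    obtain A where "A \<in> \<A>" "insert i A \<in> \<A>" "d i = z (insert i A) - z A" using diffZ[OF i] by blast
    then show ?thesis using zsubgroup_diff[OF M] zZf ZfM by (metis subsetD)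
  qed
  have "z {} \<in> M" using ZfM zZf[OF A(2)] by blast
  moreover have "(\<Sum>i<r. of_int (t {} i) *\<^sub>R d i) \<in> M"
    using dM by (intro zsubgroup_sum[OF M] zsubgroup_int_scale[OF M]) auto
  moreover have "real \<gamma> *\<^sub>R y r = z {} - (\<Sum>i<r. of_int (t {} i) *\<^sub>R d i)" by (simp add: z_def)
  ultimately have gyM: "real \<gamma> *\<^sub>R y r \<in> M" using zsubgroup_diff[OF M] by metis

  define h where "h x = (\<Sum>v\<in>K. coord E v x)" for x
  have hint: "h x \<in> \<int>" if "x \<in> L" for x
    unfolding h_def using b(6)[OF that] K(1) by (intro Ints_sum) auto
  have hM: "x \<in> M" if x: "x \<in> L" and hx: "h x = real_of_int k * real \<gamma>" for x k
  proof -
    have "x = (\<Sum>v\<in>E. coord E v x *\<^sub>R v)" using span_lincomb[OF b(1)] x b(3) by blast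
    also have "\<dots> = (\<Sum>v\<in>K. coord E v x *\<^sub>R v) + (\<Sum>v\<in>E - K. coord E v x *\<^sub>R v)"
      using sum.subset_diff[OF K(1) b(5)] by (simp add: add.commute)
    finally have x': "x = (\<Sum>v\<in>K. coord E v x *\<^sub>R v) + (\<Sum>v\<in>E - K. coord E v x *\<^sub>R v)" .
    have "(\<Sum>v\<in>K. coord E v x *\<^sub>R v) = h x *\<^sub>R y r
        + (\<Sum>i<r. (\<Sum>j\<le>i. coord E (y j) x) *\<^sub>R d i)"
      unfolding toK[of "\<lambda>v. coord E v x *\<^sub>R v"] summation_by_parts d_def h_def toK[of "\<lambda>v. coord E v x"] ..
    also have "h x *\<^sub>R y r = real_of_int k *\<^sub>R (real \<gamma> *\<^sub>R y r)" by (simp add: hx)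
    finally have eqK: "(\<Sum>v\<in>K. coord E v x *\<^sub>R v) = real_of_int k *\<^sub>R (real \<gamma> *\<^sub>R y r)
        + (\<Sum>i<r. (\<Sum>j\<le>i. coord E (y j) x) *\<^sub>R d i)" .
    have "(\<Sum>j\<le>i. coord E (y j) x) \<in> \<int>" if "i < r" for i
      using that by (intro Ints_sum b(6)[OF x] yE) auto
    then have "(\<Sum>v\<in>K. coord E v x *\<^sub>R v) \<in> M" unfolding eqK
      by (intro zsubgroup_add[OF M zsubgroup_int_scale[OF M gyM]] zsubgroup_sum[OF M]
          zsubgroup_int_scale[OF M dM]) auto
    moreover have "(\<Sum>v\<in>E - K. coord E v x *\<^sub>R v) \<in> M"
      using ZfM b(6)[OF x] by (intro zsubgroup_int_lincomb[OF M]) (auto simp: Zf_def)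
    ultimately have "(\<Sum>v\<in>K. coord E v x *\<^sub>R v) + (\<Sum>v\<in>E - K. coord E v x *\<^sub>R v) \<in> M"
      by (rule zsubgroup_add[OF M])
    then show ?thesis by (simp only: x'[symmetric])
  qed
  have inj_box: "inj_on (\<lambda>x. \<lfloor>h x\<rfloor> mod int \<gamma>) (box_pts Zf L)"
  proof (rule inj_onI)
    fix x x' assume x: "x \<in> box_pts Zf L" and x': "x' \<in> box_pts Zf L"
      and e: "\<lfloor>h x\<rfloor> mod int \<gamma> = \<lfloor>h x'\<rfloor> mod int \<gamma>"
    have xL: "x \<in> L" "x' \<in> L" using x x' by (auto simp: box_pts_def)
    obtain k where k: "\<lfloor>h x\<rfloor> - \<lfloor>h x'\<rfloor> = int \<gamma> * k" using e by (auto simp: mod_eq_dvd_iff elim: dvdE)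
    have "h (x - x') = h x - h x'"
      by (simp add: h_def linear_diff[OF linear_coord[OF b(1)]] sum_subtractf)
    also have "\<dots> = of_int (\<lfloor>h x\<rfloor> - \<lfloor>h x'\<rfloor>)"
      using hint[OF xL(1)] hint[OF xL(2)] by (auto elim!: Ints_cases)
    finally have "h (x - x') = real_of_int k * real \<gamma>" by (simp add: k)
    then have dM': "x - x' \<in> M" using hM[OF zsubgroup_diff[OF b(4) xL]] by blast
    show "x = x'"
    proof (rule coord_eqI[OF ind spE[OF xL(1)] spE[OF xL(2)]])
      fix v assume v: "v \<in> Zf"
      have "coord Zf v x - coord Zf v x' \<in> \<int>"
        using dM' v by (simp add: M_def linear_diff[OF linear_coord[OF ind]])
      moreover have "\<bar>coord Zf v x - coord Zf v x'\<bar> < 1"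
        using x x' v by (auto simp: box_pts_def abs_less_iff) (smt (verit))+
      ultimately have "coord Zf v x - coord Zf v x' = 0" by (rule Ints_nonzero_abs_less1)
      then show "coord Zf v x = coord Zf v x'" by simp
    qed
  qed
  have img: "(\<lambda>x. \<lfloor>h x\<rfloor> mod int \<gamma>) ` box_pts Zf L \<subseteq> {0..<int \<gamma>}" using g by auto
  have finbox: "finite (box_pts Zf L)" by (rule finite_imageD[OF finite_subset[OF img] inj_box]) simp
  have boxcard: "card (box_pts Zf L) \<le> \<gamma>" using card_inj_on_le[OF inj_box img] by simp
  have "lattice_frame Zf L"
    using ind finbox b(4) spE zL b(2) by (auto simp: lattice_frame_def Zf_def Z_def)
  moreover have "q \<in> nonneg_span Z"
  proof -
    have "(\<Sum>A\<in>\<A>. w A *\<^sub>R z A)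
        = (\<Sum>A\<in>\<A>. w A *\<^sub>R (real \<gamma> *\<^sub>R y r)) + (\<Sum>A\<in>\<A>. \<Sum>i<r. (w A * of_int (t A i)) *\<^sub>R d i)"
      by (simp add: z_def scaleR_add_right sum.distrib scaleR_sum_right)
    also have "(\<Sum>A\<in>\<A>. w A *\<^sub>R (real \<gamma> *\<^sub>R y r)) = (\<Sum>A\<in>\<A>. w A) *\<^sub>R (real \<gamma> *\<^sub>R y r)"
      by (rule scaleR_sum_left[symmetric])
    also have "(\<Sum>A\<in>\<A>. \<Sum>i<r. (w A * of_int (t A i)) *\<^sub>R d i) = (\<Sum>i<r. (\<Sum>A\<in>\<A>. w A * of_int (t A i)) *\<^sub>R d i)"
      by (subst sum.swap) (simp add: scaleR_sum_left)
    also have "\<dots> = (\<Sum>i<r. T i *\<^sub>R d i)"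
    proof (rule sum.cong)
      fix i assume "i \<in> {..<r}"
      then have i: "i < r" by simp
      have "(\<Sum>A\<in>\<A>. w A * of_int (t A i))
          = (\<Sum>A\<in>\<A>. w A * (of_int \<lceil>T i\<rceil> - 1)) + (\<Sum>A\<in>\<A>. if i \<in> A then w A else 0)"
        unfolding sum.distrib[symmetric] using i by (intro sum.cong) (auto simp: t_def algebra_simps)
      also have "\<dots> = T i" using A(7) A(8) i by (simp flip: sum_distrib_right) (simp add: f_def flip: A(8))
      finally show "(\<Sum>A\<in>\<A>. w A * of_int (t A i)) *\<^sub>R d i = T i *\<^sub>R d i" by simp
    qed simp
    finally have "q = (\<Sum>A\<in>\<A>. w A *\<^sub>R z A)" using qT A(7) by simp
    moreover have "z A \<in> Z" if "A \<in> \<A>" for A using that by (simp add: Z_def)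
    ultimately show ?thesis using A(6)
      by (simp add: nonneg_span_sum nonneg_span_scale nonneg_span_base[OF finZ])
  qed
  moreover have "\<forall>x\<in>L. \<forall>j\<in>E - K. coord Zf j x \<in> \<int>" using frozen b(6) by auto
  moreover have "\<exists>\<zeta>. v = (\<Sum>y\<in>K. \<zeta> y *\<^sub>R y) \<and> (\<Sum>y\<in>K. \<zeta> y) = real \<gamma>
        \<and> (\<forall>y\<in>K - {e}. 0 \<le> \<zeta> y \<and> \<zeta> y \<le> \<eta> y + 2) \<and> lev q - 1 \<le> lev v" if vZ: "v \<in> Z" for v
  proof -
    obtain A where A': "A \<in> \<A>" "v = z A" using vZ by (auto simp: Z_def)
    define \<zeta> where "\<zeta> u = real_of_int (a A (the_inv_into {..r} y u))" for u
    have \<zeta>y: "\<zeta> (y j) = a A j" if "j \<le> r" for j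
      using that the_inv_into_f_f[OF inj, of j] by (simp add: \<zeta>_def)
    have "v = (\<Sum>u\<in>K. \<zeta> u *\<^sub>R u)"
      unfolding A'(2) za toK[of "\<lambda>u. \<zeta> u *\<^sub>R u"] by (intro sum.cong) (auto simp: \<zeta>y)
    moreover have "(\<Sum>u\<in>K. \<zeta> u) = real \<gamma>"
    proof -
      have "(\<Sum>j\<le>r. \<zeta> (y j)) = (\<Sum>j\<le>r. real_of_int (a A j))" by (rule sum.cong) (auto simp: \<zeta>y)
      then show ?thesis unfolding toK[of \<zeta>] sum_a' by (simp add: t_def)
    qed
    moreover have "0 \<le> \<zeta> u \<and> \<zeta> u \<le> \<eta> u + 2" if u: "u \<in> K - {e}" for u
    proof -
      obtain j where j: "j \<le> r" "u = y j" using u y(2) by (auto simp: bij_betw_def)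
      then have "0 < j" using u y(1) by (cases j) auto
      then show ?thesis using a_nonneg[OF A'(1) _ j(1)] a_le[of j A] j by (simp add: \<zeta>y)
    qed
    moreover have "lev q - 1 \<le> lev v"
    proof -
      have ld: "0 \<le> lev (d i)" if "i < r" for i using y(3)[OF that] by (simp add: d_def linear_diff[OF lev])
      have vq: "v - q = (\<Sum>i<r. (of_int (t A i) - T i) *\<^sub>R d i)"
        by (simp add: A'(2) z_def qT sum_subtractf scaleR_diff_left)
      have "lev v - lev q = lev (v - q)" by (simp add: linear_diff[OF lev])
      also have "\<dots> = (\<Sum>i<r. (of_int (t A i) - T i) * lev (d i))"
        unfolding vq by (simp add: linear_sum[OF lev] linear_scale[OF lev])
      \<comment> \<open>Each partial sum moves down by at most 1 and \<open>lev (d i)\<close> is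
        nonnegative, so the loss is at most the telescoping sum \<open>lev e - lev (y r)\<close>,
        which is at most 1.\<close>
      also have "\<dots> \<ge> (\<Sum>i<r. (- 1) * lev (d i))"
        using ld tT(2) by (intro sum_mono mult_right_mono) (auto simp: less_imp_le algebra_simps)
      also have "(\<Sum>i<r. (- 1) * lev (d i)) = lev (y r) - lev (y 0)"
        using sum_lessThan_telescope[of "\<lambda>i. lev (y i)" r] by (simp add: d_def linear_diff[OF lev])
      also have "\<dots> \<ge> - 1" using bot[OF yK[of r]] y(1) by simp
      finally show ?thesis by simp
    qed
    ultimately show ?thesis by blast
  qed
  ultimately show ?thesis using that[of Z] cardZ finZ boxcard unfolding Zf_def by blast
qed

section \<open>Projection along a generator\<close>

text \<open>The image of \<open>L\<close> models the quotient by the line through \<open>v\<close>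
  inside the same vector space, so that the induction on dimension stays within one type.\<close>

definition proj_away :: "(real^'n) set \<Rightarrow> real^'n \<Rightarrow> real^'n \<Rightarrow> real^'n" where
  "proj_away V v x = x - coord V v x *\<^sub>R v"

lemma linear_proj_away: "independent V \<Longrightarrow> linear (proj_away V v)"
  using linear_coord[of V v]
  by (auto intro!: linearI simp: proj_away_def linear_add linear_scale algebra_simps)

lemma proj_away_basis:
  assumes "independent V" "v \<in> V"
  shows proj_away_self: "proj_away V v v = 0"
    and proj_away_other: "\<And>u. u \<in> V - {v} \<Longrightarrow> proj_away V v u = u"
  using assms by (auto simp: proj_away_def coord_basis)

lemma independent_remove: "independent V \<Longrightarrow> independent (V - {v})" for V :: "(real^'n) set"
  using independent_mono by blast

lemma proj_away_span:
  assumes V: "independent V" "v \<in> V" and x: "x \<in> span V"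
  shows "proj_away V v x \<in> span (V - {v})"
proof -
  have eq: "x = coord V v x *\<^sub>R v + (\<Sum>u\<in>V - {v}. coord V u x *\<^sub>R u)"
    by (subst span_lincomb[OF V(1) x]) (rule sum.remove[OF indep_finite[OF V(1)] V(2)])
  have "proj_away V v x = (\<Sum>u\<in>V - {v}. coord V u x *\<^sub>R u)"
    unfolding proj_away_def diff_eq_eq by (rule trans[OF eq add.commute])
  then show ?thesis by (simp only:) (intro span_sum span_scale span_base)
qed

lemma coord_proj_away:
  assumes V: "independent V" "v \<in> V" and u: "u \<in> V - {v}" and x: "x \<in> span V"
  shows "coord (V - {v}) u (proj_away V v x) = coord V u x"
proof (rule linear_eq_on_span[OF _ linear_coord[OF V(1)] _ x])
  note V0 = independent_remove[OF V(1), of v]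
  show "linear (\<lambda>x. coord (V - {v}) u (proj_away V v x))"
    using linear_compose[OF linear_proj_away[OF V(1)] linear_coord[OF V0]] by (simp add: o_def)
  fix w assume w: "w \<in> V"
  show "coord (V - {v}) u (proj_away V v w) = coord V u w"
  proof (cases "w = v")
    case True
    then show ?thesis using u V
      by (auto simp: proj_away_self coord_basis linear_0[OF linear_coord[OF V0]])
  next
    case False
    then show ?thesis using w V
      by (simp add: proj_away_other coord_basis coord_basis[OF V0])
  qed
qed

lemma deg_proj_away:
  assumes V: "independent V" "v \<in> V" and x: "x \<in> span V"
  shows "deg V x = coord V v x + deg (V - {v}) (proj_away V v x)"
proof -
  have "deg (V - {v}) (proj_away V v x) = (\<Sum>u\<in>V - {v}. coord V u x)"
    unfolding deg_def by (rule sum.cong) (auto simp: coord_proj_away[OF V _ x])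
  then show ?thesis unfolding deg_def using sum.remove[OF indep_finite[OF V(1)] V(2)] by simp
qed

lemma proj_away_cone:
  assumes V: "independent V" "v \<in> V" and p: "p \<in> nonneg_span V"
  shows "proj_away V v p \<in> nonneg_span (V - {v})"
proof -
  have "p \<in> span V" "\<forall>u\<in>V. 0 \<le> coord V u p" using p nonneg_span_coord[OF V(1)] by auto
  then show ?thesis using proj_away_span[OF V] coord_proj_away[OF V]
    by (auto simp: nonneg_span_coord[OF independent_remove[OF V(1)]])
qed

text \<open>Finiteness is the point: subtracting an integral multiple of \<open>v\<close> lifts
  every point of the new parallelepiped to a point of the old one.\<close>

lemma proj_away_frame:
  assumes V: "lattice_frame V L" "v \<in> V"
  shows "lattice_frame (V - {v}) (proj_away V v ` L)"
proof -
  note f = lattice_frameD[OF V(1)]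
  let ?\<pi> = "proj_away V v"
  note lin = linear_proj_away[OF f(1), of v]
  have V0: "V - {v} \<subseteq> ?\<pi> ` L"
  proof
    fix u assume u: "u \<in> V - {v}"
    then have "u = ?\<pi> u" using proj_away_other[OF f(1) V(2)] by simp
    then show "u \<in> ?\<pi> ` L" using u f(2) by blast
  qed
  have sp: "?\<pi> ` L \<subseteq> span (V - {v})" using proj_away_span[OF f(1) V(2)] f(3) by auto
  have grp: "zsubgroup (?\<pi> ` L)"
    unfolding zsubgroup_def
  proof (intro conjI ballI)
    show "0 \<in> ?\<pi> ` L" using linear_0[OF lin] zsubgroup_zero[OF f(4)] by force
    fix x y assume "x \<in> ?\<pi> ` L" "y \<in> ?\<pi> ` L"
    then obtain a b where "a \<in> L" "b \<in> L" "x = ?\<pi> a" "y = ?\<pi> b" by auto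
    then have "x - y = ?\<pi> (a - b)" "a - b \<in> L" using linear_diff[OF lin] zsubgroup_diff[OF f(4)] by auto
    then show "x - y \<in> ?\<pi> ` L" by blast
  qed
  have "box_pts (V - {v}) (?\<pi> ` L) \<subseteq> ?\<pi> ` box_pts V L"
  proof
    fix x assume x: "x \<in> box_pts (V - {v}) (?\<pi> ` L)"
    then obtain a where a: "a \<in> L" "x = ?\<pi> a" by (auto simp: box_pts_def)
    define k where "k = real_of_int \<lfloor>coord V v a\<rfloor>"
    define b where "b = a - k *\<^sub>R v"
    have kv: "k *\<^sub>R v \<in> L" using f(2) V(2) by (intro zsubgroup_int_scale[OF f(4)]) (auto simp: k_def)
    have bL: "b \<in> L" unfolding b_def by (rule zsubgroup_diff[OF f(4) a(1) kv])
    have \<pi>b: "?\<pi> b = x"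
      by (simp add: b_def a(2) linear_diff[OF lin] linear_scale[OF lin] proj_away_self[OF f(1) V(2)])
    have "coord V v b = frac (coord V v a)"
      by (simp add: b_def k_def linear_diff[OF linear_coord[OF f(1)]] linear_scale[OF linear_coord[OF f(1)]]
          coord_basis[OF f(1) V(2)] frac_def)
    moreover have "0 \<le> coord V u b \<and> coord V u b < 1" if "u \<in> V - {v}" for u
    proof -
      have "coord V u b = coord (V - {v}) u x"
        using coord_proj_away[OF f(1) V(2) that, of b] bL f(3) \<pi>b by auto
      then show ?thesis using x that by (simp add: box_pts_def)
    qed
    ultimately have "0 \<le> coord V u b \<and> coord V u b < 1" if "u \<in> V" for u
      using that by (cases "u = v") (auto simp: frac_lt_1)
    then have "b \<in> box_pts V L" using bL by (simp add: box_pts_def)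
    then show "x \<in> ?\<pi> ` box_pts V L" using \<pi>b by blast
  qed
  then have "finite (box_pts (V - {v}) (?\<pi> ` L))" using f(5) by (meson finite_imageI finite_subset)
  then show ?thesis using independent_remove[OF f(1)] V0 sp grp by (simp add: lattice_frame_def)
qed

text \<open>A non-integral \<open>t\<close> would put the lattice point
  \<open>frac t *\<^sub>R v\<close>, of degree strictly between 0 and 1, into the cone.\<close>

lemma empty_frame_primitive:
  assumes V: "empty_frame V L" "v \<in> V" and t: "t *\<^sub>R v \<in> L"
  shows "t \<in> \<int>"
proof (rule ccontr)
  assume nt: "t \<notin> \<int>"
  have F: "lattice_frame V L" using V by (simp add: empty_frame_def)
  note f = lattice_frameD[OF F]
  define x where "x = frac t *\<^sub>R v"
  have c: "coord V v x = frac t"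
    by (simp add: x_def linear_scale[OF linear_coord[OF f(1)]] coord_basis[OF f(1) V(2)])
  have fr: "0 < frac t" "frac t < 1" using nt by (auto simp: frac_lt_1 frac_gt_0_iff)
  have "x = t *\<^sub>R v - of_int \<lfloor>t\<rfloor> *\<^sub>R v" by (simp add: x_def frac_def scaleR_diff_left)
  moreover have "of_int \<lfloor>t\<rfloor> *\<^sub>R v \<in> L" using f(2) V(2) by (intro zsubgroup_int_scale[OF f(4)]) auto
  ultimately have xL: "x \<in> L" using zsubgroup_diff[OF f(4) t] by simp
  have xc: "x \<in> nonneg_span V" unfolding x_def
    using fr V(2) by (intro nonneg_span_scale nonneg_span_base[OF f(6)]) auto
  have "x \<noteq> 0" using c fr linear_0[OF linear_coord[OF f(1)], of v] by auto
  moreover have "x \<notin> V" using c fr coord_basis[OF f(1), of x v] by (auto split: if_splits)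
  ultimately have "1 < deg V x" using V(1) xL xc by (simp add: empty_frame_def)
  moreover have "deg V x = frac t" by (simp add: x_def linear_scale[OF linear_deg[OF f(1)]] deg_basis[OF f(1) V(2)])
  ultimately show False using fr by simp
qed

text \<open>A basis of the quotient lifts to a basis because, by primitivity, the kernel of the
  projection on \<open>L\<close> consists of the integral multiples of \<open>v\<close>. Lifts are
  unique up to these multiples, so their \<open>v\<close>-coordinates can be normalized to [0,
  1).\<close>

lemma lift_basis:
  assumes V: "empty_frame V L" "v \<in> V" and Y: "lattice_basis Y (proj_away V v ` L)"
  obtains W where "v \<notin> W" "lattice_basis (insert v W) L" "card W = card V - 1" "proj_away V v ` W = Y"
    "\<And>w. w \<in> W \<Longrightarrow> 0 \<le> coord V v w \<and> coord V v w < 1"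
    "\<And>w x. w \<in> W \<Longrightarrow> x \<in> span V \<Longrightarrow> coord (insert v W) w x = coord Y (proj_away V v w) (proj_away V v x)"
proof -
  have F: "lattice_frame V L" using V by (simp add: empty_frame_def)
  note f = lattice_frameD[OF F] and b = lattice_basisD[OF Y]
  let ?\<pi> = "proj_away V v"
  note lin = linear_proj_away[OF f(1), of v]
  have "\<exists>x. x \<in> L \<and> ?\<pi> x = y \<and> 0 \<le> coord V v x \<and> coord V v x < 1" if y: "y \<in> Y" for y
  proof -
    obtain a where a: "a \<in> L" "y = ?\<pi> a" using b(2) y by auto
    define k where "k = real_of_int \<lfloor>coord V v a\<rfloor>"
    have "k *\<^sub>R v \<in> L" using f(2) V(2) by (intro zsubgroup_int_scale[OF f(4)]) (auto simp: k_def)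
    then have "a - k *\<^sub>R v \<in> L" by (rule zsubgroup_diff[OF f(4) a(1)])
    moreover have "?\<pi> (a - k *\<^sub>R v) = y"
      by (simp add: a(2) linear_diff[OF lin] linear_scale[OF lin] proj_away_self[OF f(1) V(2)])
    moreover have "coord V v (a - k *\<^sub>R v) = frac (coord V v a)"
      by (simp add: k_def linear_diff[OF linear_coord[OF f(1)]] linear_scale[OF linear_coord[OF f(1)]]
          coord_basis[OF f(1) V(2)] frac_def)
    ultimately show ?thesis by (intro exI[of _ "a - k *\<^sub>R v"]) (simp add: frac_lt_1)
  qed
  then obtain s where s: "\<And>y. y \<in> Y \<Longrightarrow> s y \<in> L \<and> ?\<pi> (s y) = y \<and> 0 \<le> coord V v (s y) \<and> coord V v (s y) < 1"
    by metis
  define W where "W = s ` Y"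
  define E where "E = insert v W"
  have inj: "inj_on s Y" by (rule inj_onI) (metis s)
  have \<pi>inj: "w = w'" if "w \<in> W" "w' \<in> W" "?\<pi> w = ?\<pi> w'" for w w' using that s by (auto simp: W_def)
  have \<pi>W: "?\<pi> w \<in> Y" if "w \<in> W" for w using that s by (auto simp: W_def)
  have "?\<pi> ` W = Y" unfolding W_def image_image using s by simp
  have nz: "y \<noteq> 0" if "y \<in> Y" for y using b(1) that dependent_zero by blast
  have vW: "v \<notin> W" using \<pi>W nz proj_away_self[OF f(1) V(2)] by metis
  have "card Y = dim (span (V - {v}))"
  proof -
    have "span Y = span (V - {v})"
    proof -
      have "Y \<subseteq> span (V - {v})" using b(2) f(3) proj_away_span[OF f(1) V(2)] by auto
      moreover have "V - {v} \<subseteq> span Y"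
        using lattice_frameD(2)[OF proj_away_frame[OF F V(2)]] b(3) by blast
      ultimately show ?thesis by (simp only: span_eq simp_thms)
    qed
    then show ?thesis using dim_span_eq_card_independent[OF b(1)] by simp
  qed
  then have cY: "card Y = card V - 1"
    using dim_span_eq_card_independent[OF independent_remove[OF f(1), of v]] V(2) f(6) by simp
  have cW: "card W = card V - 1" using card_image[OF inj] cY by (simp add: W_def)
  have "card V \<noteq> 0" using V(2) f(6) by auto
  then have cE: "card E = card V" using vW b(5) cW by (simp add: E_def W_def)
  have EL: "E \<subseteq> L" using s f(2) V(2) by (auto simp: E_def W_def)
  \<comment> \<open>\<open>M x\<close> is the combination of the lifts with the same projection as
    \<open>x\<close>; for \<open>x\<close> in \<open>L\<close> the difference \<open>x - M x\<close>
    is an integral multiple of \<open>v\<close>.\<close>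
  define M where "M x = (\<Sum>y\<in>Y. coord Y y (?\<pi> x) *\<^sub>R s y)" for x
  have dec: "\<exists>t\<in>\<int>. x = t *\<^sub>R v + M x" if x: "x \<in> L" for x
  proof -
    have MxL: "M x \<in> L" unfolding M_def using s b(6) x
      by (intro zsubgroup_sum[OF f(4)] zsubgroup_int_scale[OF f(4)]) auto
    have "?\<pi> (M x) = (\<Sum>y\<in>Y. coord Y y (?\<pi> x) *\<^sub>R y)"
      unfolding M_def using s by (simp add: linear_sum[OF lin] linear_scale[OF lin])
    also have "\<dots> = ?\<pi> x"
      by (rule span_lincomb[symmetric, OF b(1)]) (use x b(3) in blast)
    finally have "?\<pi> (x - M x) = 0" by (simp add: linear_diff[OF lin])
    then have e: "x - M x = coord V v (x - M x) *\<^sub>R v" by (simp add: proj_away_def)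
    have "x - M x \<in> L" by (rule zsubgroup_diff[OF f(4) x MxL])
    then have "coord V v (x - M x) \<in> \<int>" using e empty_frame_primitive[OF V] by metis
    then show ?thesis using e by (intro bexI[of _ "coord V v (x - M x)"]) (simp_all add: algebra_simps)
  qed
  have finE: "finite E" using b(5) by (simp add: E_def W_def)
  have Lsp: "x \<in> span E" if x: "x \<in> L" for x
  proof -
    obtain t where "x = t *\<^sub>R v + M x" using dec[OF x] by blast
    moreover have "t *\<^sub>R v + M x \<in> span E" unfolding M_def
      by (intro span_add span_sum span_scale span_base) (auto simp: E_def W_def)
    ultimately show ?thesis by simp
  qed
  have "V \<subseteq> span E" using f(2) Lsp by blast
  then have VE: "span V \<subseteq> span E" by (simp add: span_minimal)
  have EV: "E \<subseteq> span V" using EL f(3) by blast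
  have indE: "independent E"
    by (rule card_le_dim_spanning[OF EV VE finE]) (use cE dim_span_eq_card_independent[OF f(1)] in linarith)
  have coordW: "coord E w x = coord Y (?\<pi> w) (?\<pi> x)" if w: "w \<in> W" and x: "x \<in> span V" for w x
  proof (rule linear_eq_on_span[OF linear_coord[OF indE]])
    show "linear (\<lambda>x. coord Y (?\<pi> w) (?\<pi> x))"
      using linear_compose[OF lin linear_coord[OF b(1)]] by (simp add: o_def)
    show "x \<in> span E" using x VE by blast
    fix u assume u: "u \<in> E"
    show "coord E w u = coord Y (?\<pi> w) (?\<pi> u)"
    proof (cases "u = v")
      case True
      then show ?thesis using vW w u
        by (auto simp: coord_basis[OF indE] proj_away_self[OF f(1) V(2)] linear_0[OF linear_coord[OF b(1)]])
    next
      case False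
      then have uW: "u \<in> W" using u by (simp add: E_def)
      have "u = w \<longleftrightarrow> ?\<pi> u = ?\<pi> w" using \<pi>inj[OF uW w] by auto
      then show ?thesis using u by (simp add: coord_basis[OF indE] coord_basis[OF b(1) \<pi>W[OF uW]])
    qed
  qed
  have "coord E u x \<in> \<int>" if x: "x \<in> L" and u: "u \<in> E" for x u
  proof (cases "u = v")
    case True
    obtain t where t: "t \<in> \<int>" "x = t *\<^sub>R v + M x" using dec[OF x] by blast
    have "coord E v (M x) = (\<Sum>y\<in>Y. coord Y y (?\<pi> x) * coord E v (s y))"
      unfolding M_def by (simp add: linear_sum[OF linear_coord[OF indE]] linear_scale[OF linear_coord[OF indE]])
    also have "\<dots> = 0"
    proof (intro sum.neutral ballI)
      fix y assume "y \<in> Y"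
      then have "s y \<in> E" "s y \<noteq> v" using vW by (auto simp: E_def W_def)
      then show "coord Y y (?\<pi> x) * coord E v (s y) = 0" by (simp add: coord_basis[OF indE])
    qed
    finally have "coord E v (M x) = 0" .
    moreover have vE: "v \<in> E" by (simp add: E_def)
    ultimately have "coord E v (t *\<^sub>R v + M x) = t"
      by (simp add: linear_add[OF linear_coord[OF indE]] linear_scale[OF linear_coord[OF indE]]
          coord_basis[OF indE vE])
    then show ?thesis using t True by metis
  next
    case False
    then have "u \<in> W" using u by (simp add: E_def)
    then show ?thesis using coordW[of u x] x f(3) b(6)[OF _ \<pi>W, of "?\<pi> x" u] by auto
  qed
  then have "lattice_basis E L" using indE EL Lsp f(4) by (auto simp: lattice_basis_def)
  then show ?thesis using that[of W] vW cW \<open>?\<pi> ` W = Y\<close> s coordW by (auto simp: E_def W_def)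
qed

section \<open>The corner step\<close>

text \<open>
  For \<open>m \<ge> 3\<close> this is the result of refining a cone of multiplicity at most \<open>m\<close> whose \<open>m\<close> generators
  have degree at most \<open>3 m\<^sup>2 - 4 m + 2\<close>.
\<close>

definition degree_bound :: "nat \<Rightarrow> real" where
  "degree_bound m = (if m \<le> 2 then 1 else real m * (3 * (real m)\<^sup>2 - 4 * real m + 2) / 2 * (3/2) ^ (m - 2))"

text \<open>The summand 1 pays for the \<open>v\<close>-coordinate of a lifted generator, which is
  below 1. The case \<open>m = 3\<close> is separate because \<open>degree_bound 2\<close> is
  exceptional.\<close>

lemma degree_bound_step:
  assumes "3 \<le> m"
  shows "degree_bound (m - 1) + 1 \<le> degree_bound m"
proof -
  obtain n where m: "m = n + 3" using assms by (metis add.commute le_Suc_ex)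
  define x where "x = real n"
  have x0: "0 \<le> x" by (simp add: x_def)
  define P where "P = (3/2::real) ^ n"
  have P1: "1 \<le> P" by (simp add: P_def)
  have tm: "degree_bound m = (x + 3) * (3 * (x + 3)\<^sup>2 - 4 * (x + 3) + 2) / 2 * (3 / 2 * P)"
    by (simp add: m degree_bound_def x_def P_def add.commute)
  have A: "(x + 3) * (3 * (x + 3)\<^sup>2 - 4 * (x + 3) + 2) = 3*x^3 + 23*x^2 + 59*x + 51"
    by (simp add: power2_eq_square power3_eq_cube algebra_simps)
  show ?thesis
  proof (cases "n = 0")
    case True
    then show ?thesis using tm by (simp add: m degree_bound_def x_def P_def power2_eq_square)
  next
    case False
    then have P: "P = 3/2 * (3/2) ^ (n - 1)" unfolding P_def by (simp flip: power_Suc)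
    have tm1: "degree_bound (m - 1) = (x + 2) * (3 * (x + 2)\<^sup>2 - 4 * (x + 2) + 2) / 2 * P"
      using False by (simp add: m degree_bound_def x_def P_def add.commute)
    have B: "(x + 2) * (3 * (x + 2)\<^sup>2 - 4 * (x + 2) + 2) = 3*x^3 + 14*x^2 + 22*x + 12"
      by (simp add: power2_eq_square power3_eq_cube algebra_simps)
    have "1 * 1 \<le> ((3*x^3 + 23*x^2 + 59*x + 51) * (3/4) - (3*x^3 + 14*x^2 + 22*x + 12) / 2) * P"
    proof (rule mult_mono[OF _ P1])
      have "0 \<le> x^3" "0 \<le> x^2" using x0 by auto
      then show ge: "1 \<le> (3*x^3 + 23*x^2 + 59*x + 51) * (3/4) - (3*x^3 + 14*x^2 + 22*x + 12) / 2"
        using x0 by argo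
      show "0 \<le> (3*x^3 + 23*x^2 + 59*x + 51) * (3/4) - (3*x^3 + 14*x^2 + 22*x + 12) / 2"
        by (rule order_trans[OF zero_le_one ge])
    qed simp
    also have "\<dots> = degree_bound m - degree_bound (m - 1)" unfolding tm tm1 A B by (simp add: field_simps)
    finally show ?thesis by simp
  qed
qed

lemma degree_bound_ge_one: "1 \<le> degree_bound m"
proof (induction m)
  case (Suc m)
  then show ?case using degree_bound_step[of "Suc m"] by (cases "Suc m \<le> 2") (simp add: degree_bound_def, simp)
qed (simp add: degree_bound_def)

lemma corner_step:
  fixes V :: "(real^'n) set"
  assumes V: "empty_frame V L" and m: "card V = m" "3 \<le> m" and p: "p \<in> nonneg_span V"
    and IH: "\<And>(V0::(real^'n) set) L0 p0. lattice_frame V0 L0 \<Longrightarrow> card V0 = m - 1 \<Longrightarrow> p0 \<in> nonneg_span V0 \<Longrightarrow>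
       \<exists>Y. lattice_basis Y L0 \<and> Y \<subseteq> nonneg_span V0 \<and> p0 \<in> nonneg_span Y \<and> (\<forall>y\<in>Y. deg V0 y \<le> degree_bound (m - 1))"
  shows "\<exists>Y. lattice_basis Y L \<and> Y \<subseteq> nonneg_span V \<and> p \<in> nonneg_span Y \<and> (\<forall>y\<in>Y. deg V y \<le> degree_bound m)"
proof -
  have F: "lattice_frame V L" using V by (simp add: empty_frame_def)
  note f = lattice_frameD[OF F]
  have pc: "p \<in> span V" "\<And>u. u \<in> V \<Longrightarrow> 0 \<le> coord V u p" using p nonneg_span_coord[OF f(1)] by auto
  have "V \<noteq> {}" using m by auto
  then have "finite ((\<lambda>u. coord V u p) ` V)" "(\<lambda>u. coord V u p) ` V \<noteq> {}" using f(6) by auto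
  from Max_in[OF this] obtain v where v: "v \<in> V" "coord V v p = Max ((\<lambda>u. coord V u p) ` V)" by auto
  then have vmax: "coord V u p \<le> coord V v p" if "u \<in> V" for u using that f(6) by simp
  obtain Y0 where Y0: "lattice_basis Y0 (proj_away V v ` L)" "Y0 \<subseteq> nonneg_span (V - {v})"
    "proj_away V v p \<in> nonneg_span Y0" "\<forall>y\<in>Y0. deg (V - {v}) y \<le> degree_bound (m - 1)"
    using IH[OF proj_away_frame[OF F v(1)] _ proj_away_cone[OF f(1) v(1) p]] m(1) v(1) f(6) by auto
  obtain W where W: "v \<notin> W" "lattice_basis (insert v W) L" "card W = card V - 1" "proj_away V v ` W = Y0"
    "\<And>w. w \<in> W \<Longrightarrow> 0 \<le> coord V v w \<and> coord V v w < 1"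
    "\<And>w x. w \<in> W \<Longrightarrow> x \<in> span V \<Longrightarrow> coord (insert v W) w x = coord Y0 (proj_away V v w) (proj_away V v x)"
    using lift_basis[OF V v(1) Y0(1)] by blast
  define E where "E = insert v W"
  have E: "lattice_basis E L" using W(2) by (simp add: E_def)
  note e = lattice_basisD[OF E]
  have finW: "finite W" using e(5) by (simp add: E_def)
  define l where "l = coord V v"
  define D where "D x = deg (V - {v}) (proj_away V v x)" for x
  have linl: "linear l" by (simp add: l_def linear_coord[OF f(1)])
  have linD: "linear D"
    using linear_compose[OF linear_proj_away[OF f(1)] linear_deg[OF independent_remove[OF f(1)]]]
    by (simp add: D_def[abs_def] o_def)
  have degV: "deg V x = l x + D x" if "x \<in> span V" for x
    using deg_proj_away[OF f(1) v(1) that] by (simp add: l_def D_def)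
  have lv: "l v = 1" "D v = 0"
    using coord_basis[OF f(1) v(1)] proj_away_self[OF f(1) v(1)] linear_0[OF linear_deg[OF independent_remove[OF f(1)]]]
    by (simp_all add: l_def D_def)
  have Wspan: "w \<in> span V" if "w \<in> W" for w using that e(2) f(3) by (auto simp: E_def)
  have \<pi>W: "proj_away V v w \<in> nonneg_span (V - {v})" if "w \<in> W" for w using that W(4) Y0(2) by blast
  have Wcoord: "0 \<le> coord V u w" if "w \<in> W" "u \<in> V" for u w
  proof (cases "u = v")
    case False
    then have "u \<in> V - {v}" using that by simp
    then show ?thesis
      using coord_proj_away[OF f(1) v(1) _ Wspan[OF that(1)], of u] \<pi>W[OF that(1)]
        nonneg_span_coord[OF independent_remove[OF f(1)], of "proj_away V v w" v] by metis
  qed (use W(5) that in simp)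
  have Wcone: "w \<in> nonneg_span V" if "w \<in> W" for w
    using Wcoord[OF that] Wspan[OF that] nonneg_span_coord[OF f(1)] by blast
  have Wl: "0 \<le> l w" "l w < 1" if "w \<in> W" for w using W(5)[OF that] by (auto simp: l_def)
  have WD: "0 \<le> D w" "D w \<le> degree_bound (m - 1)" if "w \<in> W" for w
    using deg_nonneg[OF independent_remove[OF f(1)] \<pi>W[OF that]] Y0(4) W(4) that by (auto simp: D_def)
  have Wdeg: "deg V w \<le> degree_bound m" if "w \<in> W" for w
    using degV[OF Wspan[OF that]] WD[OF that] Wl[OF that] degree_bound_step[OF m(2)] by simp
  have W1: "1 \<le> l w + D w" if w: "w \<in> W" for w
  proof (cases "w \<in> V")
    case True
    then show ?thesis using degV[OF Wspan[OF w]] deg_basis[OF f(1) True] by simp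
  next
    case False
    have "w \<noteq> 0" using e(1) w dependent_zero by (auto simp: E_def)
    then show ?thesis using V Wcone[OF w] w e(2) False degV[OF Wspan[OF w]]
      by (force simp: empty_frame_def E_def)
  qed
  have vdeg: "deg V v \<le> degree_bound m" using deg_basis[OF f(1) v(1)] degree_bound_ge_one[of m] by simp
  have \<beta>: "0 \<le> coord E w p" if "w \<in> W" for w
    using W(6)[OF that pc(1)] Y0(3) W(4) nonneg_span_coord[OF lattice_basisD(1)[OF Y0(1)]] that
    by (auto simp: E_def)
  have pE: "p \<in> span E"
    using pc(1) span_mono[OF f(2)] span_minimal[OF e(3) subspace_span] by blast
  have vE: "v \<in> E" by (simp add: E_def)
  have Econe: "E \<subseteq> nonneg_span V" using Wcone nonneg_span_base[OF f(6) v(1)] by (auto simp: E_def)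
  show ?thesis
  proof (cases "0 \<le> coord E v p")
    case True
    moreover have "u = v \<or> u \<in> W" if "u \<in> E" for u using that by (simp add: E_def)
    ultimately have "\<forall>u\<in>E. 0 \<le> coord E u p" using \<beta> by blast
    then have "p \<in> nonneg_span E" using pE nonneg_span_coord[OF e(1)] by blast
    then show ?thesis using E Econe Wdeg vdeg by (intro exI[of _ E]) (auto simp: E_def)
  next
    case False
    \<comment> \<open>Maximality of the \<open>v\<close>-coordinate of \<open>p\<close> gives
      \<open>D p \<le> real (m - 1) * l p\<close>. \<open>G\<close> holds the lifts obeying the same
      inequality. The others violate it, so taking them out of \<open>p\<close> leaves it intact for
      \<open>pg\<close>.\<close>
    define G where "G = {w\<in>W. D w \<le> real (m - 1) * l w}"
    define K where "K = insert v G"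
    have GW: "G \<subseteq> W" by (auto simp: G_def)
    then have KE: "K \<subseteq> E" by (auto simp: K_def E_def)
    have vG: "v \<notin> G" using W(1) GW by blast
    have finG: "finite G" using GW finW finite_subset by blast
    have sumK: "(\<Sum>y\<in>K. h y) = h v + (\<Sum>y\<in>G. h y)" for h :: "real^'n \<Rightarrow> real"
      unfolding K_def using vG finG by simp
    have EK: "E - K = W - G" using W(1) by (auto simp: E_def K_def)
    define b where "b y = coord E y p" for y
    define pg where "pg = (\<Sum>y\<in>K. b y *\<^sub>R y)"
    define pb where "pb = (\<Sum>y\<in>E - K. b y *\<^sub>R y)"
    have ppp: "p = pb + pg"
      unfolding pb_def pg_def b_def
      by (subst span_lincomb[OF e(1) pE]) (rule sum.subset_diff[OF KE e(5)])
    have b0: "0 \<le> b w" if "w \<in> W" for w using \<beta>[OF that] by (simp add: b_def)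
    have \<alpha>: "b v < 0" using False by (simp add: b_def)
    have Dp: "D p \<le> real (m - 1) * l p"
    proof -
      have "D p = (\<Sum>u\<in>V - {v}. coord V u p)"
        unfolding D_def deg_def by (rule sum.cong) (auto simp: coord_proj_away[OF f(1) v(1) _ pc(1)])
      also have "\<dots> \<le> (\<Sum>u\<in>V - {v}. l p)" using vmax by (intro sum_mono) (auto simp: l_def)
      also have "\<dots> = real (m - 1) * l p" using m(1) v(1) f(6) by simp
      finally show ?thesis .
    qed
    have lb: "real (m - 1) * l pb \<le> D pb"
      unfolding pb_def linear_lincomb[OF linl] linear_lincomb[OF linD] sum_distrib_left EK
    proof (rule sum_mono)
      fix w assume w: "w \<in> W - G"
      then have "b w * (real (m - 1) * l w) \<le> b w * D w" using b0 by (intro mult_left_mono) (auto simp: G_def)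
      then show "real (m - 1) * (b w * l w) \<le> b w * D w" by (simp add: mult.left_commute)
    qed
    have Dpg: "D pg \<le> real (m - 1) * l pg"
      using Dp lb by (simp add: ppp linear_add[OF linl] linear_add[OF linD] distrib_left)
    have lpg: "l pg = b v + (\<Sum>w\<in>G. b w * l w)" and Dpg': "D pg = (\<Sum>w\<in>G. b w * D w)"
      unfolding pg_def linear_lincomb[OF linl] linear_lincomb[OF linD] sumK by (simp_all add: lv)
    define h where "h = (\<Sum>y\<in>K. b y)"
    have h: "h = b v + (\<Sum>w\<in>G. b w)" by (simp add: h_def sumK)
    have bG: "0 \<le> b w" if "w \<in> G" for w using b0 GW that by blast
    have hl: "h - l pg = (\<Sum>w\<in>G. b w * (1 - l w))"
      by (simp add: h lpg sum_subtractf algebra_simps)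
    \<comment> \<open>Emptiness gives \<open>1 - l w \<le> D w\<close>, whence
      \<open>h - l pg \<le> D pg \<le> real (m - 1) * l pg\<close>. The resulting
      \<open>h \<le> real m * l pg\<close> is where the slice level \<open>m\<close> comes
      from.\<close>
    have "(\<Sum>w\<in>G. b w * (1 - l w)) \<le> D pg" unfolding Dpg'
      using W1 GW bG by (intro sum_mono mult_left_mono) (auto simp: algebra_simps)
    then have hm: "h \<le> real m * l pg" using Dpg hl m(2) by (simp add: of_nat_diff algebra_simps)
    have D0: "0 \<le> D pg" unfolding Dpg' using bG WD(1) GW by (intro sum_nonneg mult_nonneg_nonneg) auto
    have l0: "0 \<le> l pg"
    proof -
      have "0 \<le> real (m - 1) * l pg" using D0 Dpg by linarith
      then show ?thesis using m(2) by (simp add: zero_le_mult_iff)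
    qed
    have Gl: "l w < 1" if "w \<in> G" for w using Wl(2) GW that by blast
    \<comment> \<open>If \<open>h\<close> were not positive, every term
      \<open>b w * (1 - l w)\<close> would vanish, and the nonnegative \<open>l pg\<close> would
      equal the negative \<open>b v\<close>.\<close>
    have hpos: "0 < h"
    proof (rule ccontr)
      assume "\<not> 0 < h"
      then have "(\<Sum>w\<in>G. b w * (1 - l w)) \<le> 0" using hl l0 by linarith
      moreover have nn: "0 \<le> b w * (1 - l w)" if "w \<in> G" for w
        using bG[OF that] Gl[OF that] by simp
      then have "0 \<le> (\<Sum>w\<in>G. b w * (1 - l w))" by (rule sum_nonneg)
      ultimately have "(\<Sum>w\<in>G. b w * (1 - l w)) = 0" by (rule order_antisym)
      then have "b w * (1 - l w) = 0" if "w \<in> G" for w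
        using sum_nonneg_eq_0_iff[OF finG, of "\<lambda>w. b w * (1 - l w)"] nn that by simp
      then have "b w = 0" if "w \<in> G" for w using Gl[OF that] that by fastforce
      then have "l pg = b v" using lpg by simp
      then show False using l0 \<alpha> by simp
    qed
    \<comment> \<open>Scaling \<open>pg\<close> to coefficient sum \<open>m\<close> turns
      \<open>hm\<close> into \<open>1 \<le> l q\<close>; the drop of \<open>l\<close> along the
      slice simplex is at most 1.\<close>
    define c where "c = real m / h"
    have c0: "0 < c" using hpos m(2) by (simp add: c_def)
    define q where "q = c *\<^sub>R pg"
    have q: "q = (\<Sum>y\<in>K. (c * b y) *\<^sub>R y)" by (simp add: q_def pg_def scaleR_sum_right)
    have sumq: "(\<Sum>y\<in>K. c * b y) = real m"
    proof -
      have "(\<Sum>y\<in>K. c * b y) = c * h" by (simp add: h_def sum_distrib_left)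
      then show ?thesis using hpos by (simp add: c_def)
    qed
    have lq1: "1 \<le> l q"
    proof -
      have "l q = real m * l pg / h" by (simp add: q_def linear_scale[OF linl] c_def)
      then show ?thesis using hm hpos by (simp add: le_divide_eq)
    qed
    have Dq: "D q \<le> real (m - 1) * l q"
      using mult_left_mono[OF Dpg, of c] c0 by (simp add: q_def linear_scale[OF linl] linear_scale[OF linD] mult.left_commute)
    have Kl: "l y \<le> 1" "0 \<le> l y" if "y \<in> K" for y
      using that lv Wl[of y] GW by (auto simp: K_def less_imp_le)
    have m0: "0 < m" using m(2) by simp
    obtain Z where Z: "lattice_frame (Z \<union> (E - K)) L" "card Z \<le> card K" "finite Z" "q \<in> nonneg_span Z"
      "card (box_pts (Z \<union> (E - K)) L) \<le> m"
      "\<forall>x\<in>L. \<forall>j\<in>E - K. coord (Z \<union> (E - K)) j x \<in> \<int>"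
      "\<And>z. z \<in> Z \<Longrightarrow> \<exists>\<zeta>. z = (\<Sum>y\<in>K. \<zeta> y *\<^sub>R y) \<and> (\<Sum>y\<in>K. \<zeta> y) = real m
        \<and> (\<forall>y\<in>K - {v}. 0 \<le> \<zeta> y \<and> \<zeta> y \<le> c * b y + 2) \<and> l q - 1 \<le> l z"
    proof (rule slice_simplex[OF E KE _ linl _ _ m0 _ sumq q, of v])
      show "v \<in> K" by (simp add: K_def)
      show "l y \<le> l v" "l v - 1 \<le> l y" if "y \<in> K" for y using Kl[OF that] lv by auto
      show "0 \<le> c * b y" if "y \<in> K - {v}" for y using that bG c0 by (auto simp: K_def)
    qed blast
    \<comment> \<open>This is \<open>m + (m - 1) m + 2 (m - 1)^2\<close>: \<open>l z\<close> is at
      most \<open>m\<close>, \<open>D q\<close> is at most \<open>(m - 1) m\<close>, and rounding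
      raises at most \<open>m - 1\<close> coefficients by at most 2 each, with weights
      \<open>D y\<close> of at most \<open>m - 1\<close>.\<close>
    define B where "B = 3 * (real m)\<^sup>2 - 4 * real m + 2"
    have Zprop: "z \<in> nonneg_span V \<and> deg V z \<le> B" if z: "z \<in> Z" for z
    proof -
      obtain \<zeta> where \<zeta>: "z = (\<Sum>y\<in>K. \<zeta> y *\<^sub>R y)" "(\<Sum>y\<in>K. \<zeta> y) = real m"
        "\<forall>y\<in>K - {v}. 0 \<le> \<zeta> y \<and> \<zeta> y \<le> c * b y + 2" "l q - 1 \<le> l z" using Z(7)[OF z] by blast
      have \<zeta>G: "0 \<le> \<zeta> y" "\<zeta> y \<le> c * b y + 2" if "y \<in> G" for y using \<zeta>(3) that vG by (auto simp: K_def)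
      have zs: "z \<in> span V" unfolding \<zeta>(1)
        by (intro span_sum span_scale) (use KE e(2) f(3) in blast)
      have "0 \<le> coord V u z" if u: "u \<in> V" for u
      proof (cases "u = v")
        case True
        then show ?thesis using \<zeta>(4) lq1 by (simp add: l_def)
      next
        case False
        have "coord V u z = \<zeta> v * coord V u v + (\<Sum>y\<in>G. \<zeta> y * coord V u y)"
          unfolding \<zeta>(1) linear_lincomb[OF linear_coord[OF f(1)]] sumK ..
        also have "\<dots> = (\<Sum>y\<in>G. \<zeta> y * coord V u y)" using False by (simp add: coord_basis[OF f(1) v(1)])
        also have "\<dots> \<ge> 0" using \<zeta>G(1) Wcoord GW u by (intro sum_nonneg mult_nonneg_nonneg) auto
        finally show ?thesis .
      qed
      then have zc: "z \<in> nonneg_span V" using zs nonneg_span_coord[OF f(1)] by blast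
      \<comment> \<open>The coefficient of \<open>v\<close> may be negative. As
        \<open>l v = 1\<close> and \<open>l\<close> is at most 1 on the rest of \<open>K\<close>,
        the coefficient sum is still an upper bound.\<close>
      have lbound: "l (\<Sum>y\<in>K. x y *\<^sub>R y) \<le> real m" if "\<And>y. y \<in> G \<Longrightarrow> 0 \<le> x y" "(\<Sum>y\<in>K. x y) = real m" for x
      proof -
        have "l (\<Sum>y\<in>K. x y *\<^sub>R y) = x v + (\<Sum>y\<in>G. x y * l y)"
          unfolding linear_lincomb[OF linl] sumK by (simp add: lv)
        also have "\<dots> \<le> x v + (\<Sum>y\<in>G. x y * 1)"
          using that(1) Kl(1) by (intro add_left_mono sum_mono mult_left_mono) (auto simp: K_def)
        also have "\<dots> = real m" using that(2) by (simp add: sumK)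
        finally show ?thesis .
      qed
      have lz: "l z \<le> real m" unfolding \<zeta>(1) using \<zeta>G(1) \<zeta>(2) by (rule lbound)
      have lq: "l q \<le> real m" unfolding q using bG c0 sumq by (intro lbound) auto
      have "D z = (\<Sum>y\<in>G. \<zeta> y * D y)" unfolding \<zeta>(1) linear_lincomb[OF linD] sumK by (simp add: lv)
      also have "\<dots> \<le> (\<Sum>y\<in>G. (c * b y + 2) * D y)"
        using \<zeta>G(2) WD(1) GW by (intro sum_mono mult_right_mono) auto
      also have "\<dots> = D q + 2 * (\<Sum>y\<in>G. D y)"
        by (simp add: q linear_lincomb[OF linD] sumK lv sum.distrib sum_distrib_left distrib_right)
      also have "D q \<le> real (m - 1) * real m"
        using Dq mult_left_mono[OF lq, of "real (m - 1)"] by simp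
      also have "(\<Sum>y\<in>G. D y) \<le> (\<Sum>y\<in>G. real (m - 1))"
      proof (rule sum_mono)
        fix y assume y: "y \<in> G"
        then have "real (m - 1) * l y \<le> real (m - 1) * 1" using Kl(1) by (intro mult_left_mono) (auto simp: K_def)
        then show "D y \<le> real (m - 1)" using y by (simp add: G_def)
      qed
      also have "(\<Sum>y\<in>G. real (m - 1)) \<le> real (m - 1) * real (m - 1)"
        using card_mono[OF finW GW] W(3) m(1) by (simp add: mult_right_mono)
      finally have "D z \<le> real (m - 1) * real m + 2 * (real (m - 1) * real (m - 1))" by simp
      then have "deg V z \<le> real m + (real (m - 1) * real m + 2 * (real (m - 1) * real (m - 1)))"
        using degV[OF zs] lz by simp
      also have "\<dots> = B" using m(2) by (simp add: B_def of_nat_diff power2_eq_square algebra_simps)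
      finally show ?thesis using zc by blast
    qed
    have degree_bound: "degree_bound m = real m * B / 2 * (3/2) ^ (m - 2)" using m(2) by (simp add: degree_bound_def B_def)
    have B0: "0 \<le> B"
    proof -
      have "3 * 3 \<le> real m * real m" using m(2) by (intro mult_mono) auto
      have "0 \<le> real m * (3 * real m - 4)" using m(2) by (intro mult_nonneg_nonneg) auto
      then show ?thesis by (simp add: B_def power2_eq_square algebra_simps)
    qed
    have B_le: "B \<le> degree_bound m"
    proof -
      have "1 * 1 \<le> real m / 2 * (3/2) ^ (m - 2)" using m(2) by (intro mult_mono) auto
      then have "B * (1 * 1) \<le> B * (real m / 2 * (3/2) ^ (m - 2))" using B0 by (rule mult_left_mono)
      then show ?thesis by (simp add: degree_bound mult_ac)
    qed
    let ?Zf = "Z \<union> (E - K)"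
    have Zf: "?Zf - (E - K) \<subseteq> Z" by blast
    have "(\<Sum>z\<in>?Zf - (E - K). deg V z) \<le> (\<Sum>z\<in>?Zf - (E - K). B)" using Zprop by (intro sum_mono) auto
    also have "\<dots> \<le> real m * B"
    proof -
      have "card K \<le> m" using card_mono[OF e(5) KE] finW W(1,3) m by (simp add: E_def)
      then have "card (?Zf - (E - K)) \<le> m" using card_mono[OF Z(3) Zf] Z(2) by linarith
      then show ?thesis using B0 by (simp add: mult_right_mono)
    qed
    finally have S: "(\<Sum>z\<in>?Zf - (E - K). deg V z) \<le> real m * B" .
    have "(\<Sum>z\<in>?Zf - (E - K). deg V z) * (3/2) ^ card (box_pts ?Zf L) \<le> (real m * B) * (3/2) ^ m"
      using S Z(5) B0 by (intro mult_mono power_increasing) auto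
    \<comment> \<open>Two of the factors 3/2 make 9/4, half of the 9/2 in
      \<open>unimodular_refinement\<close>; this accounts for the exponent \<open>m - 2\<close> and
      the division by 2 in \<open>degree_bound\<close>.\<close>
    also have "(3/2::real) ^ m = (3/2) ^ 2 * (3/2) ^ (m - 2)"
    proof -
      have "m = 2 + (m - 2)" using m(2) by simp
      then show ?thesis using power_add[of "3/2::real" 2 "m - 2"] by simp
    qed
    also have "(real m * B) * ((3/2) ^ 2 * (3/2) ^ (m - 2)) = 9/2 * degree_bound m" by (simp add: degree_bound power2_eq_square)
    finally have S': "(\<Sum>z\<in>?Zf - (E - K). deg V z) * (3/2) ^ card (box_pts ?Zf L) \<le> 9/2 * degree_bound m" .
    have finZf: "finite ?Zf" using Z(3) e(5) by simp
    have "pg = (1 / c) *\<^sub>R q" using c0 by (simp add: q_def)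
    moreover have "q \<in> nonneg_span ?Zf" using nonneg_span_mono[OF finZf, of Z] Z(4) by blast
    ultimately have "pg \<in> nonneg_span ?Zf" using c0 by (simp add: nonneg_span_scale)
    moreover have "pb \<in> nonneg_span ?Zf" unfolding pb_def
      using b0 EK by (intro nonneg_span_sum nonneg_span_scale nonneg_span_base[OF finZf]) auto
    ultimately have pZf: "p \<in> nonneg_span ?Zf" using nonneg_span_add ppp by metis
    have ZV: "?Zf \<subseteq> nonneg_span V" using Zprop Econe by blast
    have bnd: "\<forall>z\<in>?Zf - (E - K). 0 \<le> deg V z \<and> deg V z \<le> degree_bound m"
      using Zprop B_le deg_nonneg[OF f(1)] by force
    \<comment> \<open>Freezing \<open>E - K\<close> protects the lifts outside \<open>G\<close>:
      their degrees, controlled through the induction hypothesis, stay out of the growth by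
      3/2.\<close>
    obtain Y where Y: "lattice_basis Y L" "E - K \<subseteq> Y" "Y \<subseteq> nonneg_span ?Zf" "p \<in> nonneg_span Y"
      "\<forall>y\<in>Y - (E - K). deg V y \<le> degree_bound m"
      using unimodular_refinement[OF linear_deg[OF f(1)] Z(1) _ Z(6) bnd S' pZf] by blast
    have "Y \<subseteq> nonneg_span V" using Y(3) nonneg_span_subset[OF ZV] by blast
    moreover have "\<forall>y\<in>Y. deg V y \<le> degree_bound m" using Y(5) Wdeg EK by blast
    ultimately show ?thesis using Y by blast
  qed
qed

text \<open>Starring at points of degree at most 1 costs nothing by \<open>deg_exchange\<close>,
  which reduces the claim to empty frames. A quotient of an empty frame need not be empty, so the
  induction runs over arbitrary frames and lattices.\<close>

lemma unimodular_cone_at: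
  fixes V :: "(real^'n) set"
  shows "lattice_frame V L \<Longrightarrow> p \<in> nonneg_span V \<Longrightarrow>
    \<exists>Y. lattice_basis Y L \<and> Y \<subseteq> nonneg_span V \<and> p \<in> nonneg_span Y \<and> (\<forall>y\<in>Y. deg V y \<le> degree_bound (card V))"
proof (induction "card V" arbitrary: V L p rule: less_induct)
  case less
  note f = lattice_frameD[OF less.prems(1)]
  obtain U where U: "empty_frame U L" "U \<subseteq> nonneg_span V" "card U = card V" "p \<in> nonneg_span U" "\<forall>u\<in>U. deg V u \<le> 1"
    using empty_refinement[OF less.prems] by blast
  have FU: "lattice_frame U L" using U(1) by (simp add: empty_frame_def)
  have "\<exists>Y. lattice_basis Y L \<and> Y \<subseteq> nonneg_span U \<and> p \<in> nonneg_span Y \<and> (\<forall>y\<in>Y. deg U y \<le> degree_bound (card U))"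
  proof (cases "card U \<le> 2")
    case True
    then show ?thesis
      using empty_frame_basis[OF U(1) True] U(4) nonneg_span_base[OF lattice_frameD(6)[OF FU]]
        deg_basis[OF lattice_frameD(1)[OF FU]]
      by (intro exI[of _ U]) (auto simp: degree_bound_def)
  next
    case False
    then have c3: "3 \<le> card U" by simp
    show ?thesis
    proof (rule corner_step[OF U(1) refl c3 U(4)])
      fix V0 :: "(real^'n) set" and L0 p0
      assume a: "lattice_frame V0 L0" "card V0 = card U - 1" "p0 \<in> nonneg_span V0"
      show "\<exists>Y. lattice_basis Y L0 \<and> Y \<subseteq> nonneg_span V0 \<and> p0 \<in> nonneg_span Y \<and> (\<forall>y\<in>Y. deg V0 y \<le> degree_bound (card U - 1))"
        using less.hyps[OF _ a(1,3)] a(2) U(3) c3 by simp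
    qed
  qed
  then obtain Y where Y: "lattice_basis Y L" "Y \<subseteq> nonneg_span U" "p \<in> nonneg_span Y" "\<forall>y\<in>Y. deg U y \<le> degree_bound (card U)"
    by blast
  have "deg V y \<le> degree_bound (card V)" if "y \<in> Y" for y
  proof -
    have "deg V y \<le> deg U y"
      using deg_exchange[OF f(1) lattice_frameD(1)[OF FU] U(2)] U(5) Y(2) that by blast
    then show ?thesis using Y(4) that U(3) by force
  qed
  moreover have "Y \<subseteq> nonneg_span V" using Y(2) nonneg_span_subset[OF U(2)] by blast
  ultimately show ?case using Y by blast
qed

section \<open>The integer lattice and unimodular cones\<close>

lemma zsubgroup_lattice_pts: "zsubgroup lattice_pts"
  by (auto simp: zsubgroup_def lattice_pts_def)

lemma finite_lattice_bounded:
  assumes "bounded (B :: (real^'n) set)"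
  shows "finite (lattice_pts \<inter> B)"
proof -
  obtain r where r: "\<And>x. x \<in> B \<Longrightarrow> norm x \<le> r" using assms by (auto simp: bounded_iff)
  define k where "k = \<lceil>r\<rceil>"
  have "lattice_pts \<inter> B \<subseteq> (\<lambda>f. \<chi> i. real_of_int (f i)) ` (UNIV \<rightarrow>\<^sub>E {- k..k})"
  proof
    fix x assume x: "x \<in> lattice_pts \<inter> B"
    have key: "\<lfloor>x $ i\<rfloor> \<in> {- k..k} \<and> real_of_int \<lfloor>x $ i\<rfloor> = x $ i" for i
    proof -
      have "x $ i \<in> \<int>" using x by (simp add: lattice_pts_def)
      then have e: "real_of_int \<lfloor>x $ i\<rfloor> = x $ i" by (rule of_int_floor)
      have "\<bar>x $ i\<bar> \<le> r" using component_le_norm_cart[of x i] r x by force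
      then have "real_of_int \<lfloor>x $ i\<rfloor> \<le> r" "- r \<le> real_of_int \<lfloor>x $ i\<rfloor>" using e by linarith+
      then show ?thesis using e unfolding k_def by (simp add: le_ceiling_iff) linarith
    qed
    show "x \<in> (\<lambda>f. \<chi> i. real_of_int (f i)) ` (UNIV \<rightarrow>\<^sub>E {- k..k})"
    proof (rule image_eqI)
      show "x = (\<chi> i. real_of_int \<lfloor>x $ i\<rfloor>)"
        by (rule iffD2[OF vec_eq_iff]) (simp only: vec_lambda_beta key[THEN conjunct2] simp_thms)
      show "(\<lambda>i. \<lfloor>x $ i\<rfloor>) \<in> UNIV \<rightarrow>\<^sub>E {- k..k}"
        unfolding PiE_UNIV_domain using key by blast
    qed
  qed
  moreover have "finite (UNIV \<rightarrow>\<^sub>E {- k..k} :: ('n \<Rightarrow> int) set)" by (intro finite_PiE) auto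
  ultimately show ?thesis by (meson finite_imageI finite_subset)
qed

lemma bounded_coord:
  assumes V: "independent V"
  shows "bounded {x\<in>span V. \<forall>v\<in>V. 0 \<le> coord V v x \<and> coord V v x \<le> c}"
proof -
  have "norm x \<le> (\<Sum>v\<in>V. c * norm v)" if "x \<in> span V" "\<forall>v\<in>V. 0 \<le> coord V v x \<and> coord V v x \<le> c" for x
  proof -
    have "norm x = norm (\<Sum>v\<in>V. coord V v x *\<^sub>R v)" using span_lincomb[OF V that(1)] by simp
    also have "\<dots> \<le> (\<Sum>v\<in>V. norm (coord V v x *\<^sub>R v))" by (rule norm_sum)
    also have "\<dots> \<le> (\<Sum>v\<in>V. c * norm v)" using that(2) by (intro sum_mono) (auto intro!: mult_right_mono)
    finally show ?thesis .
  qed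
  then show ?thesis by (auto simp: bounded_iff)
qed

lemma lattice_frame_lattice_pts:
  assumes V: "independent V" "V \<subseteq> lattice_pts"
  shows "lattice_frame V (lattice_pts \<inter> span V)"
proof -
  have "box_pts V (lattice_pts \<inter> span V) \<subseteq> lattice_pts \<inter> {x\<in>span V. \<forall>v\<in>V. 0 \<le> coord V v x \<and> coord V v x \<le> 1}"
    by (auto simp: box_pts_def less_imp_le)
  then have "finite (box_pts V (lattice_pts \<inter> span V))"
    using finite_lattice_bounded[OF bounded_coord[OF V(1)]] finite_subset by blast
  moreover have "zsubgroup (lattice_pts \<inter> span V)"
    using zsubgroup_lattice_pts by (auto simp: zsubgroup_def span_zero span_diff)
  ultimately show ?thesis using V by (auto simp: lattice_frame_def intro: span_base)
qed

section \<open>Multiplicity of lattice simplices\<close>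

lemma int_span_finite:
  assumes "finite V"
  shows "int_span V = {\<Sum>v\<in>V. real_of_int (k v) *\<^sub>R v | k. True}"
proof
  show "int_span V \<subseteq> {\<Sum>v\<in>V. real_of_int (k v) *\<^sub>R v | k. True}"
  proof
    fix x assume "x \<in> int_span V"
    then obtain F k where F: "F \<subseteq> V" "x = (\<Sum>v\<in>F. real_of_int (k v) *\<^sub>R v)" by (auto simp: int_span_def)
    have "x = (\<Sum>v\<in>V. real_of_int (if v \<in> F then k v else 0) *\<^sub>R v)"
      unfolding F(2) by (rule sum.mono_neutral_cong_left[OF assms F(1)]) auto
    then show "x \<in> {\<Sum>v\<in>V. real_of_int (k v) *\<^sub>R v | k. True}"
      unfolding mem_Collect_eq by (intro exI[of _ "\<lambda>v. if v \<in> F then k v else 0"] conjI TrueI)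
  qed
qed (use assms in \<open>auto simp: int_span_def\<close>)

lemma int_span_base:
  assumes "v \<in> V"
  shows "v \<in> int_span V"
  unfolding int_span_def using assms by (auto intro!: exI[of _ "{v}"] exI[of _ "\<lambda>_. 1"])

lemma zsubgroup_int_span:
  assumes "finite V"
  shows "zsubgroup (int_span V)"
  unfolding zsubgroup_def
proof (intro conjI ballI)
  show "0 \<in> int_span V" by (auto simp: int_span_finite[OF assms] intro!: exI[of _ "\<lambda>_. 0"])
  fix x y assume "x \<in> int_span V" "y \<in> int_span V"
  then obtain j k where "x = (\<Sum>v\<in>V. real_of_int (j v) *\<^sub>R v)" "y = (\<Sum>v\<in>V. real_of_int (k v) *\<^sub>R v)"
    by (auto simp: int_span_finite[OF assms])
  then show "x - y \<in> int_span V"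
    by (auto simp: int_span_finite[OF assms] scaleR_diff_left sum_subtractf intro!: exI[of _ "\<lambda>v. j v - k v"])
qed

lemma int_span_subset: "zsubgroup L \<Longrightarrow> V \<subseteq> L \<Longrightarrow> int_span V \<subseteq> L"
  unfolding int_span_def by (auto intro!: zsubgroup_int_lincomb)

lemma int_span_lattice_basis:
  assumes "lattice_basis Y L"
  shows "int_span Y = L"
proof
  note b = lattice_basisD[OF assms]
  show "int_span Y \<subseteq> L" by (rule int_span_subset[OF b(4,2)])
  have S: "zsubgroup (int_span Y)" by (rule zsubgroup_int_span[OF b(5)])
  show "L \<subseteq> int_span Y"
  proof
    fix x assume x: "x \<in> L"
    have "(\<Sum>v\<in>Y. coord Y v x *\<^sub>R v) \<in> int_span Y"
      using b(6)[OF x] int_span_base by (intro zsubgroup_int_lincomb[OF S]) auto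
    moreover have "x \<in> span Y" using x b(3) by blast
    ultimately show "x \<in> int_span Y" using span_lincomb[OF b(1)] by metis
  qed
qed

lemma smallest_summand_lattice_pts: "smallest_summand lattice_pts = lattice_pts"
proof -
  have sub: "lattice_subgroup lattice_pts" "lattice_subgroup {0}"
    by (auto simp: lattice_subgroup_def lattice_pts_def)
  have ds: "direct_summand lattice_pts"
    unfolding direct_summand_def using sub by (auto simp: lattice_pts_def intro!: exI[of _ "{0}"])
  show ?thesis unfolding smallest_summand_def
  proof (rule the_equality)
    show "direct_summand lattice_pts \<and> lattice_pts \<subseteq> lattice_pts \<and>
      (\<forall>S'. direct_summand S' \<and> lattice_pts \<subseteq> S' \<longrightarrow> lattice_pts \<subseteq> S')" using ds by blast
  qed (auto simp: direct_summand_def lattice_subgroup_def)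
qed

lemma simplex_mult_eq_1:
  fixes v0 :: "real^'n"
  assumes "int_span ((\<lambda>v. v - v0) ` V) = lattice_pts"
  shows "simplex_mult v0 V = 1"
proof -
  have "(+) x ` lattice_pts = lattice_pts" if x: "x \<in> lattice_pts" for x :: "real^'n"
  proof
    show "(+) x ` lattice_pts \<subseteq> lattice_pts" using zsubgroup_add[OF zsubgroup_lattice_pts x] by auto
    show "lattice_pts \<subseteq> (+) x ` lattice_pts"
    proof
      fix y :: "real^'n" assume y: "y \<in> lattice_pts"
      then show "y \<in> (+) x ` lattice_pts"
        using zsubgroup_diff[OF zsubgroup_lattice_pts y x] by (intro image_eqI[of _ _ "y - x"]) auto
    qed
  qed
  then have "(\<lambda>x. (+) x ` lattice_pts) ` lattice_pts = {lattice_pts :: (real^'n) set}"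
    using zsubgroup_zero[OF zsubgroup_lattice_pts] by (auto simp: image_iff)
  then show ?thesis by (simp add: simplex_mult_def assms smallest_summand_lattice_pts)
qed

text \<open>From any base vertex \<open>v0\<close> the differences generate \<open>0 - v0\<close>,
  and subtracting this from \<open>v - v0\<close> recovers each basis vector
  \<open>v\<close>.\<close>

lemma unimodular_simplex_basis:
  assumes "lattice_basis Y (lattice_pts :: (real^'n) set)"
  shows "unimodular_simplex (insert 0 Y)"
proof -
  note b = lattice_basisD[OF assms]
  have z: "0 \<notin> Y" using b(1) dependent_zero by blast
  have mult: "simplex_mult v0 (insert 0 Y - {v0}) = 1" if v0: "v0 \<in> insert 0 Y" for v0
  proof (rule simplex_mult_eq_1)
    let ?D = "(\<lambda>v. v - v0) ` (insert 0 Y - {v0})"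
    have fin: "finite ?D" using b(5) by simp
    note S = zsubgroup_int_span[OF fin]
    have v0L: "v0 \<in> lattice_pts" using v0 b(2) zsubgroup_zero[OF zsubgroup_lattice_pts] by auto
    have "?D \<subseteq> lattice_pts"
      using b(2) v0L zsubgroup_diff[OF zsubgroup_lattice_pts] zsubgroup_zero[OF zsubgroup_lattice_pts] by auto
    then have le: "int_span ?D \<subseteq> lattice_pts" by (rule int_span_subset[OF zsubgroup_lattice_pts])
    have d: "v - v0 \<in> int_span ?D" if "v \<in> insert 0 Y" for v
    proof (cases "v = v0")
      case True
      then show ?thesis using zsubgroup_zero[OF S] by simp
    next
      case False
      then show ?thesis using that by (intro int_span_base) auto
    qed
    have "v \<in> int_span ?D" if "v \<in> Y" for v
      using zsubgroup_diff[OF S d[of v] d[of 0]] that by simp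
    then have "int_span Y \<subseteq> int_span ?D" by (intro int_span_subset[OF S]) blast
    then show "int_span ?D = lattice_pts" using le int_span_lattice_basis[OF assms] by blast
  qed
  have "\<not> affine_dependent (insert 0 Y)"
    using affine_dependent_iff_dependent[OF z] b(1) by simp
  then show ?thesis unfolding unimodular_simplex_def
    using b(2,5) mult zsubgroup_zero[OF zsubgroup_lattice_pts] by auto
qed

text \<open>If a point \<open>t *\<^sub>R s\<close> of the ray lies between \<open>a\<close> and
  \<open>b\<close>, compare coefficients: irredundancy of \<open>s\<close> prevents the coefficient
  of \<open>s\<close> from falling below \<open>t\<close>, and then pointedness makes the
  contribution of every other generator vanish, in \<open>a\<close> and \<open>b\<close>
  alike.\<close>

lemma cone_face_ray:
  assumes S: "finite S" and pointed: "nonneg_span S \<inter> uminus ` nonneg_span S = {0}"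
    and s: "s \<in> S" "s \<notin> nonneg_span (S - {s})"
  defines "l \<equiv> {t *\<^sub>R s | t. 0 \<le> t}"
  shows "l face_of nonneg_span S" "aff_dim l = 1"
proof -
  have s0: "s \<noteq> 0" using s(2) nonneg_span_zero by blast
  have lC: "l \<subseteq> nonneg_span S" unfolding l_def using nonneg_span_scale[OF nonneg_span_base[OF S s(1)]] by auto
  have cvx: "convex l"
    unfolding convex_def l_def
  proof safe
    fix t t' u w :: real assume "0 \<le> t" "0 \<le> t'" "0 \<le> u" "0 \<le> w" "u + w = 1"
    then show "\<exists>r. u *\<^sub>R t *\<^sub>R s + w *\<^sub>R t' *\<^sub>R s = r *\<^sub>R s \<and> 0 \<le> r"
      by (intro exI[of _ "u * t + w * t'"]) (simp add: scaleR_add_left)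
  qed
  have extreme: "a \<in> l \<and> b \<in> l"
    if a: "a \<in> nonneg_span S" and b: "b \<in> nonneg_span S" and x: "x \<in> l" "x \<in> open_segment a b" for a b x
  proof -
    obtain \<alpha> where \<alpha>: "\<And>v. v \<in> S \<Longrightarrow> 0 \<le> \<alpha> v" "a = (\<Sum>v\<in>S. \<alpha> v *\<^sub>R v)" using a by (auto simp: nonneg_span_def)
    obtain \<beta> where \<beta>: "\<And>v. v \<in> S \<Longrightarrow> 0 \<le> \<beta> v" "b = (\<Sum>v\<in>S. \<beta> v *\<^sub>R v)" using b by (auto simp: nonneg_span_def)
    obtain u where u: "0 < u" "u < 1" "x = (1 - u) *\<^sub>R a + u *\<^sub>R b" using x(2) by (auto simp: in_segment)
    obtain t where t: "0 \<le> t" "x = t *\<^sub>R s" using x(1) by (auto simp: l_def)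
    define c where "c v = (1 - u) * \<alpha> v + u * \<beta> v" for v
    have c0: "0 \<le> c v" if "v \<in> S" for v using \<alpha>(1)[OF that] \<beta>(1)[OF that] u by (simp add: c_def)
    have "x = (\<Sum>v\<in>S. c v *\<^sub>R v)"
      by (simp add: u(3) \<alpha>(2) \<beta>(2) c_def scaleR_sum_right scaleR_add_left sum.distrib)
    also have "\<dots> = c s *\<^sub>R s + (\<Sum>v\<in>S - {s}. c v *\<^sub>R v)" by (rule sum.remove[OF S s(1)])
    finally have eq: "(\<Sum>v\<in>S - {s}. c v *\<^sub>R v) = (t - c s) *\<^sub>R s"
      by (simp add: t(2) scaleR_diff_left algebra_simps)
    have rest: "(\<Sum>v\<in>S - {s}. c v *\<^sub>R v) \<in> nonneg_span (S - {s})"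
      using c0 S by (intro nonneg_span_sum nonneg_span_scale nonneg_span_base) auto
    have "t \<le> c s"
    proof (rule ccontr)
      assume "\<not> t \<le> c s"
      then have "s = (1 / (t - c s)) *\<^sub>R (\<Sum>v\<in>S - {s}. c v *\<^sub>R v)" unfolding eq by simp
      then show False using nonneg_span_scale[OF rest, of "1 / (t - c s)"] s(2) \<open>\<not> t \<le> c s\<close> by simp
    qed
    have term0: "c v *\<^sub>R v = 0" if v: "v \<in> S - {s}" for v
    proof -
      have "(\<Sum>w\<in>S - {s}. c w *\<^sub>R w) = c v *\<^sub>R v + (\<Sum>w\<in>S - {s} - {v}. c w *\<^sub>R w)"
        using S v by (intro sum.remove) auto
      then have "- (c v *\<^sub>R v) = (\<Sum>w\<in>S - {s} - {v}. c w *\<^sub>R w) + (c s - t) *\<^sub>R s"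
        using eq by (simp add: scaleR_diff_left algebra_simps)
      moreover have "\<dots> \<in> nonneg_span S"
        using c0 S s(1) \<open>t \<le> c s\<close>
        by (intro nonneg_span_add nonneg_span_sum nonneg_span_scale nonneg_span_base) auto
      ultimately have "- (c v *\<^sub>R v) \<in> nonneg_span S" by simp
      then have "c v *\<^sub>R v \<in> uminus ` nonneg_span S" by (metis image_eqI minus_minus)
      moreover have "c v *\<^sub>R v \<in> nonneg_span S"
        using c0 S v by (intro nonneg_span_scale nonneg_span_base) auto
      ultimately show ?thesis using pointed by blast
    qed
    have ab0: "\<alpha> v *\<^sub>R v = 0 \<and> \<beta> v *\<^sub>R v = 0" if v: "v \<in> S - {s}" for v
    proof (cases "v = 0")
      case False
      then have "(1 - u) * \<alpha> v + u * \<beta> v = 0" using term0[OF v] by (simp add: c_def)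
      moreover have "0 \<le> (1 - u) * \<alpha> v" "0 \<le> u * \<beta> v" using \<alpha>(1) \<beta>(1) v u by auto
      ultimately have "(1 - u) * \<alpha> v = 0" "u * \<beta> v = 0" by linarith+
      then show ?thesis using u by simp
    qed simp
    have "(\<Sum>v\<in>S - {s}. \<alpha> v *\<^sub>R v) = 0" "(\<Sum>v\<in>S - {s}. \<beta> v *\<^sub>R v) = 0"
      by (rule sum.neutral, use ab0 in blast)+
    then have "a = \<alpha> s *\<^sub>R s" "b = \<beta> s *\<^sub>R s"
      unfolding \<alpha>(2) \<beta>(2) by (simp_all add: sum.remove[OF S s(1)])
    then show ?thesis using \<alpha>(1)[OF s(1)] \<beta>(1)[OF s(1)] by (auto simp: l_def)
  qed
  show "l face_of nonneg_span S" unfolding face_of_def using lC cvx extreme by blast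
  have "0 \<in> l" by (auto simp: l_def intro!: exI[of _ 0])
  then have "aff_dim l = int (dim l)" by (intro aff_dim_zero hull_inc)
  moreover have "span l = span {s}"
  proof -
    have "s \<in> l" by (auto simp: l_def intro!: exI[of _ 1])
    then have "{s} \<subseteq> span l" by (simp add: span_base)
    moreover have "l \<subseteq> span {s}" by (auto simp: l_def span_scale span_base)
    ultimately show ?thesis by (simp add: span_eq)
  qed
  then have "dim l = dim {s}" by (metis dim_span)
  moreover have "dim {s} = 1" using s0 by simp
  ultimately show "aff_dim l = 1" by simp
qed

lemma basis_cone:
  assumes "lattice_basis Y (lattice_pts :: (real^'n) set)"
  shows basis_cone_rational: "rational_cone (nonneg_span Y)"
    and basis_cone_extreme_gens: "extreme_gens (nonneg_span Y) = Y"
    and basis_cone_unimodular: "unimodular_cone (nonneg_span Y)"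
    and basis_cone_Hilb: "Hilb (nonneg_span Y) = Y"
proof -
  note b = lattice_basisD[OF assms]
  let ?C = "nonneg_span Y"
  have cone: "x \<in> ?C \<longleftrightarrow> x \<in> span Y \<and> (\<forall>y\<in>Y. 0 \<le> coord Y y x)" for x
    by (rule nonneg_span_coord[OF b(1)])
  have cb: "coord Y u v = (if v = u then 1 else 0)" if "v \<in> Y" for u v using coord_basis[OF b(1) that] .
  have pointed: "?C \<inter> uminus ` ?C = {0}"
  proof -
    have "x = 0" if x: "x \<in> ?C" "- x \<in> ?C" for x
    proof (rule coord_eqI[OF b(1) _ span_0])
      show "x \<in> span Y" using x cone by blast
      fix y assume "y \<in> Y"
      then show "coord Y y x = coord Y y 0"
        using x cone by (force simp: linear_neg[OF linear_coord[OF b(1)]] linear_0[OF linear_coord[OF b(1)]])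
    qed
    then show ?thesis using nonneg_span_zero[of Y] by (auto simp: image_iff)
  qed
  have "rational_vec v" if "v \<in> Y" for v
    using b(2) that Ints_subset_Rats by (auto simp: rational_vec_def lattice_pts_def)
  then show rat: "rational_cone ?C" unfolding rational_cone_def using pointed b(5) by blast
  have ynot: "y \<notin> nonneg_span (Y - {y})" if "y \<in> Y" for y
  proof
    assume "y \<in> nonneg_span (Y - {y})"
    then have "y \<in> span (Y - {y})" using nonneg_span_span by blast
    then show False using b(1) that by (auto simp: dependent_def)
  qed
  show eg: "extreme_gens ?C = Y"
  proof
    show "Y \<subseteq> extreme_gens ?C"
    proof
      fix y assume y: "y \<in> Y"
      define l where "l = {t *\<^sub>R y | t. 0 \<le> t}"
      note face = cone_face_ray[OF b(5) pointed y ynot[OF y], folded l_def]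
      have "l \<inter> lattice_pts = {real k *\<^sub>R y | k. True}"
      proof
        show "l \<inter> lattice_pts \<subseteq> {real k *\<^sub>R y | k. True}"
        proof
          fix x assume x: "x \<in> l \<inter> lattice_pts"
          then obtain t where t: "0 \<le> t" "x = t *\<^sub>R y" by (auto simp: l_def)
          have "coord Y y x = t" by (simp add: t(2) linear_scale[OF linear_coord[OF b(1)]] cb[OF y])
          then have "t \<in> \<int>" using b(6) x y by auto
          then obtain k where "t = real k" using t(1) by (metis Ints_cases nonneg_int_cases of_int_0_le_iff of_int_of_nat_eq)
          then show "x \<in> {real k *\<^sub>R y | k. True}" using t(2) by blast
        qed
        have "real k *\<^sub>R y \<in> lattice_pts" for k
          using b(2) y by (intro zsubgroup_int_scale[OF zsubgroup_lattice_pts]) auto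
        then show "{real k *\<^sub>R y | k. True} \<subseteq> l \<inter> lattice_pts" by (auto simp: l_def)
      qed
      moreover have "y \<in> l \<inter> lattice_pts" using y b(2) by (auto simp: l_def intro!: exI[of _ 1])
      moreover have "y \<noteq> 0" using y b(1) dependent_zero by blast
      ultimately show "y \<in> extreme_gens ?C" unfolding extreme_gens_def using face by blast
    qed
    show "extreme_gens ?C \<subseteq> Y"
    proof
      fix v assume "v \<in> extreme_gens ?C"
      then obtain l where l: "l face_of ?C" "v \<in> l" "v \<in> lattice_pts" "v \<noteq> 0"
        "l \<inter> lattice_pts = {real k *\<^sub>R v | k. True}" unfolding extreme_gens_def by blast
      have lf: "\<And>a b x. a \<in> ?C \<Longrightarrow> b \<in> ?C \<Longrightarrow> x \<in> l \<Longrightarrow> x \<in> open_segment a b \<Longrightarrow> a \<in> l \<and> b \<in> l" "convex l" "l \<subseteq> ?C"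
        using l(1) by (auto simp: face_of_def)
      have "0 \<in> {real k *\<^sub>R v | k. True}" by (auto intro!: exI[of _ 0])
      then have zl: "0 \<in> l" using l(5) by blast
      have vC: "v \<in> span Y" "\<And>y. y \<in> Y \<Longrightarrow> 0 \<le> coord Y y v" using l(2) lf(3) cone by auto
      obtain y where y: "y \<in> Y" "coord Y y v \<noteq> 0"
        using coord_eqI[OF b(1) vC(1) span_0] l(4) linear_0[OF linear_coord[OF b(1)]] by metis
      define a where "a = coord Y y v"
      have a0: "0 < a" using y vC(2)[OF y(1)] by (simp add: a_def)
      have yC: "t *\<^sub>R y \<in> ?C" if "0 \<le> t" for t by (rule nonneg_span_scale[OF nonneg_span_base[OF b(5) y(1)] that])
      \<comment> \<open>\<open>v\<close> is the midpoint of \<open>(2 * a) *\<^sub>R y\<close> and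
        \<open>2 *\<^sub>R (v - a *\<^sub>R y)\<close>, so the face containing \<open>v\<close> also
        contains \<open>y\<close>. Both then lie on one edge, and integrality forces
        \<open>y = v\<close>.\<close>
      have "v - a *\<^sub>R y \<in> ?C"
        using vC y(1) span_base[OF y(1)]
        by (auto simp: cone span_diff span_scale linear_diff[OF linear_coord[OF b(1)]] linear_scale[OF linear_coord[OF b(1)]] cb a_def)
      then have pC: "2 *\<^sub>R (v - a *\<^sub>R y) \<in> ?C" by (rule nonneg_span_scale) simp
      have "coord Y y (2 *\<^sub>R (v - a *\<^sub>R y)) = 0" "coord Y y ((2 * a) *\<^sub>R y) = 2 * a"
        using y(1) by (auto simp: linear_diff[OF linear_coord[OF b(1)]] linear_scale[OF linear_coord[OF b(1)]] cb a_def)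
      then have ne: "(2 * a) *\<^sub>R y \<noteq> 2 *\<^sub>R (v - a *\<^sub>R y)" using a0 by auto
      have "v = (1 - 1/2) *\<^sub>R ((2 * a) *\<^sub>R y) + (1/2) *\<^sub>R (2 *\<^sub>R (v - a *\<^sub>R y))"
        by (simp add: algebra_simps)
      then have "v \<in> open_segment ((2 * a) *\<^sub>R y) (2 *\<^sub>R (v - a *\<^sub>R y))"
        unfolding in_segment using ne by (intro conjI exI[of _ "1/2"]) auto
      then have tl: "(2 * a) *\<^sub>R y \<in> l" using lf(1)[OF yC pC l(2)] a0 by simp
      have y0: "y \<noteq> 0" using y(1) b(1) dependent_zero by blast
      have "y \<in> l"
      proof (cases "1 \<le> 2 * a")
        case True
        have "(1 - 1 / (2 * a)) *\<^sub>R 0 + (1 / (2 * a)) *\<^sub>R ((2 * a) *\<^sub>R y) \<in> l"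
          using True a0 by (intro convexD[OF lf(2) zl tl]) auto
        then show ?thesis using a0 by simp
      next
        case False
        have "(2 * a) *\<^sub>R y \<in> open_segment 0 y"
          unfolding in_segment using False a0 y0 by (intro conjI exI[of _ "2 * a"]) auto
        then show ?thesis using lf(1)[OF nonneg_span_zero _ tl] yC[of 1] by simp
      qed
      then have "y \<in> {real k *\<^sub>R v | k. True}" using l(5) b(2) y(1) by blast
      then obtain k where k: "y = real k *\<^sub>R v" by blast
      have "1 = coord Y y y" using cb[OF y(1)] by simp
      also have "\<dots> = real k * a" by (subst k) (simp add: linear_scale[OF linear_coord[OF b(1)]] a_def)
      finally have ka: "real k * a = 1" by simp
      have "a \<in> \<int>" using b(6)[OF l(3) y(1)] by (simp add: a_def)
      then obtain i where i: "a = real_of_int i" by (auto elim: Ints_cases)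
      have "1 \<le> a" using i a0 by simp
      moreover have "1 \<le> real k" using ka by (cases k) auto
      ultimately have "real k = 1" using ka mult_mono[of 1 a "real k" "real k"] by (simp add: mult.commute)
      then show "v \<in> Y" using k y(1) by simp
    qed
  qed
  show "unimodular_cone ?C" unfolding unimodular_cone_def
    using rat eg unimodular_simplex_basis[OF assms] b(1) by (auto simp: simplicial_def)
  have gen: "gen_set_of ?C Y"
  proof -
    have "monoid_gen Y = ?C \<inter> lattice_pts"
    proof
      show "monoid_gen Y \<subseteq> ?C \<inter> lattice_pts"
      proof
        fix x assume "x \<in> monoid_gen Y"
        then obtain F k where F: "F \<subseteq> Y" "x = (\<Sum>v\<in>F. real (k v) *\<^sub>R v)" by (auto simp: monoid_gen_def)
        have "x \<in> ?C" unfolding F(2) using F(1)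
          by (intro nonneg_span_sum nonneg_span_scale nonneg_span_base[OF b(5)]) auto
        moreover have "x \<in> lattice_pts" unfolding F(2) using F(1) b(2)
          by (intro zsubgroup_int_lincomb[OF zsubgroup_lattice_pts]) auto
        ultimately show "x \<in> ?C \<inter> lattice_pts" by blast
      qed
      show "?C \<inter> lattice_pts \<subseteq> monoid_gen Y"
      proof
        fix x assume x: "x \<in> ?C \<inter> lattice_pts"
        have "real (nat \<lfloor>coord Y y x\<rfloor>) = coord Y y x" if "y \<in> Y" for y
          using b(6)[of x y] x that cone by (auto elim!: Ints_cases)
        then have "(\<Sum>v\<in>Y. real (nat \<lfloor>coord Y v x\<rfloor>) *\<^sub>R v) = (\<Sum>v\<in>Y. coord Y v x *\<^sub>R v)"
          by (intro sum.cong) auto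
        also have "\<dots> = x" by (rule span_lincomb[symmetric, OF b(1)]) (use x cone in blast)
        finally have "x = (\<Sum>v\<in>Y. real (nat \<lfloor>coord Y v x\<rfloor>) *\<^sub>R v)" ..
        then show "x \<in> monoid_gen Y" unfolding monoid_gen_def mem_Collect_eq
          by (intro exI[of _ Y] exI[of _ "\<lambda>v. nat \<lfloor>coord Y v x\<rfloor>"] conjI b(5) subset_refl)
      qed
    qed
    then show ?thesis unfolding gen_set_of_def
      using b(2,5) nonneg_span_base[OF b(5)] by blast
  qed
  \<comment> \<open>A basis vector is irreducible: the lattice points of the cone have nonnegative
    integral coordinates, so some summand in any decomposition of \<open>y\<close> has the
    coordinates of \<open>y\<close> itself. Thus \<open>Y\<close> lies in every generating set,
    which gives minimality and uniqueness at once.\<close>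
  have least: "Y \<subseteq> H" if H: "gen_set_of ?C H" for H
  proof
    fix y assume y: "y \<in> Y"
    have "y \<in> monoid_gen H" using H y b(2) nonneg_span_base[OF b(5)] by (auto simp: gen_set_of_def)
    then obtain F k where F: "finite F" "F \<subseteq> H" "y = (\<Sum>v\<in>F. real (k v) *\<^sub>R v)" by (auto simp: monoid_gen_def)
    have FC: "v \<in> ?C" "v \<in> lattice_pts" if "v \<in> F" for v using that F(2) H by (auto simp: gen_set_of_def)
    have nn: "0 \<le> real (k v) * coord Y u v" if "v \<in> F" "u \<in> Y" for u v using FC(1)[OF that(1)] cone that by auto
    have sum: "(\<Sum>v\<in>F. real (k v) * coord Y u v) = (if y = u then 1 else 0)" for u
    proof -
      have "coord Y u y = (\<Sum>v\<in>F. real (k v) * coord Y u v)"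
        by (subst F(3)) (rule linear_lincomb[OF linear_coord[OF b(1)]])
      then show ?thesis using cb[OF y, of u] by simp
    qed
    obtain v where v: "v \<in> F" "real (k v) * coord Y y v \<noteq> 0"
      using sum[of y] by (metis (no_types, lifting) sum.neutral zero_neq_one)
    have "coord Y u v = coord Y u y" if u: "u \<in> Y" for u
    proof (cases "u = y")
      case True
      have le: "real (k v) * coord Y y v \<le> 1"
        using member_le_sum[of v F "\<lambda>v. real (k v) * coord Y y v"] nn y sum[of y] v(1) F(1) by auto
      obtain i where i: "coord Y y v = real_of_int i" using b(6)[OF FC(2)[OF v(1)] y] by (auto elim: Ints_cases)
      have "0 \<le> coord Y y v" using FC(1)[OF v(1)] cone y by auto
      then have "1 \<le> coord Y y v" using i v(2) by auto
      moreover have "1 \<le> real (k v)" using v(2) by (cases "k v") auto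
      ultimately have "coord Y y v = 1"
        using le mult_right_mono[of 1 "real (k v)" "coord Y y v"] by linarith
      then show ?thesis using True cb[OF y] by simp
    next
      case False
      have "real (k v) * coord Y u v \<le> 0"
        using member_le_sum[of v F "\<lambda>v. real (k v) * coord Y u v"] nn u sum[of u] v(1) F(1) False by auto
      then have "real (k v) * coord Y u v = 0" using nn[OF v(1) u] by simp
      then show ?thesis using v(2) False cb[OF y] by auto
    qed
    then have "v = y"
      using coord_eqI[OF b(1), of v y] FC(1)[OF v(1)] cone span_base[OF y] by blast
    then show "y \<in> H" using v(1) F(2) by blast
  qed
  show "Hilb ?C = Y" unfolding Hilb_def
  proof (rule the_equality)
    show "gen_set_of ?C Y \<and> \<not> (\<exists>H'. H' \<subset> Y \<and> gen_set_of ?C H')" using gen least by blast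
    fix H assume "gen_set_of ?C H \<and> \<not> (\<exists>H'. H' \<subset> H \<and> gen_set_of ?C H')"
    then show "H = Y" using gen least by blast
  qed
qed

section \<open>Rational cones\<close>

lemma rational_vec_multiple:
  fixes s :: "real^'n"
  assumes "rational_vec s"
  obtains N :: nat where "0 < N" "real N *\<^sub>R s \<in> lattice_pts"
proof -
  have "\<exists>d :: nat. 0 < d \<and> real d * s $ i \<in> \<int>" for i
  proof -
    have "s $ i \<in> \<rat>" using assms by (simp add: rational_vec_def)
    then obtain a :: int and d :: nat where d: "s $ i = real_of_int a / real d" "d \<noteq> 0" unfolding Rats_eq_int_div_nat by blast
    then have "real d * s $ i = real_of_int a" by simp
    then show ?thesis using d(2) by (intro exI[of _ d]) simp
  qed
  then obtain d :: "'n \<Rightarrow> nat" where d: "\<And>i. 0 < d i \<and> real (d i) * s $ i \<in> \<int>" by metis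
  define N where "N = (\<Prod>i\<in>UNIV. d i)"
  have "real N * s $ i \<in> \<int>" for i
  proof -
    have "N = d i * (\<Prod>j\<in>UNIV - {i}. d j)" unfolding N_def by (rule prod.remove) auto
    then have "real N * s $ i = real (\<Prod>j\<in>UNIV - {i}. d j) * (real (d i) * s $ i)" by simp
    also have "\<dots> \<in> \<int>" by (rule Ints_mult[OF Ints_of_nat]) (use d in blast)
    finally show ?thesis .
  qed
  then show ?thesis using that[of N] d by (simp add: N_def lattice_pts_def prod_pos)
qed

text \<open>The one-generator case of \<open>unimodular_cone_at\<close>: the lattice points on the
  line through an integral multiple of \<open>s\<close> have a basis with a single vector, the
  primitive one.\<close>

lemma primitive_generator:
  fixes s :: "real^'n"
  assumes "rational_vec s" "s \<noteq> 0"
  obtains t where "0 < t" "t *\<^sub>R s \<in> lattice_pts"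
    "{r *\<^sub>R s | r. 0 \<le> r} \<inter> lattice_pts = {real k *\<^sub>R (t *\<^sub>R s) | k. True}"
proof -
  obtain N where N: "0 < N" "real N *\<^sub>R s \<in> lattice_pts" using rational_vec_multiple[OF assms(1)] .
  define w where "w = real N *\<^sub>R s"
  have w: "w \<noteq> 0" "w \<in> lattice_pts" using N assms(2) by (auto simp: w_def)
  have ind: "independent {w}" using w(1) by simp
  define L where "L = lattice_pts \<inter> span {w}"
  have F: "lattice_frame {w} L" unfolding L_def using w(2) by (intro lattice_frame_lattice_pts[OF ind]) simp
  have "w \<in> nonneg_span {w}" by (rule nonneg_span_base) auto
  then obtain Y where Y: "lattice_basis Y L" "Y \<subseteq> nonneg_span {w}" using unimodular_cone_at[OF F] by blast
  note b = lattice_basisD[OF Y(1)]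
  have "Y \<subseteq> span {w}" using Y(2) nonneg_span_span by blast
  then have "card Y \<le> 1" using independent_span_bound[of "{w}" Y] b(1) by simp
  moreover have "Y \<noteq> {}"
  proof
    assume "Y = {}"
    moreover have "w \<in> L" using w(2) by (simp add: L_def span_base)
    ultimately show False using b(3) w(1) by auto
  qed
  ultimately obtain v where v: "Y = {v}" using b(5) by (metis card_0_eq card_1_singletonE le_neq_implies_less less_one)
  obtain a where a: "0 \<le> a" "v = a *\<^sub>R w" using Y(2) v by (auto simp: nonneg_span_def)
  have v0: "v \<noteq> 0" using b(1) v by auto
  define t where "t = a * real N"
  have vt: "v = t *\<^sub>R s" by (simp add: a(2) w_def t_def)
  have t0: "0 < t" using v0 vt a(1) by (cases "t = 0") (auto simp: t_def zero_less_mult_iff)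
  have vL: "v \<in> lattice_pts" using b(2) v by (simp add: L_def)
  have "{r *\<^sub>R s | r. 0 \<le> r} \<inter> lattice_pts = {real k *\<^sub>R v | k. True}"
  proof
    show "{real k *\<^sub>R v | k. True} \<subseteq> {r *\<^sub>R s | r. 0 \<le> r} \<inter> lattice_pts"
    proof
      fix x assume "x \<in> {real k *\<^sub>R v | k. True}"
      then obtain k where k: "x = real k *\<^sub>R v" by blast
      then have "x = (real k * t) *\<^sub>R s" "0 \<le> real k * t" using vt t0 by auto
      moreover have "x \<in> lattice_pts" unfolding k using vL by (intro zsubgroup_int_scale[OF zsubgroup_lattice_pts]) auto
      ultimately show "x \<in> {r *\<^sub>R s | r. 0 \<le> r} \<inter> lattice_pts" by blast
    qed
    show "{r *\<^sub>R s | r. 0 \<le> r} \<inter> lattice_pts \<subseteq> {real k *\<^sub>R v | k. True}"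
    proof
      fix x assume x: "x \<in> {r *\<^sub>R s | r. 0 \<le> r} \<inter> lattice_pts"
      then obtain r where r: "0 \<le> r" "x = r *\<^sub>R s" by blast
      have "x = (r / real N) *\<^sub>R w" using N(1) by (simp add: r(2) w_def)
      then have "x \<in> L" using x by (simp add: L_def span_base span_scale)
      then have int: "coord Y v x \<in> \<int>" using b(6) v by blast
      have xv: "x = (r / t) *\<^sub>R v" using t0 by (simp add: r(2) vt)
      moreover have "coord Y v v = 1" using coord_basis[OF b(1), of v v] v by simp
      ultimately have "coord Y v x = r / t" by (simp add: linear_scale[OF linear_coord[OF b(1)]])
      then have "r / t \<in> \<int>" "0 \<le> r / t" using int r(1) t0 by auto
      then obtain k where "r / t = real k"
        by (metis Ints_cases nonneg_int_cases of_int_0_le_iff of_int_of_nat_eq)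
      then show "x \<in> {real k *\<^sub>R v | k. True}" using xv by auto
    qed
  qed
  then show ?thesis using that[OF t0] vL vt by simp
qed

text \<open>In a rational generating set of least cardinality no generator lies in the cone of the
  others, so each spans an edge by \<open>cone_face_ray\<close>. Rescaling to the primitive vector
  makes it an extreme integral generator.\<close>

lemma rational_cone_generators:
  assumes "rational_cone (C :: (real^'n) set)"
  obtains E where "finite E" "E \<subseteq> extreme_gens C" "E \<subseteq> lattice_pts" "C = nonneg_span E"
proof -
  have pointed: "C \<inter> uminus ` C = {0}" using assms by (simp add: rational_cone_def)
  define Q where "Q n \<longleftrightarrow> (\<exists>S. finite S \<and> (\<forall>v\<in>S. rational_vec v) \<and> C = nonneg_span S \<and> card S = n)" for n
  have "\<exists>n. Q n" using assms by (auto simp: rational_cone_def Q_def)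
  then have "Q (LEAST n. Q n)" by (rule LeastI_ex)
  then obtain S where S: "finite S" "\<forall>v\<in>S. rational_vec v" "C = nonneg_span S" "card S = (LEAST n. Q n)"
    unfolding Q_def by blast
  have min: "s \<notin> nonneg_span (S - {s})" if s: "s \<in> S" for s
  proof
    assume a: "s \<in> nonneg_span (S - {s})"
    have "S - {s} \<subseteq> nonneg_span (S - {s})" using nonneg_span_base[of "S - {s}"] S(1) by blast
    then have "S \<subseteq> nonneg_span (S - {s})" using a by blast
    then have "nonneg_span S \<subseteq> nonneg_span (S - {s})" by (rule nonneg_span_subset)
    moreover have "nonneg_span (S - {s}) \<subseteq> nonneg_span S" by (rule nonneg_span_mono[OF S(1)]) blast
    ultimately have "C = nonneg_span (S - {s})" using S(3) by blast
    then have "Q (card (S - {s}))" unfolding Q_def using S(1,2) by blast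
    then have "card S \<le> card (S - {s})" unfolding S(4) by (rule Least_le)
    then show False using card_Diff1_less[OF S(1) s] by simp
  qed
  have nz: "s \<noteq> 0" if "s \<in> S" for s using min[OF that] nonneg_span_zero by blast
  define prim where "prim s r \<longleftrightarrow> 0 < r \<and> r *\<^sub>R s \<in> lattice_pts \<and>
      {r *\<^sub>R s | r. 0 \<le> r} \<inter> lattice_pts = {real k *\<^sub>R (r *\<^sub>R s) | k. True}" for s :: "real^'n" and r
  have "\<exists>r. prim s r" if "s \<in> S" for s
  proof -
    have "rational_vec s" "s \<noteq> 0" using S(2) nz that by auto
    then obtain r where "0 < r" "r *\<^sub>R s \<in> lattice_pts"
      "{r *\<^sub>R s | r. 0 \<le> r} \<inter> lattice_pts = {real k *\<^sub>R (r *\<^sub>R s) | k. True}"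
      by (rule primitive_generator)
    then show ?thesis unfolding prim_def by (intro exI[of _ r] conjI)
  qed
  then obtain t where "\<And>s. s \<in> S \<Longrightarrow> prim s (t s)" by metis
  then have t: "0 < t s" "t s *\<^sub>R s \<in> lattice_pts"
    "{r *\<^sub>R s | r. 0 \<le> r} \<inter> lattice_pts = {real k *\<^sub>R (t s *\<^sub>R s) | k. True}" if "s \<in> S" for s
    using that unfolding prim_def by blast+
  define E where "E = (\<lambda>s. t s *\<^sub>R s) ` S"
  have finE: "finite E" using S(1) by (simp add: E_def)
  have "E \<subseteq> extreme_gens C"
  proof
    fix v assume "v \<in> E"
    then obtain s where s: "s \<in> S" "v = t s *\<^sub>R s" by (auto simp: E_def)
    note face = cone_face_ray[OF S(1) pointed[unfolded S(3)] s(1) min[OF s(1)], folded S(3)]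
    have "v \<in> {r *\<^sub>R s | r. 0 \<le> r} \<inter> lattice_pts"
      using less_imp_le[OF t(1)[OF s(1)]] t(2)[OF s(1)] unfolding s(2) by (intro IntI CollectI exI[of _ "t s"] conjI refl)
    moreover have "v \<noteq> 0" using t(1)[OF s(1)] nz[OF s(1)] s(2) by simp
    ultimately show "v \<in> extreme_gens C" unfolding extreme_gens_def mem_Collect_eq
      using face t(3)[OF s(1)] unfolding s(2) by (intro exI[of _ "{r *\<^sub>R s | r. 0 \<le> r}"] conjI)
  qed
  moreover have "E \<subseteq> lattice_pts" using t(2) by (auto simp: E_def)
  moreover have "nonneg_span E \<subseteq> C" unfolding S(3)
  proof (rule nonneg_span_subset, rule subsetI)
    fix v assume "v \<in> E"
    then obtain s where "s \<in> S" "v = t s *\<^sub>R s" by (auto simp: E_def)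
    then show "v \<in> nonneg_span S"
      using nonneg_span_scale[OF nonneg_span_base[OF S(1)]] t(1) less_imp_le by metis
  qed
  moreover have "C \<subseteq> nonneg_span E" unfolding S(3)
  proof (rule nonneg_span_subset, rule subsetI)
    fix s assume s: "s \<in> S"
    then have "(1 / t s) *\<^sub>R (t s *\<^sub>R s) \<in> nonneg_span E"
      using t(1)[OF s] by (intro nonneg_span_scale nonneg_span_base[OF finE]) (auto simp: E_def)
    then show "s \<in> nonneg_span E" using t(1)[OF s] by simp
  qed
  ultimately show ?thesis using that finE by blast
qed

section \<open>Finite unimodular covers\<close>

lemma cone_caratheodory:
  fixes E :: "(real^'n) set"
  shows "finite E \<Longrightarrow> p \<in> nonneg_span E \<Longrightarrow> \<exists>V\<subseteq>E. independent V \<and> p \<in> nonneg_span V"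
proof (induction "card E" arbitrary: E rule: less_induct)
  case less
  show ?case
  proof (cases "independent E")
    case True
    then show ?thesis using less.prems by blast
  next
    case False
    then obtain c0 where c0: "\<exists>v\<in>E. c0 v \<noteq> 0" "(\<Sum>v\<in>E. c0 v *\<^sub>R v) = 0"
      using dependent_finite[OF less.prems(1)] by auto
    \<comment> \<open>After a possible change of sign some coefficient is positive, so moving along
      the relation is stopped when a coefficient of \<open>p\<close> reaches 0.\<close>
    obtain c where c: "\<exists>v\<in>E. 0 < c v" "(\<Sum>v\<in>E. c v *\<^sub>R v) = 0"
    proof (cases "\<exists>v\<in>E. 0 < c0 v")
      case True
      then show ?thesis using that c0 by blast
    next
      case False
      then have "\<exists>v\<in>E. 0 < - c0 v" using c0(1) by force
      moreover have "(\<Sum>v\<in>E. (- c0 v) *\<^sub>R v) = 0" using c0(2) by (simp add: sum_negf)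
      ultimately show ?thesis using that[of "\<lambda>v. - c0 v"] by blast
    qed
    obtain a where a: "\<And>v. v \<in> E \<Longrightarrow> 0 \<le> a v" "p = (\<Sum>v\<in>E. a v *\<^sub>R v)"
      using less.prems(2) by (auto simp: nonneg_span_def)
    define P where "P = {v\<in>E. 0 < c v}"
    have "finite P" "P \<noteq> {}" using less.prems(1) c(1) by (auto simp: P_def)
    then obtain u where u: "u \<in> P" and "\<not> (\<exists>v\<in>P. a v / c v < a u / c u)"
      using arg_min_if_finite[of P "\<lambda>v. a v / c v"] by blast
    then have umin: "a u / c u \<le> a v / c v" if "v \<in> P" for v using that by force
    have uE: "u \<in> E" "0 < c u" using u by (auto simp: P_def)
    define a' where "a' v = a v - a u / c u * c v" for v
    have a'0: "0 \<le> a' v" if v: "v \<in> E" for v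
    proof (cases "v \<in> P")
      case True
      then show ?thesis using umin[OF True] by (simp add: a'_def P_def field_simps)
    next
      case False
      then have "a u / c u * c v \<le> 0" using v a(1)[OF uE(1)] uE(2) by (intro mult_nonneg_nonpos) (auto simp: P_def)
      then show ?thesis using a(1)[OF v] by (simp add: a'_def)
    qed
    have "(\<Sum>v\<in>E. a' v *\<^sub>R v) = (\<Sum>v\<in>E. a v *\<^sub>R v) - (a u / c u) *\<^sub>R (\<Sum>v\<in>E. c v *\<^sub>R v)"
      by (simp add: a'_def scaleR_diff_left sum_subtractf scaleR_sum_right)
    then have "p = (\<Sum>v\<in>E. a' v *\<^sub>R v)" using a(2) c(2) by simp
    also have "\<dots> = a' u *\<^sub>R u + (\<Sum>v\<in>E - {u}. a' v *\<^sub>R v)" by (rule sum.remove[OF less.prems(1) uE(1)])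
    also have "a' u = 0" using uE(2) by (simp add: a'_def)
    finally have "p \<in> nonneg_span (E - {u})" using a'0 by (auto simp: nonneg_span_def)
    then obtain V where "V \<subseteq> E - {u}" "independent V" "p \<in> nonneg_span V"
      using less.hyps[of "E - {u}"] card_Diff1_less[OF less.prems(1) uE(1)] less.prems(1) by blast
    then show ?thesis by blast
  qed
qed

text \<open>The weights \<open>coord V v y / c\<close> sum to at most 1, and the origin takes up the
  rest. This converts degree bounds into membership in the dilated \<open>Delta C\<close>.\<close>

lemma deg_dilate:
  assumes V: "independent V" "V \<subseteq> extreme_gens C" and y: "y \<in> nonneg_span V" "deg V y \<le> c" and c: "0 < c"
  shows "y \<in> dilate c (Delta C)"
proof -
  have ys: "y \<in> span V" "\<forall>v\<in>V. 0 \<le> coord V v y" using y(1) nonneg_span_coord[OF V(1)] by auto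
  have fin: "finite V" by (rule indep_finite[OF V(1)])
  have z: "0 \<notin> V" using V(1) dependent_zero by blast
  define w where "w v = (if v = 0 then 1 - deg V y / c else coord V v y / c)" for v
  have sumV: "(\<Sum>v\<in>V. w v) = deg V y / c" unfolding deg_def sum_divide_distrib
    using z by (intro sum.cong) (auto simp: w_def)
  have sub: "insert 0 V \<subseteq> Delta C" unfolding Delta_def
    using V(2) hull_subset[of "insert 0 (extreme_gens C)" convex] by blast
  have "(\<Sum>v\<in>insert 0 V. w v *\<^sub>R v) \<in> Delta C"
  proof (rule convex_sum)
    show "convex (Delta C)" by (simp add: Delta_def)
    show "(\<Sum>v\<in>insert 0 V. w v) = 1" using fin z sumV by (simp add: w_def)
    show "0 \<le> w v" if "v \<in> insert 0 V" for v
      using that ys(2) y(2) c z by (auto simp: w_def divide_le_eq)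
    show "v \<in> Delta C" if "v \<in> insert 0 V" for v using that sub by blast
  qed (use fin in simp)
  also have "(\<Sum>v\<in>insert 0 V. w v *\<^sub>R v) = (\<Sum>v\<in>V. (coord V v y / c) *\<^sub>R v)"
    using fin z by (auto simp: w_def intro!: sum.cong)
  finally have "(\<Sum>v\<in>V. (coord V v y / c) *\<^sub>R v) \<in> Delta C" .
  moreover have "y = c *\<^sub>R (\<Sum>v\<in>V. (coord V v y / c) *\<^sub>R v)"
    using span_lincomb[OF V(1) ys(1)] c by (simp add: scaleR_sum_right)
  ultimately show ?thesis unfolding dilate_def by blast
qed

text \<open>The basis produced for a point depends on the point, but its members lie in
  \<open>U\<close>, the lattice points of degree at most \<open>c\<close> over the full-dimensional
  independent subsets of \<open>E\<close>. \<open>U\<close> is finite, so only finitely many cones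
  arise.\<close>

lemma bounded_unimodular_cover:
  fixes C :: "(real^'n) set"
  assumes C: "rational_cone C" "aff_dim C = int CARD('n)" and c: "degree_bound CARD('n) \<le> real c"
  shows "has_bounded_unimod_cover C c"
proof -
  obtain E where E: "finite E" "E \<subseteq> extreme_gens C" "E \<subseteq> lattice_pts" "C = nonneg_span E"
    using rational_cone_generators[OF C(1)] .
  have "0 \<in> C" using E(4) nonneg_span_zero by blast
  then have "dim C = CARD('n)" using C(2) aff_dim_zero[of C] hull_inc[of 0 C affine] by simp
  moreover have "dim C \<le> dim E" using E(4) nonneg_span_span by (metis dim_span dim_subset)
  ultimately have "dim (span E) = DIM(real^'n)" using dim_subset_UNIV[of E] by simp
  then have spE: "span E = UNIV" using dim_eq_full by (metis dim_span)
  define \<V> where "\<V> = {V. V \<subseteq> E \<and> independent V \<and> card V = CARD('n)}"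
  define R where "R V = {y \<in> lattice_pts. y \<in> nonneg_span V \<and> deg V y \<le> real c}" for V :: "(real^'n) set"
  have c0: "0 < real c" using c degree_bound_ge_one[of "CARD('n)"] by linarith
  have finR: "finite (R V)" if V: "V \<in> \<V>" for V
  proof -
    have ind: "independent V" using V by (simp add: \<V>_def)
    have "R V \<subseteq> lattice_pts \<inter> {x\<in>span V. \<forall>v\<in>V. 0 \<le> coord V v x \<and> coord V v x \<le> real c}"
    proof
      fix x assume x: "x \<in> R V"
      then have xc: "x \<in> span V" "\<forall>v\<in>V. 0 \<le> coord V v x" using nonneg_span_coord[OF ind] by (auto simp: R_def)
      have "coord V v x \<le> deg V x" if "v \<in> V" for v unfolding deg_def
        using xc(2) that by (intro member_le_sum indep_finite[OF ind]) auto
      then show "x \<in> lattice_pts \<inter> {x\<in>span V. \<forall>v\<in>V. 0 \<le> coord V v x \<and> coord V v x \<le> real c}"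
        using x xc by (fastforce simp: R_def)
    qed
    then show ?thesis using finite_lattice_bounded[OF bounded_coord[OF ind]] finite_subset by blast
  qed
  define U where "U = (\<Union>V\<in>\<V>. R V)"
  have "finite \<V>" using E(1) by (simp add: \<V>_def)
  then have finU: "finite U" unfolding U_def using finR by blast
  define \<F> where "\<F> = nonneg_span ` {Y. Y \<subseteq> U \<and> lattice_basis Y lattice_pts}"
  have "finite {Y. Y \<subseteq> U \<and> lattice_basis Y lattice_pts}"
    by (rule finite_subset[of _ "Pow U"]) (use finU in auto)
  then have "finite \<F>" by (simp add: \<F>_def)
  moreover have "\<Union>\<F> = C"
  proof
    have "U \<subseteq> C"
      unfolding U_def R_def \<V>_def E(4) using nonneg_span_mono[OF E(1)] by blast
    then have "nonneg_span Y \<subseteq> C" if "Y \<subseteq> U" for Y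
      using nonneg_span_subset[of Y E] that unfolding E(4) by blast
    then show "\<Union>\<F> \<subseteq> C" unfolding \<F>_def by blast
    show "C \<subseteq> \<Union>\<F>"
    proof
      fix p assume "p \<in> C"
      then obtain V0 where V0: "V0 \<subseteq> E" "independent V0" "p \<in> nonneg_span V0"
        using cone_caratheodory[OF E(1)] E(4) by blast
      \<comment> \<open>Enlarging \<open>V0\<close> to a basis of the whole space keeps
        \<open>p\<close> in the cone and turns the ambient lattice into all of
        \<open>lattice_pts\<close>.\<close>
      obtain V where V: "V0 \<subseteq> V" "V \<subseteq> E" "independent V" "E \<subseteq> span V"
        using maximal_independent_subset_extend[OF V0(1,2)] by blast
      have spV: "span V = UNIV" using span_minimal[OF V(4) subspace_span] spE by blast
      have "card V = dim (span V)" using dim_span_eq_card_independent[OF V(3)] by simp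
      then have cardV: "card V = CARD('n)" using spV by simp
      then have VV: "V \<in> \<V>" using V(2,3) by (simp add: \<V>_def)
      have F: "lattice_frame V lattice_pts"
        using lattice_frame_lattice_pts[OF V(3)] V(2) E(3) spV by simp
      have "p \<in> nonneg_span V" using nonneg_span_mono[OF indep_finite[OF V(3)] V(1)] V0(3) by blast
      then obtain Y where Y: "lattice_basis Y lattice_pts" "Y \<subseteq> nonneg_span V" "p \<in> nonneg_span Y"
        "\<forall>y\<in>Y. deg V y \<le> degree_bound (card V)"
        using unimodular_cone_at[OF F] by blast
      have "Y \<subseteq> R V" using Y c lattice_basisD(2)[OF Y(1)] by (auto simp: R_def cardV)
      then have "Y \<subseteq> U" using VV by (auto simp: U_def)
      then show "p \<in> \<Union>\<F>" using Y(1,3) by (auto simp: \<F>_def)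
    qed
  qed
  moreover have "unimodular_cone D \<and> Hilb D \<subseteq> dilate (real c) (Delta C)" if D: "D \<in> \<F>" for D
  proof -
    obtain Y where Y: "D = nonneg_span Y" "Y \<subseteq> U" "lattice_basis Y lattice_pts" using D by (auto simp: \<F>_def)
    have "U \<subseteq> dilate (real c) (Delta C)"
    proof
      fix y assume "y \<in> U"
      then obtain V where V: "V \<subseteq> E" "independent V" "y \<in> nonneg_span V" "deg V y \<le> real c"
        by (auto simp: U_def R_def \<V>_def)
      have "V \<subseteq> extreme_gens C" using V(1) E(2) by blast
      then show "y \<in> dilate (real c) (Delta C)" by (rule deg_dilate[OF V(2) _ V(3,4) c0])
    qed
    then show ?thesis
      using basis_cone_unimodular[OF Y(3)] basis_cone_Hilb[OF Y(3)] Y(1,2) by auto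
  qed
  ultimately show ?thesis unfolding has_bounded_unimod_cover_def by blast
qed

text \<open>For \<open>d \<ge> 3\<close> the rounded root is at least 2, so the power on the right
  is at least the square of \<open>P = (3/2) ^ (d - 2)\<close>; one factor \<open>P\<close> matches
  the left-hand side and the other, at least 3/2, absorbs the larger leading coefficient. For
  \<open>d = 2\<close> both sides equal 2.\<close>

lemma degree_bound_le_bound:
  assumes d: "2 \<le> d"
  shows "degree_bound d + 1 \<le> real_of_int \<lceil>sqrt (real d - 1)\<rceil> * (real d - 1)
           * (real d * (real d + 1) / 2)
           * (3/2) powr (real_of_int \<lceil>sqrt (real d - 1)\<rceil> * (real d - 1) - 2)"
proof (cases "d = 2")
  case True
  have "(3/2::real) powr - 1 = 2/3" by (simp add: powr_minus)
  then show ?thesis using True by (simp add: degree_bound_def)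
next
  case False
  then have d3: "3 \<le> d" using d by simp
  define x where "x = real d"
  have x3: "3 \<le> x" using d3 by (simp add: x_def)
  define g where "g = real_of_int \<lceil>sqrt (x - 1)\<rceil> * (x - 1)"
  have "1 < sqrt (x - 1)" using x3 by simp
  then have "2 \<le> \<lceil>sqrt (x - 1)\<rceil>" by linarith
  then have "2 \<le> real_of_int \<lceil>sqrt (x - 1)\<rceil>" by simp
  then have g: "2 * (x - 1) \<le> g" unfolding g_def using x3 by (intro mult_right_mono) auto
  define P where "P = (3/2::real) ^ (d - 2)"
  have "(3/2::real) ^ 1 \<le> P" unfolding P_def using d3 by (intro power_increasing) auto
  then have P: "3/2 \<le> P" by simp
  have "(3/2::real) powr (2 * (x - 1) - 2) = (3/2) powr (real (2 * (d - 2)))"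
    using d3 by (simp add: x_def of_nat_diff)
  also have "\<dots> = (3/2) ^ (2 * (d - 2))" by (rule powr_realpow) simp
  also have "\<dots> = P * P" by (simp add: P_def power2_eq_square power_mult mult.commute flip: power_mult_distrib)
  finally have "P * P = (3/2) powr (2 * (x - 1) - 2)" ..
  also have "\<dots> \<le> (3/2) powr (g - 2)" using g by (intro powr_mono) auto
  finally have PP: "P * P \<le> (3/2) powr (g - 2)" .
  have "degree_bound d = x * (3 * x\<^sup>2 - 4 * x + 2) / 2 * P" using d3 by (simp add: degree_bound_def x_def P_def)
  also have "\<dots> + 1 \<le> (x - 1) * (x * (x + 1)) * (3/2) * P"
  proof -
    \<comment> \<open>The cubic terms of the two sides cancel, and this product is exactly their
      difference.\<close>
    have "1 * 1 \<le> (x * (4 * x - 5) / 2) * P"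
    proof (rule mult_mono)
      have "3 * 7 \<le> x * (4 * x - 5)" using x3 by (intro mult_mono) auto
      then show "1 \<le> x * (4 * x - 5) / 2" "0 \<le> x * (4 * x - 5) / 2" by simp_all
    qed (use P in auto)
    also have "\<dots> = (x - 1) * (x * (x + 1)) * (3/2) * P - x * (3 * x\<^sup>2 - 4 * x + 2) / 2 * P"
      by (simp add: field_simps power2_eq_square)
    finally show ?thesis by simp
  qed
  also have "\<dots> \<le> (x - 1) * (x * (x + 1)) * P * P"
  proof -
    have "(x - 1) * (x * (x + 1)) * P * (3/2) \<le> (x - 1) * (x * (x + 1)) * P * P"
      using x3 P by (intro mult_left_mono) auto
    then show ?thesis by (simp add: mult_ac)
  qed
  also have "\<dots> = 2 * (x - 1) * (x * (x + 1) / 2) * (P * P)" by simp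
  also have "\<dots> \<le> g * (x * (x + 1) / 2) * (3/2) powr (g - 2)"
    using g PP x3 P by (intro mult_mono) auto
  finally show ?thesis by (simp add: g_def x_def)
qed

theorem theorem1p2:
  assumes "CARD('n::finite) \<ge> 2"
  shows "c_cone TYPE('n) \<le>
    ereal (real_of_int \<lceil>sqrt (real CARD('n) - 1)\<rceil> * (real CARD('n) - 1)
           * (real CARD('n) * (real CARD('n) + 1) / 2)
           * (3/2) powr (real_of_int \<lceil>sqrt (real CARD('n) - 1)\<rceil> * (real CARD('n) - 1) - 2))"
    (is "_ \<le> ereal ?b")
proof -
  \<comment> \<open>The infimum runs over natural numbers, while the bound may fail to be an
    integer; the \<open>+ 1\<close> in \<open>degree_bound_le_bound\<close> keeps its floor above
    \<open>degree_bound\<close>.\<close>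
  define c where "c = nat \<lfloor>?b\<rfloor>"
  have t: "degree_bound CARD('n) + 1 \<le> ?b" by (rule degree_bound_le_bound[OF assms])
  then have b0: "0 \<le> ?b" using degree_bound_ge_one[of "CARD('n)"] by linarith
  then have c: "real c \<le> ?b" "degree_bound CARD('n) \<le> real c"
    unfolding c_def using t by linarith+
  have "c_cone TYPE('n) \<le> ereal (real c)"
    unfolding c_cone_def using bounded_unimodular_cover[OF _ _ c(2)] by (intro Inf_lower) blast
  also have "\<dots> \<le> ereal ?b" using c(1) by simp
  finally show ?thesis .
qed

end
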